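(* Let $A$ be a separating invariant algebra on a compact Hausdorff group $G$. Then the maximal ideal space $\mathcal{M}_A$ with the convolution multiplication $*$ is a compact topological semigroup. The mapping $\mathrm{ev}: g\mapsto \mathrm{ev}_g$ realizes an isomorphic embedding of $G$ into $\mathcal{M}_A$ (identify $G$ with its image). The identity element $e\in G$ is the unit of $\mathcal{M}_A$, and the group $\mathcal{M}_A^{-1}$ of invertible elements of $\mathcal{M}_A$ equals $G$; moreover, the conditions $\varphi,\psi\in\mathcal{M}_A$ and $\varphi*\psi\in G$ imply $\varphi,\psi\in G$. The involution $\varphi\mapsto\varphi^*$ is an involutive antiautomorphism of the semigroup $\mathcal{M}_A$, which coincides with the inversion $g\mapsto g^{-1}$ on $G$.
   Context: $C(G)$ is the Banach algebra of continuous complex functions on $G$ with the sup-norm. Translations: $L_gf(h)=f(gh)$, $R_gf(h)=f(hg)$. An invariant algebra on $G$ is a closed subalgebra $A\subseteq C(G)$ that contains the constants and satisfies $L_gA\subseteq A$, $R_gA\subseteq A$ for all $g\in G$. It is separating if for any $x\ne y$ in $G$ there is $f\in A$ with $f(x)\neq f(y)$. $\mathcal{M}_A$ is the set of all nonzero multiplicative linear functionals $A\to\mathbb{C}$ with the weak-* topology of the dual $A'$; $\mathrm{ev}_g(f)=f(g)$. Multiplication: for $f\in A$ put $\iota(f)(g,h)=f(gh)$; then $\iota(f)$ lies in the closure of $A\otimes A$ in $C(G\times G)$. For $\varphi,\psi\in A'$, $(\varphi*\psi)(f)=(\varphi\otimes\psi)(\iota(f))$. Equivalently, $(\varphi*\psi)(f)=\int_{G\times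 G}f(gh)\,d\mu(g)\,d\nu(h)$ for any finite regular Borel complex measures $\mu,\nu$ on $G$ whose integrals extend $\varphi,\psi$ from $A$ to $C(G)$. Involution: $f^\star(g)=\overline{f(g^{-1})}$ (every invariant algebra satisfies $A^\star=A$), and $\varphi^*(f)=\overline{\varphi(f^\star)}$ for $f\in A$. *)

theory Defs
  imports "HOL-Analysis.Analysis" "HOL-Algebra.Group"
begin

definition compact_Hausdorff_group :: "('a, 'b) monoid_scheme \<Rightarrow> 'a topology \<Rightarrow> bool" where
  "compact_Hausdorff_group G T \<longleftrightarrow>
     group G \<and> topspace T = carrier G \<and> compact_space T \<and> Hausdorff_space T \<and>
     continuous_map (prod_topology T T) T (\<lambda>(x, y). x \<otimes>\<^bsub>G\<^esub> y) \<and>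
     continuous_map T T (\<lambda>x. inv\<^bsub>G\<^esub> x)"

definition compact_topological_semigroup :: "('a, 'b) monoid_scheme \<Rightarrow> 'a topology \<Rightarrow> bool" where
  "compact_topological_semigroup S X \<longleftrightarrow>
     topspace X = carrier S \<and> compact_space X \<and> Hausdorff_space X \<and>
     (\<forall>x\<in>carrier S. \<forall>y\<in>carrier S. x \<otimes>\<^bsub>S\<^esub> y \<in> carrier S) \<and>
     (\<forall>x\<in>carrier S. \<forall>y\<in>carrier S. \<forall>z\<in>carrier S.
        (x \<otimes>\<^bsub>S\<^esub> y) \<otimes>\<^bsub>S\<^esub> z = x \<otimes>\<^bsub>S\<^esub> (y \<otimes>\<^bsub>S\<^esub> z)) \<and>
     continuous_map (prod_topology X X) X (\<lambda>(x, y). x \<otimes>\<^bsub>S\<^esub> y)"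

text \<open>Automorphisms of a topological semigroup are understood to be homeomorphisms.\<close>

definition involutive_antiautomorphism ::
    "('a, 'b) monoid_scheme \<Rightarrow> 'a topology \<Rightarrow> ('a \<Rightarrow> 'a) \<Rightarrow> bool" where
  "involutive_antiautomorphism S X s \<longleftrightarrow>
     bij_betw s (carrier S) (carrier S) \<and> homeomorphic_map X X s \<and>
     (\<forall>x\<in>carrier S. \<forall>y\<in>carrier S. s (x \<otimes>\<^bsub>S\<^esub> y) = s y \<otimes>\<^bsub>S\<^esub> s x) \<and>
     (\<forall>x\<in>carrier S. s (s x) = x)"

text \<open>
  Functions on a space are extensional: they equal \<^term>\<open>undefined\<close> outside the
  carrier. Likewise functionals on a function space \<open>E\<close> are extensional on \<open>E\<close>, so
  equality of functions or functionals is equality on the intended domain. For compact \<open>X\<close>,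
  the library's space \<open>cfunspace X euclidean_metric\<close> of bounded continuous functions with the
  sup-metric is \<open>C(X)\<close>.
\<close>

abbreviation C_space :: "'a topology \<Rightarrow> ('a \<Rightarrow> complex) metric" where
  "C_space X \<equiv> cfunspace X euclidean_metric"

definition closed_subalgebra :: "'a topology \<Rightarrow> ('a \<Rightarrow> complex) set \<Rightarrow> bool" where
  "closed_subalgebra X A \<longleftrightarrow>
     A \<subseteq> mspace (C_space X) \<and> closedin (mtopology_of (C_space X)) A \<and> A \<noteq> {} \<and>
     (\<forall>f\<in>A. \<forall>g\<in>A. (\<lambda>x\<in>topspace X. f x + g x) \<in> A) \<and>
     (\<forall>c. \<forall>f\<in>A. (\<lambda>x\<in>topspace X. c * f x) \<in> A) \<and>
     (\<forall>f\<in>A. \<forall>g\<in>A. (\<lambda>x\<in>topspace X. f x * g x) \<in> A)"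

definition left_translate ::
    "('a, 'b) monoid_scheme \<Rightarrow> 'a \<Rightarrow> ('a \<Rightarrow> complex) \<Rightarrow> 'a \<Rightarrow> complex" where
  "left_translate G g f = (\<lambda>h\<in>carrier G. f (g \<otimes>\<^bsub>G\<^esub> h))"

definition right_translate ::
    "('a, 'b) monoid_scheme \<Rightarrow> 'a \<Rightarrow> ('a \<Rightarrow> complex) \<Rightarrow> 'a \<Rightarrow> complex" where
  "right_translate G g f = (\<lambda>h\<in>carrier G. f (h \<otimes>\<^bsub>G\<^esub> g))"

definition invariant_algebra ::
    "('a, 'b) monoid_scheme \<Rightarrow> 'a topology \<Rightarrow> ('a \<Rightarrow> complex) set \<Rightarrow> bool" where
  "invariant_algebra G T A \<longleftrightarrow>
     closed_subalgebra T A \<and> (\<forall>c. (\<lambda>x\<in>carrier G. c) \<in> A) \<and>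
     (\<forall>g\<in>carrier G. left_translate G g ` A \<subseteq> A \<and> right_translate G g ` A \<subseteq> A)"

definition separating :: "('a, 'b) monoid_scheme \<Rightarrow> ('a \<Rightarrow> complex) set \<Rightarrow> bool" where
  "separating G A \<longleftrightarrow>
     (\<forall>x\<in>carrier G. \<forall>y\<in>carrier G. x \<noteq> y \<longrightarrow> (\<exists>f\<in>A. f x \<noteq> f y))"

definition linear_functionals ::
    "'a topology \<Rightarrow> ('a \<Rightarrow> complex) set \<Rightarrow> (('a \<Rightarrow> complex) \<Rightarrow> complex) set" where
  "linear_functionals X E = {\<Phi> \<in> extensional E.
     (\<forall>f\<in>E. \<forall>g\<in>E. \<Phi> (\<lambda>x\<in>topspace X. f x + g x) = \<Phi> f + \<Phi> g) \<and>
     (\<forall>c. \<forall>f\<in>E. \<Phi> (\<lambda>x\<in>topspace X. c * f x) = c * \<Phi> f)}"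

definition dual_space ::
    "'a topology \<Rightarrow> ('a \<Rightarrow> complex) set \<Rightarrow> (('a \<Rightarrow> complex) \<Rightarrow> complex) set" where
  "dual_space X E = {\<Phi> \<in> linear_functionals X E.
     continuous_map (subtopology (mtopology_of (C_space X)) E) euclidean \<Phi>}"

definition max_ideal_space ::
    "'a topology \<Rightarrow> ('a \<Rightarrow> complex) set \<Rightarrow> (('a \<Rightarrow> complex) \<Rightarrow> complex) set" where
  "max_ideal_space X A = {\<phi> \<in> linear_functionals X A.
     (\<forall>f\<in>A. \<forall>g\<in>A. \<phi> (\<lambda>x\<in>topspace X. f x * g x) = \<phi> f * \<phi> g) \<and> (\<exists>f\<in>A. \<phi> f \<noteq> 0)}"

text \<open>The weak-* topology is the topology of pointwise convergence on \<open>A\<close>.\<close>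

definition max_ideal_topology ::
    "'a topology \<Rightarrow> ('a \<Rightarrow> complex) set \<Rightarrow> (('a \<Rightarrow> complex) \<Rightarrow> complex) topology" where
  "max_ideal_topology X A =
     subtopology (product_topology (\<lambda>f. euclidean) A) (max_ideal_space X A)"

definition ev :: "('a \<Rightarrow> complex) set \<Rightarrow> 'a \<Rightarrow> ('a \<Rightarrow> complex) \<Rightarrow> complex" where
  "ev A g = (\<lambda>f\<in>A. f g)"

text \<open>The algebraic tensor product \<open>A \<otimes> A\<close>, realized in \<open>C(X \<times> X)\<close>, and its closure.\<close>

definition tensor_fun ::
    "'a topology \<Rightarrow> ('a \<Rightarrow> complex) \<Rightarrow> ('a \<Rightarrow> complex) \<Rightarrow> 'a \<times> 'a \<Rightarrow> complex" where
  "tensor_fun X a b = (\<lambda>(x, y)\<in>topspace X \<times> topspace X. a x * b y)"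

definition alg_tensor :: "'a topology \<Rightarrow> ('a \<Rightarrow> complex) set \<Rightarrow> ('a \<times> 'a \<Rightarrow> complex) set" where
  "alg_tensor X A =
     {\<lambda>p\<in>topspace X \<times> topspace X. \<Sum>i<n. tensor_fun X (a i) (b i) p
       | (n :: nat) a b. \<forall>i<n. a i \<in> A \<and> b i \<in> A}"

definition closed_tensor :: "'a topology \<Rightarrow> ('a \<Rightarrow> complex) set \<Rightarrow> ('a \<times> 'a \<Rightarrow> complex) set" where
  "closed_tensor X A =
     mtopology_of (C_space (prod_topology X X)) closure_of alg_tensor X A"

text \<open>
  For \<open>\<phi>, \<psi> \<in> A'\<close>, the functional \<open>\<phi> \<otimes> \<psi>\<close> is the unique continuous linear functional on the
  closure of \<open>A \<otimes> A\<close> with \<open>(\<phi> \<otimes> \<psi>)(a \<otimes> b) = \<phi>(a) \<psi>(b)\<close>.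
\<close>

definition tensor_functional ::
    "'a topology \<Rightarrow> ('a \<Rightarrow> complex) set \<Rightarrow> (('a \<Rightarrow> complex) \<Rightarrow> complex) \<Rightarrow>
     (('a \<Rightarrow> complex) \<Rightarrow> complex) \<Rightarrow> ('a \<times> 'a \<Rightarrow> complex) \<Rightarrow> complex" where
  "tensor_functional X A \<phi> \<psi> =
     (THE \<Phi>. \<Phi> \<in> dual_space (prod_topology X X) (closed_tensor X A) \<and>
             (\<forall>a\<in>A. \<forall>b\<in>A. \<Phi> (tensor_fun X a b) = \<phi> a * \<psi> b))"

definition comult ::
    "('a, 'b) monoid_scheme \<Rightarrow> ('a \<Rightarrow> complex) \<Rightarrow> 'a \<times> 'a \<Rightarrow> complex" where
  "comult G f = (\<lambda>(g, h)\<in>carrier G \<times> carrier G. f (g \<otimes>\<^bsub>G\<^esub> h))"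

definition convolution ::
    "('a, 'b) monoid_scheme \<Rightarrow> 'a topology \<Rightarrow> ('a \<Rightarrow> complex) set \<Rightarrow>
     (('a \<Rightarrow> complex) \<Rightarrow> complex) \<Rightarrow> (('a \<Rightarrow> complex) \<Rightarrow> complex) \<Rightarrow>
     ('a \<Rightarrow> complex) \<Rightarrow> complex" where
  "convolution G T A \<phi> \<psi> = (\<lambda>f\<in>A. tensor_functional T A \<phi> \<psi> (comult G f))"

definition star_fun ::
    "('a, 'b) monoid_scheme \<Rightarrow> ('a \<Rightarrow> complex) \<Rightarrow> 'a \<Rightarrow> complex" where
  "star_fun G f = (\<lambda>g\<in>carrier G. cnj (f (inv\<^bsub>G\<^esub> g)))"

definition involution ::
    "('a, 'b) monoid_scheme \<Rightarrow> ('a \<Rightarrow> complex) set \<Rightarrow>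
     (('a \<Rightarrow> complex) \<Rightarrow> complex) \<Rightarrow> ('a \<Rightarrow> complex) \<Rightarrow> complex" where
  "involution G A \<phi> = (\<lambda>f\<in>A. cnj (\<phi> (star_fun G f)))"

definition max_ideal_monoid ::
    "('a, 'b) monoid_scheme \<Rightarrow> 'a topology \<Rightarrow> ('a \<Rightarrow> complex) set \<Rightarrow>
     (('a \<Rightarrow> complex) \<Rightarrow> complex) monoid" where
  "max_ideal_monoid G T A =
     \<lparr>carrier = max_ideal_space T A, mult = convolution G T A, one = ev A \<one>\<^bsub>G\<^esub>\<rparr>"

end

theory Submission
  imports Defs
begin

text \<open>
  A left invariant mean on \<open>C(G)\<close> exists without measure theory: averages of a continuous function
  over right translates approach a constant. Convolving \<open>a \<in> A\<close> with an approximate identity, which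
  may be replaced by its approximate \<open>L\<^sup>2\<close> projection \<open>b \<in> A\<close>, gives
  \<open>a(g) \<approx> \<integral> a(gy) cnj(b(y)) dy\<close> uniformly in \<open>g\<close>. This formula, a substitute for the Peter-Weyl
  theorem, yields both that \<open>A\<close> is closed under \<open>f \<mapsto> f\<^sup>\<star>\<close> and that \<open>f(gh)\<close> is a uniform limit of
  sums \<open>\<Sum> a\<^sub>i(g) b\<^sub>i(h)\<close> with \<open>a\<^sub>i, b\<^sub>i \<in> A\<close>. If \<open>\<phi> * \<psi>\<close> is an evaluation then \<open>f \<mapsto> f * \<psi>\<close>, where
  \<open>(f * \<psi>)(x) = \<psi>(y \<mapsto> f(xy))\<close>, is an isometry of \<open>A\<close> commuting with left translations, and an
  argument in the style of the Shilov boundary shows that \<open>\<psi>\<close> is an evaluation.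
\<close>

section \<open>Continuous functions on compact spaces\<close>

text \<open>\<open>convolution\<close> is defined through the unique continuous functional on the
  closure of A \<otimes> A, so nothing can be computed before \<open>comult G f\<close> is known to
  lie in that closure; this forces an approximation theorem ahead of any algebra. No complete L2
  space and no representation theory is built: if an element of \<open>A\<close> nearly minimises
  the distance to the approximate identity, the difference of the two is nearly orthogonal to the
  left translates of the given function, and only that is used. Elements of the maximal ideal space
  are not assumed continuous; a geometric series makes them contractive, after which a convolution
  is an iterated application of two functionals and errors do not grow. Existence of means is proved
  on one side; inversion carries it to the other, and comparing the two sides gives uniqueness. The
  divisor argument likewise treats the right factor only, since the left one is then recovered by a
  translation.\<close>

lemma continuous_map_binop:
  fixes f :: "'a \<Rightarrow> 'b::topological_space" and g :: "'a \<Rightarrow> 'c::topological_space"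
  assumes f: "continuous_map X euclidean f" and g: "continuous_map X euclidean g"
    and h: "continuous_on UNIV (case_prod h)"
  shows "continuous_map X euclidean (\<lambda>x. h (f x) (g x))"
proof -
  have "continuous_map X (prod_topology euclidean euclidean) (\<lambda>x. (f x, g x))"
    using f g by (rule continuous_map_pairedI)
  moreover have "continuous_map (prod_topology euclidean euclidean) euclidean (case_prod h)"
    using h by (simp flip: continuous_map_iff_continuous2)
  ultimately have "continuous_map X euclidean (case_prod h \<circ> (\<lambda>x. (f x, g x)))"
    by (rule continuous_map_compose)
  then show ?thesis by (simp add: o_def)
qed

lemma continuous_map_unop:
  assumes "continuous_map X euclidean f" and "continuous_on UNIV h"
  shows "continuous_map X euclidean (\<lambda>x. h (f x))"
  using continuous_map_compose[of X _ f euclidean h] assms by (simp add: o_def)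

text \<open>The tube lemma supplies the uniformity: the open set on which \<open>H\<close> differs
  from its slice at \<open>p\<close> by less than \<open>e\<close> contains {p} times the compact
  factor. This replaces uniform continuity on the group.\<close>

lemma compact_parameter_net:
  fixes H :: "'p \<times> 'x \<Rightarrow> 'c::real_normed_vector"
  assumes H: "continuous_map (prod_topology P X) euclidean H" and X: "compact_space X"
    and p: "p \<in> topspace P" and e: "e > 0"
  obtains U where "openin P U" "p \<in> U"
    "\<And>q x. \<lbrakk>q \<in> U; x \<in> topspace X\<rbrakk> \<Longrightarrow> norm (H (q, x) - H (p, x)) < e"
proof -
  let ?D = "\<lambda>z. norm (H z - H (p, snd z))"
  have "continuous_map (prod_topology P X) (prod_topology P X) (\<lambda>z. (p, snd z))"
    using p by (intro continuous_map_pairedI) (auto simp: continuous_map_snd)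
  then have "continuous_map (prod_topology P X) euclidean (\<lambda>z. H (p, snd z))"
    using continuous_map_compose[OF _ H] by (simp add: o_def)
  with H have "continuous_map (prod_topology P X) euclidean ?D"
    by (rule continuous_map_binop[where h = "\<lambda>u v. norm (u - v)"])
       (auto simp: case_prod_unfold intro!: continuous_intros)
  then have "openin (prod_topology P X) {z \<in> topspace (prod_topology P X). ?D z \<in> {..<e}}"
    by (rule openin_continuous_map_preimage) auto
  moreover have "{p} \<times> topspace X \<subseteq> {z \<in> topspace (prod_topology P X). ?D z \<in> {..<e}}"
    using p e by auto
  ultimately have "\<exists>U V. openin P U \<and> openin X V \<and> p \<in> U \<and> topspace X \<subseteq> V \<and>
      U \<times> V \<subseteq> {z \<in> topspace (prod_topology P X). ?D z \<in> {..<e}}"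
    using X p by (intro tube_lemma_right) (simp_all add: compact_space_def)
  then obtain U V where UV: "openin P U" "p \<in> U" "topspace X \<subseteq> V"
    "U \<times> V \<subseteq> {z \<in> topspace (prod_topology P X). ?D z \<in> {..<e}}"
    by (elim exE conjE)
  show ?thesis
  proof
    show "norm (H (q, x) - H (p, x)) < e" if "q \<in> U" "x \<in> topspace X" for q x
      using subsetD[OF UV(4), of "(q, x)"] UV(3) that by auto
  qed (use UV in auto)
qed

lemma compact_bounded_norm:
  fixes F :: "'a \<Rightarrow> 'c::real_normed_vector"
  assumes "compact_space X" "continuous_map X euclidean F"
  obtains B where "B > 0" "\<And>x. x \<in> topspace X \<Longrightarrow> norm (F x) \<le> B"
proof -
  have "compact (F ` topspace X)"
    using image_compactin[OF _ assms(2)] assms(1) by (simp add: compact_space_def)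
  then obtain B where "B > 0" "\<forall>y\<in>F ` topspace X. norm y \<le> B"
    using bounded_pos compact_imp_bounded by blast
  then show ?thesis using that by auto
qed

text \<open>Errors \<open>inverse (real (Suc n))\<close> turn the approximants into a uniformly
  convergent sequence, to which the metric limit theorem applies.\<close>

lemma continuous_map_approximable:
  fixes F :: "'a \<Rightarrow> 'c::real_normed_vector"
  assumes "\<And>e. e > 0 \<Longrightarrow>
    \<exists>H. continuous_map X euclidean H \<and> (\<forall>x\<in>topspace X. norm (F x - H x) \<le> e)"
  shows "continuous_map X euclidean F"
proof -
  obtain H where H: "\<And>e. e > 0 \<Longrightarrow>
      continuous_map X euclidean (H e) \<and> (\<forall>x\<in>topspace X. norm (F x - H e x) \<le> e)"
    using assms by metis
  have "continuous_map X Met_TC.mtopology F"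
  proof (rule Met_TC.continuous_map_uniform_limit)
    show "\<forall>\<^sub>F n in sequentially. continuous_map X Met_TC.mtopology (H (inverse (real (Suc n))))"
      using H by (intro always_eventually) simp
    show "\<forall>\<^sub>F n in sequentially. \<forall>x\<in>topspace X. F x \<in> UNIV \<and> dist (H (inverse (real (Suc n))) x) (F x) < e"
      if "e > 0" for e
    proof -
      have "\<forall>\<^sub>F n in sequentially. inverse (real (Suc n)) < e"
        using order_tendstoD(2)[OF LIMSEQ_inverse_real_of_nat that] .
      then show ?thesis
      proof eventually_elim
        case (elim n)
        have "\<forall>x\<in>topspace X. norm (F x - H (inverse (real (Suc n))) x) \<le> inverse (real (Suc n))"
          using H[of "inverse (real (Suc n))"] by simp
        with elim show ?case by (auto simp: dist_norm norm_minus_commute intro: le_less_trans)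
      qed
    qed
  qed auto
  then show ?thesis by simp
qed

text \<open>Compactness makes boundedness automatic.\<close>

lemma mspace_C_space:
  assumes "compact_space X"
  shows "f \<in> mspace (C_space X) \<longleftrightarrow> f \<in> extensional (topspace X) \<and> continuous_map X euclidean f"
  using compactin_mspace_cfunspace[of X "euclidean_metric :: complex metric"] assms
  by (auto simp: compact_space_def simp del: mspace_cfunspace)

lemma mdist_C_space_le:
  assumes "f \<in> mspace (C_space X)" "g \<in> mspace (C_space X)" "topspace X \<noteq> {}"
  shows "mdist (C_space X) f g \<le> e \<longleftrightarrow> (\<forall>x\<in>topspace X. norm (f x - g x) \<le> e)"
  using cfunspace_mdist_le[OF assms] by (simp add: dist_norm)

lemma C_space_closure_of:
  assumes S: "S \<subseteq> mspace (C_space X)" and X: "topspace X \<noteq> {}"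
  shows "f \<in> mtopology_of (C_space X) closure_of S \<longleftrightarrow>
    f \<in> mspace (C_space X) \<and> (\<forall>e>0. \<exists>h\<in>S. \<forall>x\<in>topspace X. norm (f x - h x) \<le> e)"
proof -
  interpret M: Metric_space "mspace (C_space X)" "mdist (C_space X)" by (rule Metric_space_mspace_mdist)
  have "(\<exists>h\<in>S. h \<in> M.mcball f e) \<longleftrightarrow> (\<exists>h\<in>S. \<forall>x\<in>topspace X. norm (f x - h x) \<le> e)"
    if "f \<in> mspace (C_space X)" for e
    using S that mdist_C_space_le[OF that _ X] unfolding M.in_mcball by blast
  then show ?thesis
    unfolding mtopology_of_def M.metric_closure_of_alt by (auto simp del: mspace_cfunspace)
qed

lemma closedin_continuous_eqs:
  assumes "Hausdorff_space Y"
    and "\<And>i. i \<in> I \<Longrightarrow> continuous_map X Y (f i) \<and> continuous_map X Y (g i)"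
  shows "closedin X {x \<in> topspace X. \<forall>i\<in>I. f i x = g i x}"
\<comment> \<open>The intersection over an empty index set would be the whole type, so this case is
  separate.\<close>
proof (cases "I = {}")
  case False
  have "{x \<in> topspace X. \<forall>i\<in>I. f i x = g i x} = (\<Inter>i\<in>I. {x \<in> topspace X. f i x = g i x})"
    using False by auto
  moreover have "closedin X {x \<in> topspace X. f i x = g i x}" if "i \<in> I" for i
    using assms that closedin_continuous_maps_eq by blast
  ultimately show ?thesis using False by auto
qed auto

section \<open>Arithmetic means\<close>

lemma sum_lessThan_add:
  fixes f :: "nat \<Rightarrow> 'c::comm_monoid_add"
  shows "(\<Sum>i<n + m. f i) = (\<Sum>i<n. f i) + (\<Sum>i<m. f (n + i))"
  by (induction m) (simp_all add: add.assoc)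

text \<open>Using \<open>t\<close> in place of \<open>s\<close> for a single entry saves
  \<open>s - t\<close>; this saving drives the minimisation in
  \<open>rmean_exists_real\<close>.\<close>

lemma sum_list_upper_one:
  fixes f :: "'a \<Rightarrow> real" and s t :: real
  assumes "\<And>x. x \<in> set xs \<Longrightarrow> f x \<le> s" and "y \<in> set xs" and "f y \<le> t"
  shows "(\<Sum>x\<leftarrow>xs. f x) \<le> length xs * s - (s - t)"
  using assms
proof (induction xs)
  case (Cons a xs)
  have le: "(\<Sum>x\<leftarrow>xs. f x) \<le> length xs * s"
    using sum_list_mono[of xs f "\<lambda>_. s"] Cons.prems(1) by (simp add: sum_list_triv)
  show ?case
  proof (cases "y = a")
    case True
    with le Cons.prems show ?thesis by (simp add: algebra_simps)
  next
    case False
    with Cons.IH Cons.prems have "(\<Sum>x\<leftarrow>xs. f x) \<le> length xs * s - (s - t)" by auto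
    moreover have "f a \<le> s" using Cons.prems by auto
    ultimately show ?thesis by (simp add: algebra_simps)
  qed
qed auto

text \<open>Lists keep multiplicities, so an average of averages is again a plain average, even when
  different pairs give the same group element.\<close>

definition mean :: "'a list \<Rightarrow> ('a \<Rightarrow> 'b::real_normed_field) \<Rightarrow> 'b" where
  "mean xs f = (\<Sum>x\<leftarrow>xs. f x) / of_nat (length xs)"

lemma mean_cong: "(\<And>x. x \<in> set xs \<Longrightarrow> f x = g x) \<Longrightarrow> mean xs f = mean xs g"
  unfolding mean_def by (metis map_cong)

lemma mean_add: "mean xs (\<lambda>x. f x + g x) = mean xs f + mean xs g"
  by (simp add: mean_def sum_list_addf add_divide_distrib)

lemma mean_diff: "mean xs (\<lambda>x. f x - g x) = mean xs f - mean xs g"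
  by (simp add: mean_def sum_list_subtractf diff_divide_distrib)

lemma mean_cmult: "mean xs (\<lambda>x. c * f x) = c * mean xs f"
  by (simp add: mean_def sum_list_const_mult)

lemma mean_const: "xs \<noteq> [] \<Longrightarrow> mean xs (\<lambda>x. c) = c"
  by (simp add: mean_def sum_list_triv)

lemma norm_mean_le:
  assumes "xs \<noteq> []" "\<And>x. x \<in> set xs \<Longrightarrow> norm (f x) \<le> e"
  shows "norm (mean xs f) \<le> e"
proof -
  have "norm (\<Sum>x\<leftarrow>xs. f x) \<le> (\<Sum>x\<leftarrow>xs. norm (f x))"
    by (induction xs) (auto intro: norm_triangle_le)
  also have "\<dots> \<le> length xs * e"
    using sum_list_mono[of xs "\<lambda>x. norm (f x)" "\<lambda>_. e"] assms(2) by (simp add: sum_list_triv)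
  finally show ?thesis using assms(1) by (simp add: mean_def norm_divide divide_simps mult.commute)
qed

lemma norm_mean_diff_le:
  assumes "xs \<noteq> []" "\<And>x. x \<in> set xs \<Longrightarrow> norm (f x - c) \<le> e"
  shows "norm (mean xs f - c) \<le> e"
  using norm_mean_le[of xs "\<lambda>x. f x - c" e] assms by (simp add: mean_diff mean_const)

lemma mean_mean_product:
  assumes "xs \<noteq> []" "ys \<noteq> []"
  shows "mean ys (\<lambda>b. mean xs (\<lambda>a. f (g b a))) = mean [g b a. b \<leftarrow> ys, a \<leftarrow> xs] f"
proof -
  have len: "length [g b a. b \<leftarrow> ys, a \<leftarrow> xs] = length ys * length xs"
    by (induction ys) auto
  have "(\<Sum>z\<leftarrow>[g b a. b \<leftarrow> ys, a \<leftarrow> xs]. f z) = (\<Sum>b\<leftarrow>ys. \<Sum>a\<leftarrow>xs. f (g b a))"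
    by (induction ys) (auto simp: o_def)
  moreover have "mean ys (\<lambda>b. mean xs (\<lambda>a. f (g b a)))
      = (\<Sum>b\<leftarrow>ys. \<Sum>a\<leftarrow>xs. f (g b a)) / of_nat (length xs) / of_nat (length ys)"
    by (simp add: mean_def divide_inverse sum_list_mult_const)
  ultimately show ?thesis
    unfolding mean_def len by (simp add: field_simps)
qed

lemma mean_commute:
  "mean ys (\<lambda>b. mean xs (\<lambda>a. f b a)) = mean xs (\<lambda>a. mean ys (\<lambda>b. f b a))"
proof -
  have "(\<Sum>b\<leftarrow>ys. \<Sum>a\<leftarrow>xs. f b a) = (\<Sum>a\<leftarrow>xs. \<Sum>b\<leftarrow>ys. f b a)"
    by (induction ys) (auto simp: sum_list_addf)
  then show ?thesis
    by (simp add: mean_def divide_inverse sum_list_mult_const mult.assoc mult.left_commute)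
qed

lemma Re_mean: "Re (mean xs f) = mean xs (\<lambda>x. Re (f x))"
proof -
  have "Re (\<Sum>x\<leftarrow>xs. f x) = (\<Sum>x\<leftarrow>xs. Re (f x))" by (induction xs) auto
  then show ?thesis by (simp add: mean_def)
qed

lemma Im_mean: "Im (mean xs f) = mean xs (\<lambda>x. Im (f x))"
proof -
  have "Im (\<Sum>x\<leftarrow>xs. f x) = (\<Sum>x\<leftarrow>xs. Im (f x))" by (induction xs) auto
  then show ?thesis by (simp add: mean_def)
qed

section \<open>The invariant mean of a compact group\<close>

locale compact_group = group G for G :: "('a, 'b) monoid_scheme" (structure) +
  fixes T :: "'a topology"
  assumes topspace_T: "topspace T = carrier G"
    and compact_T: "compact_space T"
    and Hausdorff_T: "Hausdorff_space T"
    and continuous_mult: "continuous_map (prod_topology T T) T (\<lambda>(x, y). x \<otimes> y)"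
    and continuous_inv: "continuous_map T T (\<lambda>x. inv x)"
begin

abbreviation cont :: "('a \<Rightarrow> 'c::topological_space) \<Rightarrow> bool" where
  "cont \<equiv> continuous_map T euclidean"

definition elts :: "'a list \<Rightarrow> bool" where
  "elts xs \<longleftrightarrow> xs \<noteq> [] \<and> set xs \<subseteq> carrier G"

lemma eltsD: "elts xs \<Longrightarrow> xs \<noteq> []" "elts xs \<Longrightarrow> a \<in> set xs \<Longrightarrow> a \<in> carrier G"
  by (auto simp: elts_def)

lemma continuous_mult_of:
  assumes "continuous_map X T f" "continuous_map X T g"
  shows "continuous_map X T (\<lambda>x. f x \<otimes> g x)"
proof -
  have "continuous_map X (prod_topology T T) (\<lambda>x. (f x, g x))"
    using assms by (rule continuous_map_pairedI)
  then have "continuous_map X T ((\<lambda>(x, y). x \<otimes> y) \<circ> (\<lambda>x. (f x, g x)))"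
    using continuous_mult by (rule continuous_map_compose)
  then show ?thesis by (simp add: o_def)
qed

lemma continuous_inv_of: "continuous_map X T f \<Longrightarrow> continuous_map X T (\<lambda>x. inv (f x))"
  using continuous_map_compose[OF _ continuous_inv, of X f] by (simp add: o_def)

lemma cont_of: "cont F \<Longrightarrow> continuous_map X T f \<Longrightarrow> continuous_map X euclidean (\<lambda>x. F (f x))"
  using continuous_map_compose[of X T f euclidean F] by (simp add: o_def)

lemma continuous_const_of: "a \<in> carrier G \<Longrightarrow> continuous_map X T (\<lambda>x. a)"
  by (simp add: topspace_T)

lemma continuous_ident: "continuous_map T T (\<lambda>x. x)"
  using continuous_map_id by (simp add: id_def)

lemmas continuous_group = continuous_mult_of continuous_inv_of continuous_const_of
  continuous_ident continuous_map_fst continuous_map_snd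

lemma cont_mean:
  fixes F :: "'i \<Rightarrow> 'x \<Rightarrow> 'c::real_normed_field"
  assumes "\<And>a. a \<in> set xs \<Longrightarrow> continuous_map X euclidean (F a)"
  shows "continuous_map X euclidean (\<lambda>x. mean xs (\<lambda>a. F a x))"
proof -
  have "continuous_map X euclidean (\<lambda>x. \<Sum>a\<leftarrow>xs. F a x)"
    using assms by (induction xs) (auto intro: continuous_map_add)
  then show ?thesis
    unfolding mean_def
    by (rule continuous_map_unop[where h = "\<lambda>z. z / of_nat (length xs)"])
      (auto simp: divide_inverse intro!: continuous_intros)
qed

lemma cont_ravg:
  assumes "cont F" "elts xs"
  shows "cont (\<lambda>x. mean xs (\<lambda>a. F (x \<otimes> a)))"
  using eltsD(2)[OF assms(2)]
  by (intro cont_mean cont_of[OF assms(1)] continuous_mult_of continuous_ident continuous_const_of)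

section \<open>Finite covers by translates, and means over translates\<close>

lemma right_translates_cover:
  assumes U: "openin T U" "\<one> \<in> U"
  obtains xs where "elts xs" "\<And>x. x \<in> carrier G \<Longrightarrow> \<exists>a\<in>set xs. x \<otimes> a \<in> U"
proof -
  define V where "V a = {x \<in> topspace T. x \<otimes> a \<in> U}" for a
  have V: "openin T (V a)" if "a \<in> carrier G" for a
    unfolding V_def using that
    by (intro openin_continuous_map_preimage[OF _ U(1)] continuous_group)
  \<comment> \<open>Each \<open>x\<close> lies in \<open>V (inv x)\<close>, since
    \<open>x \<otimes> inv x\<close> is the identity.\<close>
  have "topspace T \<subseteq> \<Union>(V ` carrier G)"
    using U(2) by (auto simp: V_def topspace_T intro!: bexI[of _ "inv _"])
  then obtain D where D: "finite D" "D \<subseteq> V ` carrier G" "topspace T \<subseteq> \<Union>D"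
    using compact_T V unfolding compact_space_alt by (metis (no_types, lifting) imageE)
  then obtain S where S: "finite S" "S \<subseteq> carrier G" "D = V ` S"
    by (meson finite_subset_image)
  obtain xs where xs: "set xs = S" using S(1) finite_list by auto
  have cov: "\<exists>a\<in>set xs. x \<otimes> a \<in> U" if "x \<in> carrier G" for x
    using D(3) S(3) xs that by (auto simp: V_def topspace_T)
  \<comment> \<open>Covering the identity takes at least one translate, so the list is not
    empty.\<close>
  moreover have "elts xs" using cov[OF one_closed] S(2) xs by (auto simp: elts_def)
  ultimately show ?thesis using that by blast
qed

text \<open>Inversion exchanges the sides: the list found for the inverted neighbourhood is itself
  inverted.\<close>

lemma left_translates_cover:
  assumes U: "openin T U" "\<one> \<in> U"
  obtains xs where "elts xs" "\<And>x. x \<in> carrier G \<Longrightarrow> \<exists>a\<in>set xs. a \<otimes> x \<in> U"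
proof -
  define V where "V = {x \<in> topspace T. inv x \<in> U}"
  have "openin T V"
    unfolding V_def by (rule openin_continuous_map_preimage[OF continuous_inv U(1)])
  moreover have "\<one> \<in> V" using U(2) by (simp add: V_def topspace_T)
  ultimately obtain xs where xs: "elts xs" "\<And>x. x \<in> carrier G \<Longrightarrow> \<exists>a\<in>set xs. x \<otimes> a \<in> V"
    using right_translates_cover by metis
  have "\<exists>a\<in>set (map (\<lambda>a. inv a) xs). a \<otimes> x \<in> U" if x: "x \<in> carrier G" for x
  proof -
    obtain a where a: "a \<in> set xs" "inv x \<otimes> a \<in> V" using xs(2)[of "inv x"] x by auto
    moreover have "inv (inv x \<otimes> a) = inv a \<otimes> x"
      using x a(1) eltsD(2)[OF xs(1)] by (simp add: inv_mult_group)
    ultimately show ?thesis by (auto simp: V_def)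
  qed
  moreover have "elts (map (\<lambda>a. inv a) xs)" using xs(1) by (auto simp: elts_def)
  ultimately show ?thesis using that by blast
qed

text \<open>The constant \<open>c\<close> is a uniform limit of rational convex combinations of
  right translates of \<open>F\<close>; this is von Neumann's way to a mean without
  measures.\<close>

definition rmean :: "('a \<Rightarrow> 'c::real_normed_field) \<Rightarrow> 'c \<Rightarrow> bool" where
  "rmean F c \<longleftrightarrow> (\<forall>e>0. \<exists>xs. elts xs \<and>
     (\<forall>x\<in>carrier G. norm (mean xs (\<lambda>a. F (x \<otimes> a)) - c) \<le> e))"

definition lmean :: "('a \<Rightarrow> 'c::real_normed_field) \<Rightarrow> 'c \<Rightarrow> bool" where
  "lmean F c \<longleftrightarrow> (\<forall>e>0. \<exists>xs. elts xs \<and>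
     (\<forall>x\<in>carrier G. norm (mean xs (\<lambda>a. F (a \<otimes> x)) - c) \<le> e))"

lemma rmeanE:
  assumes "rmean F c" "e > 0"
  obtains xs where "elts xs" "\<And>x. x \<in> carrier G \<Longrightarrow> norm (mean xs (\<lambda>a. F (x \<otimes> a)) - c) \<le> e"
  using assms unfolding rmean_def by meson

lemma lmeanE:
  assumes "lmean F c" "e > 0"
  obtains xs where "elts xs" "\<And>x. x \<in> carrier G \<Longrightarrow> norm (mean xs (\<lambda>a. F (a \<otimes> x)) - c) \<le> e"
  using assms unfolding lmean_def by meson

text \<open>With \<open>inv x\<close> in place of \<open>x\<close>, averaging
  \<open>F (inv (x \<otimes> a))\<close> over \<open>a\<close> becomes averaging
  \<open>F (inv a \<otimes> x)\<close>.\<close>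

lemma lmean_if_rmean_inv:
  assumes "rmean (\<lambda>x. F (inv x)) c"
  shows "lmean F c"
  unfolding lmean_def
proof (intro allI impI)
  fix e :: real assume "e > 0"
  then obtain xs where xs: "elts xs"
    "\<And>x. x \<in> carrier G \<Longrightarrow> norm (mean xs (\<lambda>a. F (inv (x \<otimes> a))) - c) \<le> e"
    using rmeanE[OF assms] by metis
  have "mean (map (\<lambda>a. inv a) xs) (\<lambda>a. F (a \<otimes> x)) = mean xs (\<lambda>a. F (inv (inv x \<otimes> a)))"
    if "x \<in> carrier G" for x
    using that eltsD(2)[OF xs(1)]
    unfolding mean_def by (auto simp: o_def inv_mult_group intro!: arg_cong[where f = sum_list])
  moreover have "elts (map (\<lambda>a. inv a) xs)" using xs(1) by (auto simp: elts_def)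
  ultimately show "\<exists>xs. elts xs \<and> (\<forall>x\<in>carrier G. norm (mean xs (\<lambda>a. F (a \<otimes> x)) - c) \<le> e)"
    using xs(2) by (metis inv_closed)
qed

text \<open>The double average of \<open>F (a \<otimes> b)\<close> is close to either number,
  depending on which average is taken innermost. So left and right means, once both exist, are
  unique and equal.\<close>

lemma lmean_rmean_unique:
  assumes "lmean F c" "rmean F d"
  shows "c = d"
proof -
  have "norm (c - d) \<le> e" if "e > 0" for e
  proof -
    have "e / 2 > 0" using that by simp
    from lmeanE[OF assms(1) this] obtain xs where xs: "elts xs"
      "\<And>x. x \<in> carrier G \<Longrightarrow> norm (mean xs (\<lambda>a. F (a \<otimes> x)) - c) \<le> e / 2" by metis
    from rmeanE[OF assms(2) \<open>e / 2 > 0\<close>] obtain ys where ys: "elts ys"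
      "\<And>x. x \<in> carrier G \<Longrightarrow> norm (mean ys (\<lambda>a. F (x \<otimes> a)) - d) \<le> e / 2" by metis
    let ?z = "mean xs (\<lambda>a. mean ys (\<lambda>b. F (a \<otimes> b)))"
    have "norm (?z - d) \<le> e / 2"
      using eltsD[OF xs(1)] ys(2) by (intro norm_mean_diff_le[of xs]) auto
    moreover have "norm (?z - c) \<le> e / 2"
      unfolding mean_commute[of xs] using eltsD[OF ys(1)] xs(2) by (intro norm_mean_diff_le[of ys]) auto
    ultimately show ?thesis
      by (metis add_mono field_sum_of_halves norm_minus_commute norm_diff_triangle_le)
  qed
  then have "norm (c - d) \<le> 0" by (meson field_le_epsilon add_le_same_cancel2 add_0 dense_ge)
  then show ?thesis by simp
qed

text \<open>If some average of \<open>F\<close> lies below \<open>s\<close> but dips below \<open>M\<close>, averaging once more over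
  finitely many translates, whose number depends only on the modulus of continuity of \<open>F\<close>,
  lowers the bound \<open>s\<close> by a fixed amount.\<close>

lemma rmean_exists_real:
  fixes F :: "'a \<Rightarrow> real"
  assumes F: "cont F"
  shows "\<exists>c. rmean F c"
proof -
  obtain B where B: "\<And>x. x \<in> carrier G \<Longrightarrow> \<bar>F x\<bar> \<le> B"
    using compact_bounded_norm[OF compact_T F] by (auto simp: topspace_T)
  \<comment> \<open>\<open>S\<close> collects the uniform upper bounds of averages of right
    translates; its infimum turns out to be the mean.\<close>
  define S where "S = {s. \<exists>xs. elts xs \<and> (\<forall>x\<in>carrier G. mean xs (\<lambda>a. F (x \<otimes> a)) \<le> s)}"
  have bnd: "\<bar>mean xs (\<lambda>a. F (x \<otimes> a))\<bar> \<le> B" if "elts xs" "x \<in> carrier G" for xs x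
    using norm_mean_le[of xs "\<lambda>a. F (x \<otimes> a)" B] that B by (auto dest: eltsD)
  have "elts [\<one>]" by (auto simp: elts_def)
  with bnd have "B \<in> S" unfolding S_def by (auto simp: abs_le_iff)
  have "bdd_below S"
  proof (rule bdd_belowI[of _ "- B"])
    fix s assume "s \<in> S"
    then obtain xs where xs: "elts xs" "\<forall>x\<in>carrier G. mean xs (\<lambda>a. F (x \<otimes> a)) \<le> s"
      by (auto simp: S_def)
    then show "- B \<le> s" using bnd[OF xs(1) one_closed] xs(2)[rule_format, OF one_closed] by linarith
  qed
  define M where "M = Inf S"
  have M_le: "M \<le> s" if "s \<in> S" for s
    using that \<open>bdd_below S\<close> by (simp add: M_def cInf_lower)
  have "\<exists>xs. elts xs \<and> (\<forall>x\<in>carrier G. norm (mean xs (\<lambda>a. F (x \<otimes> a)) - M) \<le> e)"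
    if "e > 0" for e
  proof -
    define d where "d = e / 2"
    have "d > 0" using that by (simp add: d_def)
    have Fm: "continuous_map (prod_topology T T) euclidean (\<lambda>z. F (fst z \<otimes> snd z))"
      by (intro cont_of[OF F] continuous_group)
    have "\<one> \<in> topspace T" by (simp add: topspace_T)
    from compact_parameter_net[OF Fm compact_T this \<open>d > 0\<close>]
    obtain U where U: "openin T U" "\<one> \<in> U"
      "\<And>u x. u \<in> U \<Longrightarrow> x \<in> carrier G \<Longrightarrow> \<bar>F (u \<otimes> x) - F x\<bar> < d"
      by (auto simp: topspace_T)
    \<comment> \<open>This list is fixed before any average is chosen: its length depends on
      \<open>U\<close> alone, hence on \<open>F\<close> and \<open>d\<close>.\<close>
    obtain zs where zs: "elts zs" "\<And>x. x \<in> carrier G \<Longrightarrow> \<exists>a\<in>set zs. x \<otimes> a \<in> U"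
      using right_translates_cover[OF U(1,2)] by metis
    define N where "N = real (length zs)"
    have N: "N \<ge> 1" using eltsD(1)[OF zs(1)] by (cases zs) (auto simp: N_def)
    \<comment> \<open>The tolerance \<open>d / N\<close> is the amount by which one further
      averaging will lower the bound.\<close>
    have "M < M + d / N" using \<open>d > 0\<close> N by simp
    then obtain s where s: "s \<in> S" "s < M + d / N"
      unfolding M_def using cInf_lessD[of S] \<open>B \<in> S\<close> by blast
    then obtain xs where xs: "elts xs" "\<forall>x\<in>carrier G. mean xs (\<lambda>a. F (x \<otimes> a)) \<le> s"
      by (auto simp: S_def)
    define k where "k x = mean xs (\<lambda>a. F (x \<otimes> a))" for x
    have ks: "k x \<le> s" if "x \<in> carrier G" for x using xs(2) that by (simp add: k_def)
    \<comment> \<open>Left translation commutes with averaging over right translates, so the same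
      \<open>U\<close> serves every average.\<close>
    have kU: "\<bar>k (u \<otimes> x) - k x\<bar> \<le> d" if "u \<in> U" "x \<in> carrier G" for u x
    proof -
      have "u \<in> carrier G" using U(1) that(1) topspace_T by (auto dest: openin_subset)
      then have eq: "k (u \<otimes> x) - k x = mean xs (\<lambda>a. F (u \<otimes> (x \<otimes> a)) - F (x \<otimes> a))"
        unfolding k_def mean_diff using that eltsD(2)[OF xs(1)]
        by (auto simp: m_assoc intro!: mean_cong)
      have "norm (mean xs (\<lambda>a. F (u \<otimes> (x \<otimes> a)) - F (x \<otimes> a))) \<le> d"
        using that eltsD[OF xs(1)] U(3)
        by (intro norm_mean_le) (auto simp: less_imp_le)
      then show ?thesis by (simp add: eq)
    qed
    have low: "k x0 \<ge> M - 2 * d" if x0: "x0 \<in> carrier G" for x0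
    proof (rule ccontr)
      assume neg: "\<not> ?thesis"
      \<comment> \<open>For every \<open>x\<close> some \<open>a\<close> in \<open>zs\<close> puts
        \<open>x \<otimes> a\<close> into \<open>U\<close>, and then
        \<open>k (x \<otimes> a \<otimes> x0)\<close> exceeds the low value \<open>k x0\<close> by
        at most \<open>d\<close>.\<close>
      define ys where "ys = [a \<otimes> (x0 \<otimes> b). a \<leftarrow> zs, b \<leftarrow> xs]"
      have ys: "elts ys"
        using zs(1) xs(1) x0 by (auto simp: elts_def ys_def)
      have "s - d / N \<in> S"
        unfolding S_def
      proof (rule CollectI, rule exI[of _ ys], rule conjI[OF ys], rule ballI)
        fix x assume x: "x \<in> carrier G"
        have "mean ys (\<lambda>a. F (x \<otimes> a)) = mean zs (\<lambda>a. mean xs (\<lambda>b. F (x \<otimes> (a \<otimes> (x0 \<otimes> b)))))"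
          unfolding ys_def using eltsD(1)[OF zs(1)] eltsD(1)[OF xs(1)]
          by (subst mean_mean_product[where f = "\<lambda>a. F (x \<otimes> a)" and g = "\<lambda>a b. a \<otimes> (x0 \<otimes> b)"]) auto
        also have "\<dots> = mean zs (\<lambda>a. k (x \<otimes> a \<otimes> x0))"
          unfolding k_def using x x0 eltsD(2)[OF zs(1)] eltsD(2)[OF xs(1)]
          by (intro mean_cong) (auto simp: m_assoc)
        also have "\<dots> \<le> s - d / N"
        proof -
          obtain a where a: "a \<in> set zs" "x \<otimes> a \<in> U" using zs(2)[OF x] by blast
          have "k (x \<otimes> a \<otimes> x0) \<le> M - d" using kU[OF a(2) x0] neg by linarith
          then have "(\<Sum>a\<leftarrow>zs. k (x \<otimes> a \<otimes> x0)) \<le> N * s - (s - (M - d))"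
            unfolding N_def using x x0 eltsD(2)[OF zs(1)] a(1)
            by (intro sum_list_upper_one[of zs _ s a]) (auto intro!: ks)
          \<comment> \<open>By \<open>M \<le> s\<close> the saving \<open>s - (M - d)\<close> is at
            least \<open>d\<close>.\<close>
          also have "\<dots> \<le> N * s - d" using M_le[OF s(1)] by simp
          finally show ?thesis
            using N unfolding mean_def N_def[symmetric] by (simp add: field_simps)
        qed
        finally show "mean ys (\<lambda>a. F (x \<otimes> a)) \<le> s - d / N" .
      qed
      with M_le s(2) show False by fastforce
    qed
    have "d / N \<le> d" using N \<open>d > 0\<close> by (simp add: divide_le_eq)
    \<comment> \<open>The lower bound is \<open>M - e\<close> because \<open>d\<close> is half of
      \<open>e\<close>; the upper bound \<open>s\<close> exceeds \<open>M\<close> by less than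
      \<open>d\<close>.\<close>
    have "\<bar>k x - M\<bar> \<le> e" if "x \<in> carrier G" for x
      using low[OF that] ks[OF that] s(2) \<open>d / N \<le> d\<close> \<open>d > 0\<close>
      unfolding d_def abs_le_iff by (auto simp: field_simps)
    then show ?thesis using xs(1) by (auto simp: k_def)
  qed
  then show ?thesis unfolding rmean_def by blast
qed

text \<open>For a fixed right factor \<open>a\<close> the left mean is merely read off at
  \<open>x \<otimes> a\<close>, and the two averages commute.\<close>

lemma lmean_ravg:
  assumes "lmean F c" "elts xs"
  shows "lmean (\<lambda>x. mean xs (\<lambda>a. F (x \<otimes> a))) c"
  unfolding lmean_def
proof (intro allI impI)
  fix e :: real assume "e > 0"
  with assms(1) obtain ys where ys: "elts ys"
    "\<And>x. x \<in> carrier G \<Longrightarrow> norm (mean ys (\<lambda>b. F (b \<otimes> x)) - c) \<le> e"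
    using lmeanE by metis
  have "norm (mean ys (\<lambda>b. mean xs (\<lambda>a. F (b \<otimes> x \<otimes> a))) - c) \<le> e" if x: "x \<in> carrier G" for x
    unfolding mean_commute[of ys]
  proof (rule norm_mean_diff_le)
    show "xs \<noteq> []" using assms(2) by (rule eltsD)
    fix a assume "a \<in> set xs"
    then have a: "a \<in> carrier G" using assms(2) by (auto dest: eltsD)
    have "mean ys (\<lambda>b. F (b \<otimes> x \<otimes> a)) = mean ys (\<lambda>b. F (b \<otimes> (x \<otimes> a)))"
      using a x eltsD(2)[OF ys(1)] by (intro mean_cong) (simp add: m_assoc)
    then show "norm (mean ys (\<lambda>b. F (b \<otimes> x \<otimes> a)) - c) \<le> e"
      using ys(2)[of "x \<otimes> a"] a x by simp
  qed
  then show "\<exists>ys. elts ys \<and> (\<forall>x\<in>carrier G. norm (mean ys (\<lambda>b. mean xs (\<lambda>a. F (b \<otimes> x \<otimes> a))) - c) \<le> e)"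
    using ys(1) by blast
qed

text \<open>The list is built from \<open>xs\<close> and \<open>ys\<close> without reference to
  \<open>F\<close>, so that several functions can share it.\<close>

lemma ravg_ravg:
  fixes F :: "'a \<Rightarrow> 'c::real_normed_field"
  assumes "elts xs" "elts ys"
  obtains zs where "elts zs"
    "\<And>F x. x \<in> carrier G \<Longrightarrow>
      mean zs (\<lambda>a. F (x \<otimes> a)) = (mean ys (\<lambda>b. mean xs (\<lambda>a. F (x \<otimes> b \<otimes> a))) :: 'c)"
proof
  let ?zs = "[b \<otimes> a. b \<leftarrow> ys, a \<leftarrow> xs]"
  show "elts ?zs" using assms by (auto simp: elts_def)
  fix F :: "'a \<Rightarrow> 'c" and x assume x: "x \<in> carrier G"
  have "mean ?zs (\<lambda>a. F (x \<otimes> a)) = mean ys (\<lambda>b. mean xs (\<lambda>a. F (x \<otimes> (b \<otimes> a))))"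
    using eltsD(1) assms by (subst mean_mean_product[where f = "\<lambda>a. F (x \<otimes> a)"]) auto
  also have "\<dots> = mean ys (\<lambda>b. mean xs (\<lambda>a. F (x \<otimes> b \<otimes> a)))"
    using x eltsD(2)[OF assms(1)] eltsD(2)[OF assms(2)] by (intro mean_cong) (simp add: m_assoc)
  finally show "mean ?zs (\<lambda>a. F (x \<otimes> a)) = mean ys (\<lambda>b. mean xs (\<lambda>a. F (x \<otimes> b \<otimes> a)))" .
qed

text \<open>Estimates uniform in \<open>x\<close> survive further averaging, so approximations can
  be arranged one after another.\<close>

lemma norm_ravg_ravg:
  assumes "elts ys" "x \<in> carrier G"
    and "\<And>x. x \<in> carrier G \<Longrightarrow> norm (mean xs (\<lambda>a. F (x \<otimes> a)) - c) \<le> e"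
  shows "norm (mean ys (\<lambda>b. mean xs (\<lambda>a. F (x \<otimes> b \<otimes> a))) - c) \<le> e"
  using assms by (intro norm_mean_diff_le[of ys]) (auto dest: eltsD)

text \<open>A right mean of \<open>F\<close> composed with inversion is a left mean of
  \<open>F\<close>, and \<open>lmean_rmean_unique\<close> identifies it with the right mean.\<close>

lemma lmean_exists_if_rmean:
  fixes F :: "'a \<Rightarrow> 'c::real_normed_field"
  assumes ex: "\<And>H :: 'a \<Rightarrow> 'c. cont H \<Longrightarrow> \<exists>c. rmean H c" and F: "cont F"
  shows "\<exists>c. rmean F c \<and> lmean F c"
proof -
  obtain c where c: "rmean F c" using ex[OF F] by blast
  have inv: "cont (\<lambda>x. F (inv x))" by (intro cont_of[OF F] continuous_group)
  then obtain d where "rmean (\<lambda>x. F (inv x)) d" using ex[OF inv] by blast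
  then have "lmean F d" by (rule lmean_if_rmean_inv)
  with c lmean_rmean_unique show ?thesis by metis
qed

text \<open>Real and imaginary parts need a common list. The list \<open>xs\<close> settles the real
  part; a second average, chosen for the already averaged imaginary part, does not disturb
  it.\<close>

lemma rmean_exists_complex:
  fixes F :: "'a \<Rightarrow> complex"
  assumes F: "cont F"
  shows "\<exists>c. rmean F c"
proof -
  have F1: "cont (\<lambda>x. Re (F x))" and F2: "cont (\<lambda>x. Im (F x))"
    by (rule continuous_map_unop[OF F], auto intro: continuous_intros)+
  obtain c1 where c1: "rmean (\<lambda>x. Re (F x)) c1" using rmean_exists_real[OF F1] by blast
  obtain c2 where c2: "lmean (\<lambda>x. Im (F x)) c2"
    using lmean_exists_if_rmean[OF rmean_exists_real F2] by blast
  have "rmean F (Complex c1 c2)"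
    unfolding rmean_def
  proof (intro allI impI)
    fix e :: real assume "e > 0"
    then have e2: "e / 2 > 0" by simp
    from rmeanE[OF c1 e2] obtain xs where xs: "elts xs"
      "\<And>x. x \<in> carrier G \<Longrightarrow> norm (mean xs (\<lambda>a. Re (F (x \<otimes> a))) - c1) \<le> e / 2" by metis
    let ?k = "\<lambda>x. mean xs (\<lambda>a. Im (F (x \<otimes> a)))"
    obtain c2' where c2': "rmean ?k c2'" using rmean_exists_real[OF cont_ravg[OF F2 xs(1)]] by blast
    \<comment> \<open>Averaging over \<open>xs\<close> preserves the left mean of the imaginary
      part, hence the right mean \<open>c2'\<close> cannot differ from it.\<close>
    have "c2' = c2" using lmean_rmean_unique[OF lmean_ravg[OF c2 xs(1)] c2'] by simp
    with c2' have "rmean ?k c2" by simp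
    from rmeanE[OF this e2] obtain ys where ys: "elts ys"
      "\<And>x. x \<in> carrier G \<Longrightarrow> norm (mean ys (\<lambda>b. ?k (x \<otimes> b)) - c2) \<le> e / 2" by metis
    obtain zs where zs: "elts zs" "\<And>F x. x \<in> carrier G \<Longrightarrow>
      mean zs (\<lambda>a. F (x \<otimes> a)) = (mean ys (\<lambda>b. mean xs (\<lambda>a. F (x \<otimes> b \<otimes> a))) :: real)"
      using ravg_ravg[OF xs(1) ys(1)] by metis
    have "norm (mean zs (\<lambda>a. F (x \<otimes> a)) - Complex c1 c2) \<le> e" if x: "x \<in> carrier G" for x
    proof -
      let ?w = "mean zs (\<lambda>a. F (x \<otimes> a)) - Complex c1 c2"
      have "\<bar>Re ?w\<bar> \<le> e / 2"
        using norm_ravg_ravg[OF ys(1) x xs(2)] zs(2)[OF x, of "\<lambda>x. Re (F x)"] by (simp add: Re_mean)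
      moreover have "\<bar>Im ?w\<bar> \<le> e / 2"
        using ys(2)[OF x] zs(2)[OF x, of "\<lambda>x. Im (F x)"] by (simp add: Im_mean)
      ultimately show ?thesis using cmod_le[of ?w] by linarith
    qed
    with zs(1) show "\<exists>xs. elts xs \<and>
        (\<forall>x\<in>carrier G. norm (mean xs (\<lambda>a. F (x \<otimes> a)) - Complex c1 c2) \<le> e)" by blast
  qed
  then show ?thesis by blast
qed

section \<open>The normalised Haar integral as a two-sided mean\<close>

definition haar :: "('a \<Rightarrow> complex) \<Rightarrow> complex" where
  "haar F = (SOME c. rmean F c \<and> lmean F c)"

lemma haar_mean:
  assumes "cont F"
  shows "rmean F (haar F)" "lmean F (haar F)"
  using someI_ex[OF lmean_exists_if_rmean[OF rmean_exists_complex assms]]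
  by (simp_all add: haar_def)

lemma haar_eqI: "cont F \<Longrightarrow> rmean F c \<Longrightarrow> haar F = c"
  using haar_mean(2) lmean_rmean_unique by blast

lemma haar_eqI': "cont F \<Longrightarrow> lmean F c \<Longrightarrow> haar F = c"
  using haar_mean(1) lmean_rmean_unique by blast

lemma haar_ravg:
  assumes "cont F" "elts xs"
  shows "haar (\<lambda>x. mean xs (\<lambda>a. F (x \<otimes> a))) = haar F"
  using assms by (intro haar_eqI' cont_ravg lmean_ravg haar_mean)

text \<open>The estimate in \<open>rmean\<close> is uniform in \<open>x\<close>, so \<open>x\<close>
  may be replaced by \<open>g \<otimes> x\<close> with the same list.\<close>

lemma haar_left_translate:
  assumes F: "cont F" and g: "g \<in> carrier G"
  shows "haar (\<lambda>x. F (g \<otimes> x)) = haar F"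
proof (rule haar_eqI)
  show "cont (\<lambda>x. F (g \<otimes> x))" using g by (intro cont_of[OF F] continuous_group)
  show "rmean (\<lambda>x. F (g \<otimes> x)) (haar F)"
    unfolding rmean_def
  proof (intro allI impI)
    fix e :: real assume "e > 0"
    then obtain xs where xs: "elts xs"
      "\<And>x. x \<in> carrier G \<Longrightarrow> norm (mean xs (\<lambda>a. F (x \<otimes> a)) - haar F) \<le> e"
      using rmeanE[OF haar_mean(1)[OF F]] by metis
    have "mean xs (\<lambda>a. F (g \<otimes> (x \<otimes> a))) = mean xs (\<lambda>a. F (g \<otimes> x \<otimes> a))" if "x \<in> carrier G" for x
      using that g eltsD(2)[OF xs(1)] by (intro mean_cong) (simp add: m_assoc)
    with xs g show "\<exists>xs. elts xs \<and>
        (\<forall>x\<in>carrier G. norm (mean xs (\<lambda>a. F (g \<otimes> (x \<otimes> a))) - haar F) \<le> e)"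
      by (intro exI[of _ xs]) auto
  qed
qed

text \<open>Further averaging keeps the estimates already reached. The new function, averaged over
  the old list, still has the same integral, so a second list can be chosen for it.\<close>

lemma haar_simultaneous:
  assumes "finite S" "\<And>F. F \<in> S \<Longrightarrow> cont F" "e > 0"
  shows "\<exists>xs. elts xs \<and> (\<forall>F\<in>S. \<forall>x\<in>carrier G. norm (mean xs (\<lambda>a. F (x \<otimes> a)) - haar F) \<le> e)"
  using assms
proof (induction S rule: finite_induct)
  case empty
  then show ?case by (intro exI[of _ "[\<one>]"]) (auto simp: elts_def)
next
  case (insert F S)
  then obtain xs where xs: "elts xs"
    "\<And>F x. F \<in> S \<Longrightarrow> x \<in> carrier G \<Longrightarrow> norm (mean xs (\<lambda>a. F (x \<otimes> a)) - haar F) \<le> e"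
    by auto
  have F: "cont F" using insert.prems by simp
  let ?k = "\<lambda>x. mean xs (\<lambda>a. F (x \<otimes> a))"
  have "rmean ?k (haar F)" using haar_mean(1)[OF cont_ravg[OF F xs(1)]] haar_ravg[OF F xs(1)] by simp
  from rmeanE[OF this \<open>e > 0\<close>] obtain ys where ys: "elts ys"
    "\<And>x. x \<in> carrier G \<Longrightarrow> norm (mean ys (\<lambda>b. ?k (x \<otimes> b)) - haar F) \<le> e" by metis
  obtain zs where zs: "elts zs" "\<And>F x. x \<in> carrier G \<Longrightarrow>
    mean zs (\<lambda>a. F (x \<otimes> a)) = (mean ys (\<lambda>b. mean xs (\<lambda>a. F (x \<otimes> b \<otimes> a))) :: complex)"
    using ravg_ravg[OF xs(1) ys(1)] by metis
  have "norm (mean zs (\<lambda>a. H (x \<otimes> a)) - haar H) \<le> e"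
    if "H \<in> insert F S" "x \<in> carrier G" for H x
    using that norm_ravg_ravg[OF ys(1) that(2) xs(2), of H] ys(2)[OF that(2)]
    by (auto simp: zs(2))
  with zs(1) show ?case by blast
qed

lemma haar_approx:
  assumes "finite S" "\<And>F. F \<in> S \<Longrightarrow> cont F" "e > 0"
  shows "\<exists>xs. elts xs \<and> (\<forall>F\<in>S. norm (mean xs F - haar F) \<le> e)"
proof -
  obtain xs where xs: "elts xs"
    "\<forall>F\<in>S. \<forall>x\<in>carrier G. norm (mean xs (\<lambda>a. F (x \<otimes> a)) - haar F) \<le> e"
    using haar_simultaneous[OF assms] by blast
  have "mean xs F = mean xs (\<lambda>a. F (\<one> \<otimes> a))" for F :: "'a \<Rightarrow> complex"
    using eltsD(2)[OF xs(1)] by (intro mean_cong) simp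
  with xs show ?thesis by (metis one_closed)
qed

text \<open>Averages sample only the carrier, although \<open>haar\<close> accepts functions on the
  whole type.\<close>

lemma haar_cong:
  assumes "\<And>x. x \<in> carrier G \<Longrightarrow> F x = H x"
  shows "haar F = haar H"
proof -
  have "mean xs (\<lambda>a. F (x \<otimes> a)) = mean xs (\<lambda>a. H (x \<otimes> a))"
    "mean xs (\<lambda>a. F (a \<otimes> x)) = mean xs (\<lambda>a. H (a \<otimes> x))"
    if "elts xs" "x \<in> carrier G" for xs x
    using that assms by (auto intro!: mean_cong dest: eltsD)
  then have "rmean F c = rmean H c" "lmean F c = lmean H c" for c
    unfolding rmean_def lmean_def by (simp_all cong: conj_cong)
  then show ?thesis by (simp add: haar_def)
qed

text \<open>Means are additive for each list, so one list that is good for all three functions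
  carries additivity to the limit.\<close>

lemma haar_add:
  assumes "cont F" "cont H"
  shows "haar (\<lambda>x. F x + H x) = haar F + haar H"
proof -
  let ?S = "\<lambda>x. F x + H x"
  have "norm (haar ?S - (haar F + haar H)) \<le> e" if "e > 0" for e
  proof -
    have "\<And>K. K \<in> {F, H, ?S} \<Longrightarrow> cont K" using assms by (auto intro: continuous_map_add)
    then have "\<exists>xs. elts xs \<and> (\<forall>K\<in>{F, H, ?S}. norm (mean xs K - haar K) \<le> e / 3)"
      using \<open>e > 0\<close> by (intro haar_approx) simp_all
    then obtain xs where xs: "\<And>K. K \<in> {F, H, ?S} \<Longrightarrow> norm (mean xs K - haar K) \<le> e / 3"
      by blast
    have "haar ?S - (haar F + haar H) = (mean xs F - haar F) + (mean xs H - haar H) - (mean xs ?S - haar ?S)"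
      by (simp add: mean_add)
    also have "norm \<dots> \<le> e / 3 + e / 3 + e / 3"
      by (intro norm_triangle_le_diff norm_triangle_le add_mono xs) auto
    finally show ?thesis by simp
  qed
  then have "norm (haar ?S - (haar F + haar H)) \<le> 0" by (rule dense_ge)
  then show ?thesis by simp
qed

lemma haar_cmult:
  assumes "cont F"
  shows "haar (\<lambda>x. c * F x) = c * haar F"
proof -
  let ?S = "\<lambda>x. c * F x"
  have "norm (haar ?S - c * haar F) \<le> (1 + norm c) * e" if "e > 0" for e
  proof -
    have "cont ?S" by (rule continuous_map_unop[OF assms]) (intro continuous_intros)
    then have "\<And>K. K \<in> {F, ?S} \<Longrightarrow> cont K" using assms by auto
    then have "\<exists>xs. elts xs \<and> (\<forall>K\<in>{F, ?S}. norm (mean xs K - haar K) \<le> e)"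
      using \<open>e > 0\<close> by (intro haar_approx) simp_all
    then obtain xs where xs: "\<And>K. K \<in> {F, ?S} \<Longrightarrow> norm (mean xs K - haar K) \<le> e"
      by blast
    have "haar ?S - c * haar F = c * (mean xs F - haar F) - (mean xs ?S - haar ?S)"
      by (simp add: mean_cmult algebra_simps)
    also have "norm \<dots> \<le> norm c * e + e"
      by (intro norm_triangle_le_diff add_mono xs) (auto simp: norm_mult intro!: mult_left_mono xs)
    finally show ?thesis by (simp add: algebra_simps)
  qed
  then have "norm (haar ?S - c * haar F) \<le> e" if "e > 0" for e
    using that[THEN divide_pos_pos, of "1 + norm c"] by (smt (verit) norm_ge_zero nonzero_mult_div_cancel_left times_divide_eq_right)
  then have "norm (haar ?S - c * haar F) \<le> 0" by (rule dense_ge)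
  then show ?thesis by simp
qed

text \<open>The integral is a limit of averages and inherits every closed condition that all
  averages satisfy.\<close>

lemma haar_in_closed:
  assumes "cont F" "closed C" "\<And>xs. elts xs \<Longrightarrow> mean xs F \<in> C"
  shows "haar F \<in> C"
proof (subst closure_closed[OF assms(2), symmetric], unfold closure_approachable, intro allI impI)
  fix e :: real assume "e > 0"
  then have "\<exists>xs. elts xs \<and> (\<forall>K\<in>{F}. norm (mean xs K - haar K) \<le> e / 2)"
    using assms(1) by (intro haar_approx) simp_all
  then obtain xs where "elts xs" "norm (mean xs F - haar F) \<le> e / 2" by blast
  with \<open>e > 0\<close> assms(3) show "\<exists>y\<in>C. dist y (haar F) < e"
    by (intro bexI[of _ "mean xs F"]) (auto simp: dist_norm)
qed

lemma norm_haar_le: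
  assumes "cont F" "\<And>x. x \<in> carrier G \<Longrightarrow> norm (F x) \<le> B"
  shows "norm (haar F) \<le> B"
proof -
  have "haar F \<in> cball 0 B"
    using assms by (intro haar_in_closed) (auto intro!: norm_mean_le dest: eltsD)
  then show ?thesis by simp
qed

lemma haar_cnj:
  assumes "cont F"
  shows "haar (\<lambda>x. cnj (F x)) = cnj (haar F)"
proof -
  have eq: "cnj (mean xs f) = mean xs (\<lambda>x. cnj (f x))" for xs :: "'a list" and f
    by (simp add: complex_eq_iff Re_mean Im_mean mean_cmult[where c = "-1", simplified])
  have "rmean (\<lambda>x. cnj (F x)) (cnj (haar F))"
    using haar_mean(1)[OF assms] unfolding rmean_def
    by (simp flip: eq complex_cnj_diff)
  moreover have "cont (\<lambda>x. cnj (F x))" by (rule continuous_map_unop[OF assms]) (intro continuous_intros)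
  ultimately show ?thesis by (simp add: haar_eqI)
qed

lemma Re_haar_ge:
  assumes "cont F" "\<And>x. x \<in> carrier G \<Longrightarrow> Re (F x) \<ge> b"
  shows "Re (haar F) \<ge> b"
proof -
  have "mean xs F \<in> {z. Re z \<ge> b}" if "elts xs" for xs
  proof -
    have "length xs * b \<le> (\<Sum>x\<leftarrow>xs. Re (F x))"
      using sum_list_mono[of xs "\<lambda>_. b" "\<lambda>x. Re (F x)"] assms(2) that
      by (auto simp: sum_list_triv dest: eltsD)
    then have "b \<le> mean xs (\<lambda>x. Re (F x))"
      using eltsD(1)[OF that] by (simp add: mean_def field_simps)
    then show ?thesis by (simp add: Re_mean)
  qed
  then have "haar F \<in> {z. Re z \<ge> b}"
    using assms(1) by (intro haar_in_closed closed_halfspace_Re_ge)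
  then show ?thesis by simp
qed

text \<open>Finitely many translates of an open set where \<open>Re F\<close> exceeds a positive
  \<open>d\<close> cover the group, so averaging over them yields a function bounded below by a
  positive constant, with the same integral as \<open>F\<close>.\<close>

lemma Re_haar_pos:
  assumes F: "cont F" "\<And>x. x \<in> carrier G \<Longrightarrow> Re (F x) \<ge> 0" and pos: "Re (F \<one>) > 0"
  shows "Re (haar F) > 0"
proof -
  define d where "d = Re (F \<one>) / 2"
  define U where "U = {x \<in> topspace T. Re (F x) \<in> {d<..}}"
  have "openin T U" unfolding U_def
    by (rule openin_continuous_map_preimage[of T euclidean])
      (auto intro!: continuous_map_unop[OF F(1)] continuous_intros)
  moreover have "\<one> \<in> U" using pos by (simp add: U_def d_def topspace_T)
  ultimately obtain zs where zs: "elts zs" "\<And>x. x \<in> carrier G \<Longrightarrow> \<exists>a\<in>set zs. x \<otimes> a \<in> U"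
    using right_translates_cover by metis
  have "Re (mean zs (\<lambda>a. F (x \<otimes> a))) \<ge> d / length zs" if x: "x \<in> carrier G" for x
  proof -
    obtain a where a: "a \<in> set zs" "x \<otimes> a \<in> U" using zs(2)[OF x] by blast
    then have "d \<le> Re (F (x \<otimes> a))" by (simp add: U_def)
    also have "\<dots> \<le> (\<Sum>a\<leftarrow>zs. Re (F (x \<otimes> a)))"
      using a(1) F(2) x eltsD(2)[OF zs(1)] by (intro member_le_sum_list) auto
    finally have "d / length zs \<le> mean zs (\<lambda>a. Re (F (x \<otimes> a)))"
      by (simp add: mean_def divide_right_mono)
    then show ?thesis by (simp add: Re_mean)
  qed
  then have "Re (haar (\<lambda>x. mean zs (\<lambda>a. F (x \<otimes> a)))) \<ge> d / length zs"
    using cont_ravg[OF F(1) zs(1)] by (intro Re_haar_ge)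
  moreover have "d / length zs > 0" using eltsD(1)[OF zs(1)] pos by (simp add: d_def)
  ultimately show ?thesis using haar_ravg[OF F(1) zs(1)] by simp
qed

lemma cont_section:
  assumes "continuous_map (prod_topology P T) euclidean H" "p \<in> topspace P"
  shows "cont (\<lambda>y. H (p, y))"
proof -
  have "continuous_map T (prod_topology P T) (\<lambda>y. (p, y))"
    using assms(2) by (intro continuous_map_pairedI continuous_ident) auto
  from continuous_map_compose[OF this assms(1)] show ?thesis by (simp add: o_def)
qed

text \<open>A finite net of parameters leaves finitely many slices, which share one list. Passing to
  a nearby net point changes averages and integrals by at most \<open>e / 3\<close>.\<close>

lemma haar_Riemann_sums:
  assumes P: "compact_space P" and H: "continuous_map (prod_topology P T) euclidean H"
    and e: "e > 0"
  obtains xs where "elts xs"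
    "\<And>p. p \<in> topspace P \<Longrightarrow> norm (mean xs (\<lambda>y. H (p, y)) - haar (\<lambda>y. H (p, y))) \<le> e"
proof -
  have e3: "e / 3 > 0" using e by simp
  have "\<exists>U. openin P U \<and> p \<in> U \<and>
      (\<forall>q\<in>U. \<forall>x\<in>carrier G. norm (H (q, x) - H (p, x)) < e / 3)" if "p \<in> topspace P" for p
    using compact_parameter_net[OF H compact_T that e3] unfolding topspace_T by metis
  then obtain U where U: "\<And>p. p \<in> topspace P \<Longrightarrow> openin P (U p) \<and> p \<in> U p \<and>
      (\<forall>q\<in>U p. \<forall>x\<in>carrier G. norm (H (q, x) - H (p, x)) < e / 3)" by metis
  then have "topspace P \<subseteq> \<Union>(U ` topspace P)" by blast
  then obtain D where D: "finite D" "D \<subseteq> U ` topspace P" "topspace P \<subseteq> \<Union>D"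
    using P U unfolding compact_space_alt by (metis (no_types, lifting) imageE)
  then obtain Q where Q: "finite Q" "Q \<subseteq> topspace P" "D = U ` Q"
    by (meson finite_subset_image)
  have "\<And>F. F \<in> (\<lambda>q y. H (q, y)) ` Q \<Longrightarrow> cont F" using cont_section[OF H] Q(2) by auto
  then have "\<exists>xs. elts xs \<and> (\<forall>F\<in>(\<lambda>q y. H (q, y)) ` Q. norm (mean xs F - haar F) \<le> e / 3)"
    using Q(1) e3 by (intro haar_approx) simp_all
  then obtain xs where xs: "elts xs"
    "\<And>q. q \<in> Q \<Longrightarrow> norm (mean xs (\<lambda>y. H (q, y)) - haar (\<lambda>y. H (q, y))) \<le> e / 3"
    by blast
  have "norm (mean xs (\<lambda>y. H (p, y)) - haar (\<lambda>y. H (p, y))) \<le> e" if p: "p \<in> topspace P" for p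
  proof -
    obtain q where q: "q \<in> Q" "p \<in> U q" using D(3) Q(3) p by auto
    then have qP: "q \<in> topspace P" using Q(2) by auto
    have less: "norm (H (p, x) - H (q, x)) \<le> e / 3" if "x \<in> carrier G" for x
      using U[OF qP] q(2) that by (auto simp: less_imp_le)
    have m: "norm (mean xs (\<lambda>y. H (p, y)) - mean xs (\<lambda>y. H (q, y))) \<le> e / 3"
      unfolding mean_diff[symmetric]
      using less eltsD[OF xs(1)] by (intro norm_mean_le) auto
    have "haar (\<lambda>y. H (p, y)) = haar (\<lambda>y. (H (p, y) - H (q, y)) + H (q, y))" by simp
    also have "\<dots> = haar (\<lambda>y. H (p, y) - H (q, y)) + haar (\<lambda>y. H (q, y))"
      by (intro haar_add continuous_map_diff cont_section[OF H] p qP)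
    finally have h: "norm (haar (\<lambda>y. H (p, y)) - haar (\<lambda>y. H (q, y))) \<le> e / 3"
      using norm_haar_le[OF continuous_map_diff[OF cont_section[OF H p] cont_section[OF H qP]] less]
      by simp
    have "mean xs (\<lambda>y. H (p, y)) - haar (\<lambda>y. H (p, y)) =
        (mean xs (\<lambda>y. H (p, y)) - mean xs (\<lambda>y. H (q, y))) +
        (mean xs (\<lambda>y. H (q, y)) - haar (\<lambda>y. H (q, y))) -
        (haar (\<lambda>y. H (p, y)) - haar (\<lambda>y. H (q, y)))" by simp
    also have "norm \<dots> \<le> e / 3 + e / 3 + e / 3"
      by (intro norm_triangle_le_diff norm_triangle_le add_mono m h xs(2) q(1))
    finally show ?thesis by simp
  qed
  with xs(1) that show ?thesis by blast
qed

section \<open>The inner product of the Haar integral, and approximate identities\<close>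

definition inner_haar :: "('a \<Rightarrow> complex) \<Rightarrow> ('a \<Rightarrow> complex) \<Rightarrow> complex" where
  "inner_haar f g = haar (\<lambda>x. f x * cnj (g x))"

lemma cont_mult: "cont f \<Longrightarrow> cont g \<Longrightarrow> cont (\<lambda>x. f x * g x :: complex)"
  by (erule continuous_map_binop) (auto simp: case_prod_unfold intro!: continuous_intros)

lemma cont_cmult: "cont f \<Longrightarrow> cont (\<lambda>x. c * f x :: complex)"
  by (erule continuous_map_unop) (intro continuous_intros)

lemma cont_cnj: "cont f \<Longrightarrow> cont (\<lambda>x. cnj (f x))"
  by (erule continuous_map_unop) (intro continuous_intros)

lemma haar_diff:
  assumes "cont f" "cont g"
  shows "haar (\<lambda>x. f x - g x) = haar f - haar g"
  using haar_add[OF assms(1) cont_cmult[OF assms(2), of "-1"]] haar_cmult[OF assms(2), of "-1"]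
  by simp

lemma inner_haar_diff_left:
  assumes "cont f" "cont g" "cont h"
  shows "inner_haar (\<lambda>x. f x - g x) h = inner_haar f h - inner_haar g h"
  using haar_diff[of "\<lambda>x. f x * cnj (h x)" "\<lambda>x. g x * cnj (h x)"] assms
  by (simp add: inner_haar_def cont_mult cont_cnj left_diff_distrib)

lemma inner_haar_cmult_left:
  assumes "cont f" "cont g"
  shows "inner_haar (\<lambda>x. c * f x) g = c * inner_haar f g"
  using haar_cmult[of "\<lambda>x. f x * cnj (g x)" c] assms
  by (simp add: inner_haar_def cont_mult cont_cnj mult.assoc)

lemma inner_haar_commute:
  assumes "cont f" "cont g"
  shows "inner_haar g f = cnj (inner_haar f g)"
  using haar_cnj[of "\<lambda>x. f x * cnj (g x)"] assms
  by (simp add: inner_haar_def cont_mult cont_cnj mult.commute)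

lemma Re_inner_haar_self_le:
  assumes "cont f" "\<And>x. x \<in> carrier G \<Longrightarrow> norm (f x) \<le> B"
  shows "Re (inner_haar f f) \<le> B\<^sup>2"
proof -
  have "norm (haar (\<lambda>x. f x * cnj (f x))) \<le> B\<^sup>2"
    using assms by (intro norm_haar_le cont_mult cont_cnj)
      (auto simp: norm_mult power2_eq_square intro!: mult_mono intro: order_trans[OF norm_ge_zero])
  then show ?thesis unfolding inner_haar_def using complex_Re_le_cmod order_trans by blast
qed

lemma Re_inner_haar_self_ge:
  assumes "cont f"
  shows "Re (inner_haar f f) \<ge> 0"
  unfolding inner_haar_def
  using assms by (intro Re_haar_ge cont_mult cont_cnj) (auto simp: complex_mult_cnj)

text \<open>The basis of the variational argument: if subtracting multiples of \<open>f\<close> can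
  hardly shorten \<open>r\<close>, then \<open>inner_haar r f\<close> is small.\<close>

lemma inner_haar_expand:
  assumes r: "cont r" and f: "cont f"
  shows "Re (inner_haar (\<lambda>x. r x - t * f x) (\<lambda>x. r x - t * f x)) =
    Re (inner_haar r r) - 2 * Re (cnj t * inner_haar r f) + (norm t)\<^sup>2 * Re (inner_haar f f)"
proof -
  have tf: "cont (\<lambda>x. t * f x)" and d: "cont (\<lambda>x. r x - t * f x)"
    using r f by (auto intro: cont_cmult continuous_map_diff)
  have 1: "inner_haar k (\<lambda>x. r x - t * f x) = inner_haar k r - cnj t * inner_haar k f"
    if "cont k" for k
    using inner_haar_commute[OF d that] inner_haar_diff_left[OF r tf that]
      inner_haar_cmult_left[OF f that, of t] inner_haar_commute[OF that r] inner_haar_commute[OF that f]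
    by simp
  have "inner_haar (\<lambda>x. r x - t * f x) (\<lambda>x. r x - t * f x) =
    inner_haar r r - cnj t * inner_haar r f - t * (cnj (inner_haar r f) - cnj t * inner_haar f f)"
    unfolding inner_haar_diff_left[OF r tf d] inner_haar_cmult_left[OF f d]
    unfolding 1[OF r] 1[OF f] using inner_haar_commute[OF r f] by simp
  also have "\<dots> = inner_haar r r - (cnj t * inner_haar r f + cnj (cnj t * inner_haar r f))
      + of_real ((norm t)\<^sup>2) * inner_haar f f"
    unfolding complex_norm_square by (simp add: algebra_simps)
  finally show ?thesis by simp
qed

lemma norm_haar_le_Re_haar:
  assumes F: "cont F" and K: "cont K" and le: "\<And>x. x \<in> carrier G \<Longrightarrow> norm (F x) \<le> Re (K x)"
  shows "norm (haar F) \<le> Re (haar K)"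
proof -
  \<comment> \<open>A unimodular \<open>c\<close> rotates the integral onto the nonnegative axis,
    after which only real parts are compared.\<close>
  obtain c where c: "norm c = 1" "c * haar F = norm (haar F)"
  proof (cases "haar F = 0")
    case True
    then show ?thesis using that[of 1] by simp
  next
    case False
    then show ?thesis
      using that[of "cnj (haar F) / norm (haar F)"]
      by (simp add: norm_divide complex_norm_square[symmetric] mult.commute power2_eq_square)
  qed
  have cF: "cont (\<lambda>x. c * F x)" by (rule cont_cmult[OF F])
  have "0 \<le> Re (haar (\<lambda>x. K x - c * F x))"
  proof (rule Re_haar_ge)
    show "cont (\<lambda>x. K x - c * F x)" using K cF by (rule continuous_map_diff)
    fix x assume "x \<in> carrier G"
    moreover have "Re (c * F x) \<le> norm (F x)"
      using complex_Re_le_cmod[of "c * F x"] c(1) by (simp add: norm_mult)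
    ultimately show "0 \<le> Re (K x - c * F x)" using le[of x] by simp
  qed
  also have "haar (\<lambda>x. K x - c * F x) = haar K - norm (haar F)"
    using haar_diff[OF K cF] haar_cmult[OF F, of c] c(2) by simp
  finally show ?thesis by simp
qed

text \<open>A Urysohn function with value 1 at the identity is divided by its integral, which is
  positive by \<open>Re_haar_pos\<close> and real because the function equals its conjugate.\<close>

lemma approximate_identity:
  assumes U: "openin T U" "\<one> \<in> U"
  obtains w :: "'a \<Rightarrow> complex" where "cont w" "haar w = 1" "\<And>x. w x = of_real (Re (w x))"
    "\<And>x. x \<in> carrier G \<Longrightarrow> Re (w x) \<ge> 0" "\<And>x. x \<in> carrier G - U \<Longrightarrow> w x = 0"
proof -
  have "normal_space T"
    using compact_T Hausdorff_T compact_Hausdorff_or_regular_imp_normal_space by blast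
  moreover have "closedin T (topspace T - U)" using U(1) by blast
  moreover have "closedin T {\<one>}"
    using Hausdorff_T by (simp add: Hausdorff_imp_t1_space closedin_t1_singleton topspace_T)
  moreover have "disjnt (topspace T - U) {\<one>}" using U(2) by simp
  ultimately obtain f :: "'a \<Rightarrow> real" where f: "continuous_map T (top_of_set {0..1}) f"
    "f ` (topspace T - U) \<subseteq> {0}" "f ` {\<one>} \<subseteq> {1}"
    using Urysohn_lemma[of T "topspace T - U" "{\<one>}" 0 1] by auto
  have cf: "cont f" and f01: "\<And>x. x \<in> carrier G \<Longrightarrow> 0 \<le> f x"
    using f(1) by (auto simp: continuous_map_in_subtopology image_subset_iff topspace_T Pi_iff)
  let ?F = "\<lambda>x. complex_of_real (f x)"
  have F: "cont ?F" by (rule continuous_map_unop[OF cf]) (intro continuous_intros)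
  define h where "h = Re (haar ?F)"
  have "h > 0" unfolding h_def using f01 f(3) by (intro Re_haar_pos[OF F]) auto
  have "cnj (haar ?F) = haar ?F" using haar_cnj[OF F] by simp
  then have h: "haar ?F = of_real h" unfolding h_def by (simp add: complex_eq_iff)
  show ?thesis
  proof
    show "cont (\<lambda>x. of_real (1 / h) * ?F x)" by (rule cont_cmult[OF F])
    show "haar (\<lambda>x. of_real (1 / h) * ?F x) = 1"
      unfolding haar_cmult[OF F] h using \<open>h > 0\<close> by simp
  qed (use f01 f(2) \<open>h > 0\<close> in \<open>auto simp: topspace_T image_subset_iff\<close>)
qed

end

section \<open>Invariant algebras\<close>

locale invariant_alg = compact_group G T for G :: "('a, 'b) monoid_scheme" (structure) and T +
  fixes A :: "('a \<Rightarrow> complex) set"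
  assumes invariant_A: "invariant_algebra G T A"
begin

text \<open>Membership in \<open>A\<close> for functions that need not be extensional.\<close>

definition inA :: "('a \<Rightarrow> complex) \<Rightarrow> bool" where
  "inA F \<longleftrightarrow> restrict F (carrier G) \<in> A"

lemma closed_A: "closed_subalgebra T A"
  using invariant_A by (simp add: invariant_algebra_def)

lemma A_subset: "A \<subseteq> mspace (C_space T)"
  using closed_A by (simp add: closed_subalgebra_def)

lemma A_D:
  assumes "f \<in> A"
  shows "f \<in> extensional (carrier G)" "cont f" "restrict f (carrier G) = f" "inA f"
  using subsetD[OF A_subset assms] mspace_C_space[OF compact_T, of f] assms
  by (auto simp: topspace_T extensional_restrict inA_def simp del: mspace_cfunspace)

lemma carrier_ne: "topspace T \<noteq> {}"
  using one_closed by (auto simp: topspace_T)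

lemma inA_cont:
  assumes "inA F"
  shows "cont F"
proof -
  have "cont (restrict F (carrier G))" using assms A_D(2) by (simp add: inA_def)
  then show ?thesis by (rule continuous_map_eq) (simp add: topspace_T)
qed

lemma inA_add:
  assumes "inA F" "inA H"
  shows "inA (\<lambda>x. F x + H x)"
proof -
  have "(\<lambda>x\<in>topspace T. restrict F (carrier G) x + restrict H (carrier G) x) \<in> A"
    using closed_A assms unfolding closed_subalgebra_def inA_def by blast
  also have "(\<lambda>x\<in>topspace T. restrict F (carrier G) x + restrict H (carrier G) x) = restrict (\<lambda>x. F x + H x) (carrier G)"
    unfolding topspace_T by (rule restrict_ext) simp
  finally show ?thesis unfolding inA_def .
qed

lemma inA_cmult:
  assumes "inA F"
  shows "inA (\<lambda>x. c * F x)"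
proof -
  have "(\<lambda>x\<in>topspace T. c * restrict F (carrier G) x) \<in> A"
    using closed_A assms unfolding closed_subalgebra_def inA_def by blast
  also have "(\<lambda>x\<in>topspace T. c * restrict F (carrier G) x) = restrict (\<lambda>x. c * F x) (carrier G)"
    unfolding topspace_T by (rule restrict_ext) simp
  finally show ?thesis unfolding inA_def .
qed

lemma inA_mult:
  assumes "inA F" "inA H"
  shows "inA (\<lambda>x. F x * H x)"
proof -
  have "(\<lambda>x\<in>topspace T. restrict F (carrier G) x * restrict H (carrier G) x) \<in> A"
    using closed_A assms unfolding closed_subalgebra_def inA_def by blast
  also have "(\<lambda>x\<in>topspace T. restrict F (carrier G) x * restrict H (carrier G) x) = restrict (\<lambda>x. F x * H x) (carrier G)"
    unfolding topspace_T by (rule restrict_ext) simp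
  finally show ?thesis unfolding inA_def .
qed

lemma inA_const: "inA (\<lambda>x. c)"
  using invariant_A by (simp add: invariant_algebra_def inA_def)

lemma inA_left_translate:
  assumes "g \<in> carrier G" "inA F"
  shows "inA (\<lambda>x. F (g \<otimes> x))"
proof -
  have "left_translate G g (restrict F (carrier G)) \<in> A"
    using assms invariant_A unfolding invariant_algebra_def inA_def by blast
  moreover have "left_translate G g (restrict F (carrier G)) = restrict (\<lambda>x. F (g \<otimes> x)) (carrier G)"
    using assms(1) by (auto simp: left_translate_def)
  ultimately show ?thesis by (simp add: inA_def)
qed

lemma inA_right_translate:
  assumes "g \<in> carrier G" "inA F"
  shows "inA (\<lambda>x. F (x \<otimes> g))"
proof -
  have "right_translate G g (restrict F (carrier G)) \<in> A"
    using assms invariant_A unfolding invariant_algebra_def inA_def by blast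
  moreover have "right_translate G g (restrict F (carrier G)) = restrict (\<lambda>x. F (x \<otimes> g)) (carrier G)"
    using assms(1) by (auto simp: right_translate_def)
  ultimately show ?thesis by (simp add: inA_def)
qed

lemma inA_diff: "inA F \<Longrightarrow> inA H \<Longrightarrow> inA (\<lambda>x. F x - H x)"
  using inA_add[of F "\<lambda>x. (-1) * H x"] inA_cmult[of H "-1"] by simp

lemma inA_power: "inA F \<Longrightarrow> inA (\<lambda>x. F x ^ n)"
  by (induction n) (auto intro: inA_const inA_mult)

lemma inA_sum: "(\<And>i. i \<in> I \<Longrightarrow> inA (F i)) \<Longrightarrow> inA (\<lambda>x. \<Sum>i\<in>I. F i x)"
  by (induction I rule: infinite_finite_induct) (auto intro: inA_const inA_add)

lemma inA_mean:
  assumes "\<And>a. a \<in> set xs \<Longrightarrow> inA (F a)"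
  shows "inA (\<lambda>x. mean xs (\<lambda>a. F a x))"
proof -
  have "inA (\<lambda>x. \<Sum>a\<leftarrow>xs. F a x)"
    using assms by (induction xs) (auto intro: inA_add inA_const)
  from inA_cmult[OF this, of "1 / of_nat (length xs)"] show ?thesis by (simp add: mean_def)
qed

text \<open>Closedness of \<open>A\<close> in a form that does not presuppose continuity of
  \<open>F\<close>: as a uniform limit \<open>F\<close> is continuous, so its restriction lies in
  C(G) and then in the closure of \<open>A\<close>.\<close>

lemma inA_limit:
  assumes lim: "\<And>e. e > 0 \<Longrightarrow> \<exists>H. inA H \<and> (\<forall>x\<in>carrier G. norm (F x - H x) \<le> e)"
  shows "inA F"
proof -
  let ?F = "restrict F (carrier G)"
  have "cont F"
    by (rule continuous_map_approximable) (use lim inA_cont topspace_T in fastforce)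
  then have "cont ?F" by (rule continuous_map_eq) (simp add: topspace_T)
  then have "?F \<in> mspace (C_space T)" by (subst mspace_C_space[OF compact_T]) (simp add: topspace_T)
  moreover have "\<exists>h\<in>A. \<forall>x\<in>topspace T. norm (?F x - h x) \<le> e" if e: "e > 0" for e
  proof -
    obtain H where H: "inA H" "\<forall>x\<in>carrier G. norm (F x - H x) \<le> e" using lim[OF e] by blast
    then show ?thesis
      by (intro bexI[of _ "restrict H (carrier G)"]) (auto simp: inA_def topspace_T)
  qed
  ultimately have "?F \<in> mtopology_of (C_space T) closure_of A"
    using C_space_closure_of[OF A_subset carrier_ne] by blast
  moreover have "closedin (mtopology_of (C_space T)) A"
    using closed_A by (simp add: closed_subalgebra_def)
  ultimately show ?thesis by (simp add: inA_def closure_of_closedin)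
qed

text \<open>An approximate identity \<open>w\<close> gives \<open>a(g) \<approx> \<integral> a(gy) w(y) dy\<close>. Since all left translates
  of \<open>a\<close> lie in \<open>A\<close>, the function \<open>w\<close> may be replaced by an element of \<open>A\<close> that almost
  minimises the \<open>L\<^sup>2\<close> distance to \<open>w\<close>.\<close>

lemma reproducing_approximation:
  assumes a: "inA a" and e: "e > 0"
  obtains b where "inA b"
    "\<And>g. g \<in> carrier G \<Longrightarrow> norm (a g - haar (\<lambda>y. a (g \<otimes> y) * cnj (b y))) \<le> e"
proof -
  note ca = inA_cont[OF a]
  have e2: "e / 2 > 0" using e by simp
  have cm: "continuous_map (prod_topology T T) euclidean (\<lambda>z. a (snd z \<otimes> fst z))"
    by (intro cont_of[OF ca] continuous_group)
  have one: "\<one> \<in> topspace T" by (simp add: topspace_T)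
  \<comment> \<open>Right translation by elements of \<open>U\<close> moves \<open>a\<close> by less
    than \<open>e / 2\<close>, uniformly over the group.\<close>
  obtain U where U: "openin T U" "\<one> \<in> U"
    and U': "\<And>u x. u \<in> U \<Longrightarrow> x \<in> topspace T \<Longrightarrow>
      norm (a (snd (u, x) \<otimes> fst (u, x)) - a (snd (\<one>, x) \<otimes> fst (\<one>, x))) < e / 2"
    by (rule compact_parameter_net[OF cm compact_T one e2]) (rule that)
  have U3: "norm (a (x \<otimes> u) - a x) < e / 2" if "u \<in> U" "x \<in> carrier G" for u x
    using U'[of u x] that by (simp add: topspace_T)
  obtain w :: "'a \<Rightarrow> complex" where w: "cont w" "haar w = 1" "\<And>x. w x = of_real (Re (w x))"
    "\<And>x. x \<in> carrier G \<Longrightarrow> Re (w x) \<ge> 0" "\<And>x. x \<in> carrier G - U \<Longrightarrow> w x = 0"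
    using approximate_identity[OF U(1,2)] by blast
  have cL: "cont (\<lambda>y. a (g \<otimes> y))" if "g \<in> carrier G" for g
    using inA_cont[OF inA_left_translate[OF that a]] .
  \<comment> \<open>\<open>w\<close> is nonnegative, has integral 1 and vanishes off
    \<open>U\<close>, so the integral is a weighted average of values close to
    \<open>a g\<close>.\<close>
  have near: "norm (a g - haar (\<lambda>y. a (g \<otimes> y) * w y)) \<le> e / 2" if g: "g \<in> carrier G" for g
  proof -
    have c1: "cont (\<lambda>y. a g * w y)" and c2: "cont (\<lambda>y. a (g \<otimes> y) * w y)"
      using cont_cmult[OF w(1)] cont_mult[OF cL[OF g] w(1)] by auto
    have "a g - haar (\<lambda>y. a (g \<otimes> y) * w y) = haar (\<lambda>y. a g * w y - a (g \<otimes> y) * w y)"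
      unfolding haar_diff[OF c1 c2] haar_cmult[OF w(1)] w(2) by simp
    also have "norm \<dots> \<le> Re (haar (\<lambda>y. of_real (e / 2) * w y))"
    proof (rule norm_haar_le_Re_haar)
      fix y assume y: "y \<in> carrier G"
      have "norm ((a g - a (g \<otimes> y)) * w y) \<le> e / 2 * Re (w y)"
      proof (cases "y \<in> U")
        case True
        have "norm (w y) = Re (w y)"
          using w(4)[OF y] by (subst w(3)) (simp only: norm_of_real abs_of_nonneg)
        moreover have "norm (a g - a (g \<otimes> y)) \<le> e / 2"
          using U3[OF True g] by (simp add: norm_minus_commute less_imp_le)
        ultimately show ?thesis using w(4)[OF y] by (metis norm_mult mult_right_mono)
      qed (use w(5) y in simp)
      then show "norm (a g * w y - a (g \<otimes> y) * w y) \<le> Re (of_real (e / 2) * w y)"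
        by (simp add: left_diff_distrib)
    qed (rule continuous_map_diff[OF c1 c2] cont_cmult[OF w(1)])+
    also have "\<dots> = e / 2" unfolding haar_cmult[OF w(1)] w(2) by simp
    finally show ?thesis .
  qed
  obtain B where B: "B > 0" "\<And>x. x \<in> carrier G \<Longrightarrow> norm (a x) \<le> B"
    using compact_bounded_norm[OF compact_T ca] by (auto simp: topspace_T)
  \<comment> \<open>\<open>Q b\<close> is the squared L2 distance from \<open>w\<close> to
    \<open>b\<close>. Its infimum over \<open>A\<close> is only approached, as \<open>A\<close> need
    not be complete for this distance.\<close>
  define Q where "Q b = Re (inner_haar (\<lambda>x. w x - b x) (\<lambda>x. w x - b x))" for b
  define d where "d = Inf (Q ` Collect inA)"
  have Q0: "Q b \<ge> 0" if "inA b" for b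
    unfolding Q_def using w(1) inA_cont[OF that] by (intro Re_inner_haar_self_ge continuous_map_diff)
  have d_le: "d \<le> Q b" if "inA b" for b
    unfolding d_def using that Q0 by (intro cInf_lower bdd_belowI[of _ 0]) auto
  \<comment> \<open>This excess over the infimum is what bounds the inner product \<open>c\<close>
    below by \<open>e / 2\<close> in modulus.\<close>
  have "(e / (2 * B))\<^sup>2 > 0" using e B(1) by simp
  then have "\<exists>q\<in>Q ` Collect inA. q < d + (e / (2 * B))\<^sup>2"
    unfolding d_def using inA_const by (intro cInf_lessD) auto
  then obtain b where b: "inA b" "Q b < d + (e / (2 * B))\<^sup>2" by auto
  let ?r = "\<lambda>x. w x - b x"
  have cr: "cont ?r" using w(1) inA_cont[OF b(1)] by (rule continuous_map_diff)
  have "norm (a g - haar (\<lambda>y. a (g \<otimes> y) * cnj (b y))) \<le> e" if g: "g \<in> carrier G" for g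
  proof -
    let ?f = "\<lambda>y. a (g \<otimes> y)"
    define c where "c = inner_haar ?r ?f"
    have f: "inA ?f" using inA_left_translate[OF g a] .
    \<comment> \<open>This step length minimises \<open>s\<^sup>2 * B\<^sup>2 - 2 * s\<close>, where
      \<open>B\<^sup>2\<close> bounds the squared norm of \<open>?f\<close>.\<close>
    define s where "s = 1 / B\<^sup>2"
    have s: "s > 0" using B(1) by (simp add: s_def)
    have "inA (\<lambda>x. b x + of_real s * c * ?f x)" using b(1) inA_cmult[OF f] by (rule inA_add)
    from d_le[OF this] have "d \<le> Re (inner_haar (\<lambda>x. ?r x - of_real s * c * ?f x) (\<lambda>x. ?r x - of_real s * c * ?f x))"
      by (simp add: Q_def algebra_simps)
    also have "\<dots> = Q b - 2 * Re (cnj (of_real s * c) * c) + (norm (of_real s * c))\<^sup>2 * Re (inner_haar ?f ?f)"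
      unfolding inner_haar_expand[OF cr inA_cont[OF f]] Q_def c_def ..
    also have "\<dots> \<le> Q b - 2 * (s * (norm c)\<^sup>2) + (s * norm c)\<^sup>2 * B\<^sup>2"
    proof -
      have "Re (inner_haar ?f ?f) \<le> B\<^sup>2"
        using B(2) g by (intro Re_inner_haar_self_le[OF inA_cont[OF f]]) auto
      moreover have "Re (cnj (of_real s * c) * c) = s * (norm c)\<^sup>2"
        by (simp add: cmod_power2) (simp add: power2_eq_square algebra_simps)
      ultimately show ?thesis using s by (simp add: norm_mult mult_left_mono)
    qed
    also have "(s * norm c)\<^sup>2 * B\<^sup>2 = s * (norm c)\<^sup>2"
      using B(1) by (simp add: s_def power2_eq_square)
    finally have "s * (norm c)\<^sup>2 \<le> (e / (2 * B))\<^sup>2" using b(2) by simp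
    then have "(norm c)\<^sup>2 \<le> (e / 2)\<^sup>2"
      using B(1) by (simp add: s_def field_simps power2_eq_square)
    then have c: "norm c \<le> e / 2" using e by (simp add: power2_le_iff_abs_le)
    \<comment> \<open>Replacing \<open>w\<close> by \<open>cnj b\<close> costs one inner product
      with the remainder, since \<open>w\<close> is real and equals its conjugate.\<close>
    have "haar (\<lambda>y. ?f y * w y) - haar (\<lambda>y. ?f y * cnj (b y)) = inner_haar ?f ?r"
    proof -
      have "cnj (w y) = w y" for y using w(3) by (metis complex_cnj_complex_of_real)
      then show ?thesis
        using haar_diff[of "\<lambda>y. ?f y * w y" "\<lambda>y. ?f y * cnj (b y)"] w(1) b(1) f
        by (simp add: inner_haar_def right_diff_distrib cont_mult cont_cnj inA_cont)
    qed
    also have "\<dots> = cnj c" unfolding c_def by (rule inner_haar_commute[OF cr inA_cont[OF f]])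
    finally have "norm (haar (\<lambda>y. ?f y * w y) - haar (\<lambda>y. ?f y * cnj (b y))) \<le> e / 2" using c by simp
    then have "norm ((a g - haar (\<lambda>y. ?f y * w y)) +
        (haar (\<lambda>y. ?f y * w y) - haar (\<lambda>y. ?f y * cnj (b y)))) \<le> e / 2 + e / 2"
      by (intro norm_triangle_le add_mono near g)
    then show ?thesis by simp
  qed
  with b(1) show ?thesis by (rule that)
qed

text \<open>After conjugation and the substitution of \<open>g \<otimes> y\<close> for
  \<open>y\<close>, the reproducing integral contains \<open>g\<close> only through
  \<open>b (g \<otimes> y)\<close>, a right translate of \<open>b\<close> as a function of
  \<open>g\<close>. Its Riemann sums therefore lie in \<open>A\<close>.\<close>

lemma inA_star:
  assumes a: "inA a"
  shows "inA (\<lambda>x. cnj (a (inv x)))"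
proof (rule inA_limit)
  fix e :: real assume e: "e > 0"
  then obtain b where b: "inA b"
    "\<And>g. g \<in> carrier G \<Longrightarrow> norm (a g - haar (\<lambda>y. a (g \<otimes> y) * cnj (b y))) \<le> e"
    using reproducing_approximation[OF a] by blast
  note ca = inA_cont[OF a] and cb = inA_cont[OF b(1)]
  define K where "K g = haar (\<lambda>y. cnj (a y) * b (g \<otimes> y))" for g
  have near: "norm (cnj (a (inv g)) - K g) \<le> e" if g: "g \<in> carrier G" for g
  proof -
    have cL: "cont (\<lambda>y. a (inv g \<otimes> y))" using g inA_cont[OF inA_left_translate[OF _ a]] by simp
    let ?F = "\<lambda>y. cnj (a (inv g \<otimes> y)) * b y"
    have cF: "cont ?F" using cont_mult[OF cont_cnj[OF cL] cb] .
    have "cnj (haar (\<lambda>y. a (inv g \<otimes> y) * cnj (b y))) = haar ?F"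
      using haar_cnj[of "\<lambda>y. a (inv g \<otimes> y) * cnj (b y)"] cont_mult[OF cL cont_cnj[OF cb]] by simp
    also have "\<dots> = haar (\<lambda>y. ?F (g \<otimes> y))" using haar_left_translate[OF cF g] by simp
    also have "\<dots> = K g"
      unfolding K_def using g by (intro haar_cong) (simp add: m_assoc[symmetric])
    finally show ?thesis
      using b(2)[of "inv g"] g by (metis complex_cnj_diff complex_mod_cnj inv_closed)
  qed
  have "inA K"
  proof (rule inA_limit)
    fix e :: real assume e: "e > 0"
    have "continuous_map (prod_topology T T) euclidean (\<lambda>z. cnj (a (snd z)) * b (fst z \<otimes> snd z))"
      by (intro continuous_map_binop[where h = "\<lambda>u v. cnj u * v"] cont_of[OF ca] cont_of[OF cb] continuous_group)
        (auto simp: case_prod_unfold intro!: continuous_intros)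
    from haar_Riemann_sums[OF compact_T this e] obtain xs where xs: "elts xs"
      "\<And>g. g \<in> carrier G \<Longrightarrow> norm (mean xs (\<lambda>y. cnj (a y) * b (g \<otimes> y)) - K g) \<le> e"
      unfolding K_def by (auto simp: topspace_T)
    moreover have "inA (\<lambda>g. mean xs (\<lambda>y. cnj (a y) * b (g \<otimes> y)))"
      using eltsD(2)[OF xs(1)] by (intro inA_mean inA_cmult inA_right_translate b(1))
    ultimately show "\<exists>H. inA H \<and> (\<forall>x\<in>carrier G. norm (K x - H x) \<le> e)"
      by (intro exI[of _ "\<lambda>g. mean xs (\<lambda>y. cnj (a y) * b (g \<otimes> y))"]) (auto simp: norm_minus_commute)
  qed
  with near show "\<exists>H. inA H \<and> (\<forall>x\<in>carrier G. norm (cnj (a (inv x)) - H x) \<le> e)" by blast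
qed

subsection \<open>Approximation by tensors\<close>

text \<open>Uniform closure of A \<otimes> A for curried functions; continuity and extensionality
  are left out here and restored in \<open>closed_tensor_iff\<close>.\<close>

definition tens :: "('a \<Rightarrow> 'a \<Rightarrow> complex) \<Rightarrow> bool" where
  "tens F \<longleftrightarrow> (\<forall>e>0. \<exists>(n::nat) a b. (\<forall>i<n. inA (a i) \<and> inA (b i)) \<and>
     (\<forall>x\<in>carrier G. \<forall>y\<in>carrier G. norm (F x y - (\<Sum>i<n. a i x * b i y)) \<le> e))"

lemma tensE:
  assumes "tens F" "e > 0"
  obtains n :: nat and a b where "\<And>i. i < n \<Longrightarrow> inA (a i)" "\<And>i. i < n \<Longrightarrow> inA (b i)"
    "\<And>x y. x \<in> carrier G \<Longrightarrow> y \<in> carrier G \<Longrightarrow> norm (F x y - (\<Sum>i<n. a i x * b i y)) \<le> e"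
proof -
  from assms have "\<exists>(n::nat) a b. (\<forall>i<n. inA (a i) \<and> inA (b i)) \<and>
     (\<forall>x\<in>carrier G. \<forall>y\<in>carrier G. norm (F x y - (\<Sum>i<n. a i x * b i y)) \<le> e)"
    unfolding tens_def by simp
  then obtain n :: nat and a b where "\<forall>i<n. inA (a i) \<and> inA (b i)"
    "\<forall>x\<in>carrier G. \<forall>y\<in>carrier G. norm (F x y - (\<Sum>i<n. a i x * b i y)) \<le> e"
    by (elim exE conjE)
  then show ?thesis by (intro that[of n a b]) simp_all
qed

lemma tens_swap:
  assumes "tens F"
  shows "tens (\<lambda>x y. F y x)"
  unfolding tens_def
proof (intro allI impI)
  fix e :: real assume "e > 0"
  obtain n :: nat and a b where n: "\<And>i. i < n \<Longrightarrow> inA (a i)" "\<And>i. i < n \<Longrightarrow> inA (b i)"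
    "\<And>x y. x \<in> carrier G \<Longrightarrow> y \<in> carrier G \<Longrightarrow> norm (F x y - (\<Sum>i<n. a i x * b i y)) \<le> e"
    by (rule tensE[OF assms \<open>e > 0\<close>]) auto
  then show "\<exists>(n::nat) a b. (\<forall>i<n. inA (a i) \<and> inA (b i)) \<and>
     (\<forall>x\<in>carrier G. \<forall>y\<in>carrier G. norm (F y x - (\<Sum>i<n. a i x * b i y)) \<le> e)"
    by (intro exI[of _ n] exI[of _ b] exI[of _ a]) (auto simp: mult.commute)
qed

text \<open>The substitution \<open>z = h \<otimes> y\<close> splits the reproducing integrand for
  \<open>g \<otimes> h\<close> into \<open>f (g \<otimes> z)\<close> and
  \<open>cnj (b (inv h \<otimes> z))\<close>. A Riemann sum valid for all pairs is then a sum of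
  products, whose second factors lie in \<open>A\<close> by \<open>inA_star\<close>.\<close>

lemma tens_comult:
  assumes f: "inA f"
  shows "tens (\<lambda>x y. f (x \<otimes> y))"
  unfolding tens_def
proof (intro allI impI)
  fix e :: real assume "e > 0"
  then have e2: "e / 2 > 0" by simp
  obtain b where b: "inA b"
    "\<And>g. g \<in> carrier G \<Longrightarrow> norm (f g - haar (\<lambda>y. f (g \<otimes> y) * cnj (b y))) \<le> e / 2"
    using reproducing_approximation[OF f e2] by blast
  note cf = inA_cont[OF f] and cb = inA_cont[OF b(1)]
  define H where "H = (\<lambda>z. f (fst (fst z) \<otimes> snd z) * cnj (b (inv (snd (fst z)) \<otimes> snd z)))"
  have cH: "continuous_map (prod_topology (prod_topology T T) T) euclidean H"
  proof -
    have "continuous_map (prod_topology (prod_topology T T) T) T (\<lambda>z. fst (fst z))"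
      "continuous_map (prod_topology (prod_topology T T) T) T (\<lambda>z. snd (fst z))"
      using continuous_map_compose[OF continuous_map_fst continuous_map_fst]
        continuous_map_compose[OF continuous_map_fst continuous_map_snd] by (simp_all add: o_def)
    then show ?thesis
      unfolding H_def
      by (intro continuous_map_binop[where h = "\<lambda>u v. u * cnj v"] cont_of[OF cf] cont_of[OF cb]
          continuous_mult_of continuous_inv_of continuous_map_snd)
        (auto simp: case_prod_unfold intro!: continuous_intros)
  qed
  have cTT: "compact_space (prod_topology T T)" using compact_T by (simp add: compact_space_prod_topology)
  obtain xs where xs: "elts xs" "\<And>p. p \<in> topspace (prod_topology T T) \<Longrightarrow>
      norm (mean xs (\<lambda>z. H (p, z)) - haar (\<lambda>z. H (p, z))) \<le> e / 2"
    by (rule haar_Riemann_sums[OF cTT cH e2]) (rule that)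
  define n where "n = length xs"
  \<comment> \<open>The weight of the mean is absorbed into the first factor.\<close>
  define \<alpha> where "\<alpha> i g = 1 / of_nat n * f (g \<otimes> xs ! i)" for i g
  define \<beta> where "\<beta> i h = cnj (b (inv h \<otimes> xs ! i))" for i h
  have mem: "xs ! i \<in> carrier G" if "i < n" for i using eltsD(2)[OF xs(1)] that by (simp add: n_def)
  have "inA (\<alpha> i) \<and> inA (\<beta> i)" if "i < n" for i
    unfolding \<alpha>_def \<beta>_def
    using inA_cmult[OF inA_right_translate[OF mem[OF that] f]]
      inA_star[OF inA_right_translate[OF mem[OF that] b(1)]] by blast
  moreover have "norm (f (g \<otimes> h) - (\<Sum>i<n. \<alpha> i g * \<beta> i h)) \<le> e"
    if g: "g \<in> carrier G" and h: "h \<in> carrier G" for g h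
  proof -
    let ?F = "\<lambda>z. f (g \<otimes> z) * cnj (b (inv h \<otimes> z))"
    have cF: "cont ?F"
      using g h by (intro cont_mult cont_cnj inA_cont inA_left_translate f b(1)) auto
    have "haar (\<lambda>y. f (g \<otimes> h \<otimes> y) * cnj (b y)) = haar (\<lambda>y. ?F (h \<otimes> y))"
    proof (rule haar_cong)
      fix y assume y: "y \<in> carrier G"
      have "inv h \<otimes> (h \<otimes> y) = y" using h y by (simp add: m_assoc[symmetric])
      then show "f (g \<otimes> h \<otimes> y) * cnj (b y) = ?F (h \<otimes> y)" using g h y by (simp add: m_assoc)
    qed
    then have 1: "norm (f (g \<otimes> h) - haar ?F) \<le> e / 2"
      using b(2)[of "g \<otimes> h"] g h haar_left_translate[OF cF h] by simp
    have 2: "norm (haar ?F - mean xs ?F) \<le> e / 2"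
      using xs(2)[of "(g, h)"] g h by (simp add: topspace_T norm_minus_commute H_def)
    have "mean xs ?F = (\<Sum>i<n. \<alpha> i g * \<beta> i h)"
      by (simp add: mean_def sum_list_sum_nth atLeast0LessThan n_def \<alpha>_def \<beta>_def sum_divide_distrib)
    then have "norm ((f (g \<otimes> h) - haar ?F) + (haar ?F - mean xs ?F)) \<le> e / 2 + e / 2"
      by (intro norm_triangle_le add_mono 1 2)
    with \<open>mean xs ?F = _\<close> show ?thesis by simp
  qed
  ultimately show "\<exists>(n::nat) a b. (\<forall>i<n. inA (a i) \<and> inA (b i)) \<and>
     (\<forall>x\<in>carrier G. \<forall>y\<in>carrier G. norm (f (x \<otimes> y) - (\<Sum>i<n. a i x * b i y)) \<le> e)"
    by (intro exI[of _ n] exI[of _ \<alpha>] exI[of _ \<beta>] conjI allI impI ballI) simp_all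
qed

subsection \<open>Multiplicative functionals\<close>

abbreviation maxspace :: "(('a \<Rightarrow> complex) \<Rightarrow> complex) set" where
  "maxspace \<equiv> max_ideal_space T A"

text \<open>Functionals in the maximal ideal space are extensional on \<open>A\<close>; restricting
  the argument first lets them act on lambda terms.\<close>

definition app :: "(('a \<Rightarrow> complex) \<Rightarrow> complex) \<Rightarrow> ('a \<Rightarrow> complex) \<Rightarrow> complex" where
  "app \<phi> F = \<phi> (restrict F (carrier G))"

lemma app_cong: "(\<And>x. x \<in> carrier G \<Longrightarrow> F x = H x) \<Longrightarrow> app \<phi> F = app \<phi> H"
  unfolding app_def by (metis restrict_ext)

lemma app_A: "f \<in> A \<Longrightarrow> app \<phi> f = \<phi> f"
  by (simp add: app_def A_D(3))

lemma maxspaceD: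
  assumes "\<phi> \<in> maxspace" "f \<in> A" "g \<in> A"
  shows "\<phi> (\<lambda>x\<in>topspace T. f x + g x) = \<phi> f + \<phi> g"
    "\<phi> (\<lambda>x\<in>topspace T. c * f x) = c * \<phi> f"
    "\<phi> (\<lambda>x\<in>topspace T. f x * g x) = \<phi> f * \<phi> g"
  using assms unfolding max_ideal_space_def linear_functionals_def by blast+

lemma maxspace_extensional: "\<phi> \<in> maxspace \<Longrightarrow> \<phi> \<in> extensional A"
  by (simp add: max_ideal_space_def linear_functionals_def)

lemma app_add:
  assumes "\<phi> \<in> maxspace" "inA F" "inA H"
  shows "app \<phi> (\<lambda>x. F x + H x) = app \<phi> F + app \<phi> H"
proof -
  have "restrict (\<lambda>x. F x + H x) (carrier G) =
      (\<lambda>x\<in>topspace T. restrict F (carrier G) x + restrict H (carrier G) x)"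
    unfolding topspace_T by (rule restrict_ext) simp
  then show ?thesis
    unfolding app_def using maxspaceD(1)[OF assms(1)] assms(2,3) by (simp only: inA_def)
qed

lemma app_cmult:
  assumes "\<phi> \<in> maxspace" "inA F"
  shows "app \<phi> (\<lambda>x. c * F x) = c * app \<phi> F"
proof -
  have "restrict (\<lambda>x. c * F x) (carrier G) = (\<lambda>x\<in>topspace T. c * restrict F (carrier G) x)"
    unfolding topspace_T by (rule restrict_ext) simp
  then show ?thesis
    unfolding app_def using maxspaceD(2)[OF assms(1)] assms(2) by (simp only: inA_def)
qed

lemma app_mult:
  assumes "\<phi> \<in> maxspace" "inA F" "inA H"
  shows "app \<phi> (\<lambda>x. F x * H x) = app \<phi> F * app \<phi> H"
proof -
  have "restrict (\<lambda>x. F x * H x) (carrier G) =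
      (\<lambda>x\<in>topspace T. restrict F (carrier G) x * restrict H (carrier G) x)"
    unfolding topspace_T by (rule restrict_ext) simp
  then show ?thesis
    unfolding app_def using maxspaceD(3)[OF assms(1)] assms(2,3) by (simp only: inA_def)
qed

text \<open>Multiplicativity gives \<open>\<phi> f = \<phi> f * \<phi> 1\<close> for an
  \<open>f\<close> with nonzero value, so the constant 1 is sent to 1.\<close>

lemma app_const:
  assumes \<phi>: "\<phi> \<in> maxspace"
  shows "app \<phi> (\<lambda>x. c) = c"
proof -
  obtain f where f: "f \<in> A" "\<phi> f \<noteq> 0" using \<phi> by (auto simp: max_ideal_space_def)
  have "app \<phi> f = app \<phi> f * app \<phi> (\<lambda>x. 1)"
    using app_mult[OF \<phi> A_D(4)[OF f(1)] inA_const[of 1]] by simp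
  then have "app \<phi> (\<lambda>x. 1) = 1" using f by (simp add: app_A)
  then show ?thesis using app_cmult[OF \<phi> inA_const[of 1], of c] by simp
qed

lemma app_diff:
  assumes "\<phi> \<in> maxspace" "inA F" "inA H"
  shows "app \<phi> (\<lambda>x. F x - H x) = app \<phi> F - app \<phi> H"
  using app_add[OF assms(1,2) inA_cmult[OF assms(3), of "-1"]] app_cmult[OF assms(1,3), of "-1"]
  by simp

lemma app_power:
  assumes "\<phi> \<in> maxspace" "inA F"
  shows "app \<phi> (\<lambda>x. F x ^ n) = app \<phi> F ^ n"
  by (induction n) (simp_all add: app_const assms(1) app_mult[OF assms inA_power[OF assms(2)]])

lemma app_sum:
  assumes "\<phi> \<in> maxspace" "\<And>i. i \<in> I \<Longrightarrow> inA (F i)"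
  shows "app \<phi> (\<lambda>x. \<Sum>i\<in>I. F i x) = (\<Sum>i\<in>I. app \<phi> (F i))"
  using assms(2)
  by (induction I rule: infinite_finite_induct) (simp_all add: app_const assms(1) app_add inA_sum)

text \<open>If \<open>|\<phi>(F)| > sup |F|\<close> then \<open>1 - F/\<phi>(F)\<close> is invertible in \<open>A\<close> by the geometric series, but
  \<open>\<phi>\<close> vanishes on it.\<close>

lemma norm_app_le:
  assumes \<phi>: "\<phi> \<in> maxspace" and F: "inA F" and B: "\<And>x. x \<in> carrier G \<Longrightarrow> norm (F x) \<le> B"
  shows "norm (app \<phi> F) \<le> B"
proof (rule ccontr)
  assume neg: "\<not> ?thesis"
  define l where "l = app \<phi> F"
  have l: "norm l > B" using neg by (simp add: l_def)
  have "B \<ge> 0" using B[OF one_closed] norm_ge_zero order_trans by blast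
  with l have l0: "l \<noteq> 0" "norm l > 0" by auto
  define q where "q x = F x / l" for x
  have q: "inA q" unfolding q_def using inA_cmult[OF F, of "1 / l"] by simp
  define r where "r = B / norm l"
  have r: "0 \<le> r" "r < 1" using \<open>B \<ge> 0\<close> l l0 by (simp_all add: r_def)
  have qr: "norm (q x) \<le> r" if "x \<in> carrier G" for x
    using B[OF that] by (simp add: q_def r_def norm_divide divide_right_mono)
  have q1: "q x \<noteq> 1" if "x \<in> carrier G" for x using qr[OF that] r by auto
  define H where "H x = 1 / (1 - q x)" for x
  have "inA H"
  proof (rule inA_limit)
    fix e :: real assume "e > 0"
    \<comment> \<open>The tail of the geometric series after \<open>n\<close> terms is at most
      \<open>r ^ n / (1 - r)\<close>, uniformly on the group.\<close>
    have "(\<lambda>n. r ^ n / (1 - r)) \<longlonglongrightarrow> 0 / (1 - r)"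
      using r by (intro tendsto_divide LIMSEQ_realpow_zero tendsto_const) auto
    then have "\<forall>\<^sub>F n in sequentially. r ^ n / (1 - r) < e"
      using \<open>e > 0\<close> by (intro order_tendstoD) simp_all
    then obtain n where n: "r ^ n / (1 - r) < e" by (auto simp: eventually_sequentially)
    have "norm (H x - (\<Sum>k<n. q x ^ k)) \<le> e" if x: "x \<in> carrier G" for x
    proof -
      have "H x - (\<Sum>k<n. q x ^ k) = q x ^ n / (1 - q x)"
        unfolding H_def using q1[OF x]
        by (subst geometric_sum) (simp_all add: field_simps divide_simps)
      also have "norm \<dots> \<le> r ^ n / (1 - r)"
      proof -
        have "1 - r \<le> norm (1 - q x)"
          using norm_triangle_ineq2[of 1 "q x"] qr[OF x] by simp
        then show ?thesis
          using r qr[OF x] by (simp add: norm_divide norm_power frac_le power_mono)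
      qed
      finally show ?thesis using n by simp
    qed
    moreover have "inA (\<lambda>x. \<Sum>k<n. q x ^ k)" by (intro inA_sum inA_power q)
    ultimately show "\<exists>H'. inA H' \<and> (\<forall>x\<in>carrier G. norm (H x - H' x) \<le> e)" by blast
  qed
  have d: "inA (\<lambda>x. 1 - q x)" by (intro inA_diff inA_const q)
  have "1 = app \<phi> (\<lambda>x. (1 - q x) * H x)"
    using app_const[OF \<phi>, of 1] q1 by (subst app_cong[of _ "\<lambda>x. 1"]) (auto simp: H_def)
  also have "\<dots> = (1 - app \<phi> q) * app \<phi> H"
    using app_mult[OF \<phi> d \<open>inA H\<close>] app_diff[OF \<phi> inA_const[of 1] q] app_const[OF \<phi>] by simp
  also have "app \<phi> q = 1"
    using app_cmult[OF \<phi> F, of "1 / l"] l0 by (simp add: q_def[abs_def] l_def)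
  finally show False by simp
qed

lemma norm_app_diff_le:
  assumes "\<phi> \<in> maxspace" "inA F" "inA H" "\<And>x. x \<in> carrier G \<Longrightarrow> norm (F x - H x) \<le> B"
  shows "norm (app \<phi> F - app \<phi> H) \<le> B"
  using norm_app_le[OF assms(1) inA_diff[OF assms(2,3)] assms(4)] app_diff[OF assms(1-3)] by simp

lemma maxspace_eqI:
  assumes "\<phi> \<in> maxspace" "\<psi> \<in> maxspace" "\<And>F. inA F \<Longrightarrow> app \<phi> F = app \<psi> F"
  shows "\<phi> = \<psi>"
proof (rule extensionalityI[of _ A])
  fix f assume "f \<in> A"
  then show "\<phi> f = \<psi> f" using assms(3)[of f] by (simp add: app_A A_D)
qed (use assms maxspace_extensional in auto)

text \<open>Evaluations, convolutions and the involution all arise from formulas on unrestricted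
  functions, and this turns such formulas into members of the maximal ideal space. The congruence
  hypothesis says that only values on the carrier matter.\<close>

lemma restrict_in_maxspace:
  assumes cong: "\<And>F H. (\<And>x. x \<in> carrier G \<Longrightarrow> F x = H x) \<Longrightarrow> \<Phi> F = \<Phi> H"
    and add: "\<And>F H. inA F \<Longrightarrow> inA H \<Longrightarrow> \<Phi> (\<lambda>x. F x + H x) = \<Phi> F + \<Phi> H"
    and cmult: "\<And>c F. inA F \<Longrightarrow> \<Phi> (\<lambda>x. c * F x) = c * \<Phi> F"
    and mult: "\<And>F H. inA F \<Longrightarrow> inA H \<Longrightarrow> \<Phi> (\<lambda>x. F x * H x) = \<Phi> F * \<Phi> H"
    and one: "\<Phi> (\<lambda>x. 1) = 1"
  shows "restrict \<Phi> A \<in> maxspace" "\<And>F. inA F \<Longrightarrow> app (restrict \<Phi> A) F = \<Phi> F"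
proof -
  show app: "app (restrict \<Phi> A) F = \<Phi> F" if "inA F" for F
    using that cong[of "restrict F (carrier G)" F] by (simp add: app_def inA_def)
  have eq: "restrict \<Phi> A (\<lambda>x\<in>topspace T. F x) = \<Phi> F" if "inA F" for F
    using app[OF that] by (simp add: app_def topspace_T)
  have eqA: "restrict \<Phi> A f = \<Phi> f" if "f \<in> A" for f using that by simp
  have "restrict \<Phi> A (\<lambda>x\<in>topspace T. f x + g x) = restrict \<Phi> A f + restrict \<Phi> A g"
    if "f \<in> A" "g \<in> A" for f g
    using that by (simp only: eq eqA add inA_add A_D(4))
  moreover have "restrict \<Phi> A (\<lambda>x\<in>topspace T. f x * g x) = restrict \<Phi> A f * restrict \<Phi> A g"
    if "f \<in> A" "g \<in> A" for f g
    using that by (simp only: eq eqA mult inA_mult A_D(4))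
  moreover have "restrict \<Phi> A (\<lambda>x\<in>topspace T. c * f x) = c * restrict \<Phi> A f" if "f \<in> A" for c f
    using that by (simp only: eq eqA cmult inA_cmult A_D(4))
  moreover have "\<exists>f\<in>A. restrict \<Phi> A f \<noteq> 0"
  proof
    show "(\<lambda>x\<in>topspace T. 1) \<in> A" using inA_const[of 1] by (simp add: inA_def topspace_T)
    show "restrict \<Phi> A (\<lambda>x\<in>topspace T. 1) \<noteq> 0" by (simp only: eq inA_const one) simp
  qed
  ultimately show "restrict \<Phi> A \<in> maxspace"
    unfolding max_ideal_space_def linear_functionals_def by blast
qed

lemma ev_in_maxspace:
  assumes "g \<in> carrier G"
  shows "ev A g \<in> maxspace" "inA F \<Longrightarrow> app (ev A g) F = F g"
  using restrict_in_maxspace[of "\<lambda>f. f g"] assms unfolding ev_def by auto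

section \<open>Iterated application of functionals to limits of tensors\<close>

lemma tens_slice_right:
  assumes F: "tens F" and x: "x \<in> carrier G"
  shows "inA (F x)"
proof (rule inA_limit)
  fix e :: real assume "e > 0"
  then obtain n :: nat and a b where n: "\<And>i. i < n \<Longrightarrow> inA (a i)" "\<And>i. i < n \<Longrightarrow> inA (b i)"
    "\<And>x y. x \<in> carrier G \<Longrightarrow> y \<in> carrier G \<Longrightarrow> norm (F x y - (\<Sum>i<n. a i x * b i y)) \<le> e"
    by (rule tensE[OF F]) (rule that)
  then show "\<exists>H. inA H \<and> (\<forall>y\<in>carrier G. norm (F x y - H y) \<le> e)"
    using x by (intro exI[of _ "\<lambda>y. \<Sum>i<n. a i x * b i y"] conjI inA_sum inA_cmult) auto
qed

text \<open>\<open>\<psi>\<close> is contractive and acts on the \<open>b i\<close> only, so the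
  error stays \<open>e\<close> while combinations of the \<open>a i\<close> remain.\<close>

lemma norm_app_slice_le:
  assumes F: "tens F" and \<psi>: "\<psi> \<in> maxspace" and x: "x \<in> carrier G"
    and b: "\<And>i. i < (n::nat) \<Longrightarrow> inA (b i)"
    and near: "\<And>x y. x \<in> carrier G \<Longrightarrow> y \<in> carrier G \<Longrightarrow> norm (F x y - (\<Sum>i<n. a i x * b i y)) \<le> e"
  shows "norm (app \<psi> (F x) - (\<Sum>i<n. app \<psi> (b i) * a i x)) \<le> e"
proof -
  have "app \<psi> (\<lambda>y. \<Sum>i<n. a i x * b i y) = (\<Sum>i<n. app \<psi> (b i) * a i x)"
    using b by (subst app_sum[OF \<psi>]) (auto intro!: inA_cmult sum.cong simp: app_cmult[OF \<psi>])
  moreover have "inA (\<lambda>y. \<Sum>i<n. a i x * b i y)" using b by (intro inA_sum inA_cmult) auto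
  ultimately show ?thesis
    using norm_app_diff_le[OF \<psi> tens_slice_right[OF F x] _ near[OF x]] by metis
qed

lemma inA_app_slice:
  assumes F: "tens F" and \<psi>: "\<psi> \<in> maxspace"
  shows "inA (\<lambda>x. app \<psi> (F x))"
proof (rule inA_limit)
  fix e :: real assume "e > 0"
  then obtain n :: nat and a b where n: "\<And>i. i < n \<Longrightarrow> inA (a i)" "\<And>i. i < n \<Longrightarrow> inA (b i)"
    "\<And>x y. x \<in> carrier G \<Longrightarrow> y \<in> carrier G \<Longrightarrow> norm (F x y - (\<Sum>i<n. a i x * b i y)) \<le> e"
    by (rule tensE[OF F]) (rule that)
  have "inA (\<lambda>x. \<Sum>i<n. app \<psi> (b i) * a i x)" using n(1) by (intro inA_sum inA_cmult) auto
  then show "\<exists>H. inA H \<and> (\<forall>x\<in>carrier G. norm (app \<psi> (F x) - H x) \<le> e)"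
    using norm_app_slice_le[of F \<psi> _ n b a e] F \<psi> n(2,3)
    by (intro exI[of _ "\<lambda>x. \<Sum>i<n. app \<psi> (b i) * a i x"]) simp
qed

text \<open>Neither the error nor the functions \<open>a i\<close> and \<open>b i\<close> depend on
  the functionals. This uniformity gives both the exchange of order and the joint continuity of
  convolution.\<close>

lemma norm_app_app_le:
  assumes F: "tens F" and \<phi>: "\<phi> \<in> maxspace" and \<psi>: "\<psi> \<in> maxspace"
    and a: "\<And>i. i < (n::nat) \<Longrightarrow> inA (a i)" and b: "\<And>i. i < n \<Longrightarrow> inA (b i)"
    and near: "\<And>x y. x \<in> carrier G \<Longrightarrow> y \<in> carrier G \<Longrightarrow> norm (F x y - (\<Sum>i<n. a i x * b i y)) \<le> e"
  shows "norm (app \<phi> (\<lambda>x. app \<psi> (F x)) - (\<Sum>i<n. app \<phi> (a i) * app \<psi> (b i))) \<le> e"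
proof -
  have "app \<phi> (\<lambda>x. \<Sum>i<n. app \<psi> (b i) * a i x) = (\<Sum>i<n. app \<phi> (a i) * app \<psi> (b i))"
    using a by (subst app_sum[OF \<phi>]) (auto intro!: inA_cmult sum.cong simp: app_cmult[OF \<phi>])
  moreover have "inA (\<lambda>x. \<Sum>i<n. app \<psi> (b i) * a i x)" using a by (intro inA_sum inA_cmult) auto
  moreover have "norm (app \<psi> (F x) - (\<Sum>i<n. app \<psi> (b i) * a i x)) \<le> e" if "x \<in> carrier G" for x
    using norm_app_slice_le[of F \<psi> x n b a e] F \<psi> that b near by blast
  ultimately show ?thesis
    using norm_app_diff_le[OF \<phi> inA_app_slice[OF F \<psi>], of "\<lambda>x. \<Sum>i<n. app \<psi> (b i) * a i x" e]
    by simp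
qed

text \<open>A Fubini theorem for functionals: both iterated values lie within \<open>e / 2\<close>
  of the same sum of products.\<close>

lemma app_app_commute:
  assumes F: "tens F" and \<phi>: "\<phi> \<in> maxspace" and \<psi>: "\<psi> \<in> maxspace"
  shows "app \<phi> (\<lambda>x. app \<psi> (\<lambda>y. F x y)) = app \<psi> (\<lambda>y. app \<phi> (\<lambda>x. F x y))" (is "?L = ?R")
proof -
  have "norm (?L - ?R) \<le> e" if e: "e > 0" for e
  proof -
    have e2: "e / 2 > 0" using e by simp
    obtain n :: nat and a b where n: "\<And>i. i < n \<Longrightarrow> inA (a i)" "\<And>i. i < n \<Longrightarrow> inA (b i)"
      "\<And>x y. x \<in> carrier G \<Longrightarrow> y \<in> carrier G \<Longrightarrow> norm (F x y - (\<Sum>i<n. a i x * b i y)) \<le> e / 2"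
      by (rule tensE[OF F e2]) (rule that)
    have n': "norm (F y x - (\<Sum>i<n. b i x * a i y)) \<le> e / 2"
      if "x \<in> carrier G" "y \<in> carrier G" for x y
      using n(3)[OF that(2,1)] by (simp add: mult.commute)
    have "norm (?R - (\<Sum>i<n. app \<psi> (b i) * app \<phi> (a i))) \<le> e / 2"
      by (rule norm_app_app_le[OF tens_swap[OF F] \<psi> \<phi> n(2,1) n'])
    moreover have "norm (?L - (\<Sum>i<n. app \<psi> (b i) * app \<phi> (a i))) \<le> e / 2"
      using norm_app_app_le[OF F \<phi> \<psi> n] by (simp add: mult.commute)
    ultimately show ?thesis
      using norm_diff_triangle_le[of ?L "\<Sum>i<n. app \<psi> (b i) * app \<phi> (a i)" "e / 2" ?R "e / 2"]
      by (simp add: norm_minus_commute)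
  qed
  then have "norm (?L - ?R) \<le> 0" by (rule dense_ge)
  then show ?thesis by simp
qed

subsection \<open>The tensor product of functionals\<close>

lemma alg_tensor_subset: "alg_tensor T A \<subseteq> mspace (C_space (prod_topology T T))"
proof
  fix F assume "F \<in> alg_tensor T A"
  then obtain n :: nat and a b where F: "\<forall>i<n. a i \<in> A \<and> b i \<in> A"
    "F = (\<lambda>p\<in>topspace T \<times> topspace T. \<Sum>i<n. tensor_fun T (a i) (b i) p)"
    unfolding alg_tensor_def by blast
  have "continuous_map (prod_topology T T) euclidean (\<lambda>p. \<Sum>i<n. a i (fst p) * b i (snd p))"
  proof (intro continuous_map_sum finite_lessThan)
    fix i assume "i \<in> {..<n}"
    then have ab: "cont (a i)" "cont (b i)" using F(1) A_D(2) by auto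
    show "continuous_map (prod_topology T T) euclidean (\<lambda>p. a i (fst p) * b i (snd p))"
      by (intro continuous_map_binop[where h = "\<lambda>u v. u * v"] cont_of[OF ab(1)] cont_of[OF ab(2)]
          continuous_map_fst continuous_map_snd)
        (auto simp: case_prod_unfold intro!: continuous_intros)
  qed
  then have "continuous_map (prod_topology T T) euclidean F"
    by (rule continuous_map_eq) (auto simp: F(2) tensor_fun_def)
  moreover have "F \<in> extensional (topspace (prod_topology T T))" by (simp add: F(2))
  moreover have "compact_space (prod_topology T T)"
    using compact_T by (simp add: compact_space_prod_topology)
  ultimately show "F \<in> mspace (C_space (prod_topology T T))"
    by (subst mspace_C_space) auto
qed

lemma closed_tensor_iff:
  "F \<in> closed_tensor T A \<longleftrightarrow>
    F \<in> mspace (C_space (prod_topology T T)) \<and> tens (\<lambda>x y. F (x, y))"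
proof -
  have "(\<exists>h\<in>alg_tensor T A. \<forall>p\<in>topspace (prod_topology T T). norm (F p - h p) \<le> e) \<longleftrightarrow>
    (\<exists>(n::nat) a b. (\<forall>i<n. inA (a i) \<and> inA (b i)) \<and>
     (\<forall>x\<in>carrier G. \<forall>y\<in>carrier G. norm (F (x, y) - (\<Sum>i<n. a i x * b i y)) \<le> e))" (is "?L \<longleftrightarrow> ?R") for e
  proof
    assume ?L
    then obtain h where h: "h \<in> alg_tensor T A"
      "\<forall>p\<in>topspace (prod_topology T T). norm (F p - h p) \<le> e" by blast
    then obtain n :: nat and a b where n: "\<forall>i<n. a i \<in> A \<and> b i \<in> A"
      "h = (\<lambda>p\<in>topspace T \<times> topspace T. \<Sum>i<n. tensor_fun T (a i) (b i) p)"
      unfolding alg_tensor_def by blast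
    have "\<forall>x\<in>carrier G. \<forall>y\<in>carrier G. norm (F (x, y) - (\<Sum>i<n. a i x * b i y)) \<le> e"
    proof (intro ballI)
      fix x y assume "x \<in> carrier G" "y \<in> carrier G"
      then show "norm (F (x, y) - (\<Sum>i<n. a i x * b i y)) \<le> e"
        using h(2)[rule_format, of "(x, y)"] by (simp add: n(2) topspace_T tensor_fun_def)
    qed
    then show ?R using n(1) A_D(4) by (intro exI[of _ n] exI[of _ a] exI[of _ b]) simp
  next
    assume ?R
    then obtain n :: nat and a b where n: "\<forall>i<n. inA (a i) \<and> inA (b i)"
      "\<forall>x\<in>carrier G. \<forall>y\<in>carrier G. norm (F (x, y) - (\<Sum>i<n. a i x * b i y)) \<le> e"
      by (elim exE conjE)
    let ?a = "\<lambda>i. restrict (a i) (carrier G)" and ?b = "\<lambda>i. restrict (b i) (carrier G)"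
    let ?h = "\<lambda>p\<in>topspace T \<times> topspace T. \<Sum>i<n. tensor_fun T (?a i) (?b i) p"
    have "?h \<in> alg_tensor T A"
      unfolding alg_tensor_def
      by (rule CollectI, rule exI[of _ n], rule exI[of _ ?a], rule exI[of _ ?b])
        (use n(1) in \<open>simp add: inA_def\<close>)
    moreover have "\<forall>p\<in>topspace (prod_topology T T). norm (F p - ?h p) \<le> e"
      using n(2) by (auto simp: topspace_T tensor_fun_def)
    ultimately show ?L by blast
  qed
  then show ?thesis
    unfolding closed_tensor_def tens_def
    using C_space_closure_of[OF alg_tensor_subset, of F] carrier_ne by (simp del: mspace_cfunspace)
qed

lemma tens_add:
  assumes "tens F" "tens H"
  shows "tens (\<lambda>x y. F x y + H x y)"
  unfolding tens_def
proof (intro allI impI)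
  fix e :: real assume "e > 0"
  then have e2: "e / 2 > 0" by simp
  obtain n :: nat and a b where n: "\<And>i. i < n \<Longrightarrow> inA (a i)" "\<And>i. i < n \<Longrightarrow> inA (b i)"
    "\<And>x y. x \<in> carrier G \<Longrightarrow> y \<in> carrier G \<Longrightarrow> norm (F x y - (\<Sum>i<n. a i x * b i y)) \<le> e / 2"
    by (rule tensE[OF assms(1) e2]) (rule that)
  obtain m :: nat and c d where m: "\<And>i. i < m \<Longrightarrow> inA (c i)" "\<And>i. i < m \<Longrightarrow> inA (d i)"
    "\<And>x y. x \<in> carrier G \<Longrightarrow> y \<in> carrier G \<Longrightarrow> norm (H x y - (\<Sum>i<m. c i x * d i y)) \<le> e / 2"
    by (rule tensE[OF assms(2) e2]) (rule that)
  define p where "p i = (if i < n then a i else c (i - n))" for i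
  define q where "q i = (if i < n then b i else d (i - n))" for i
  have sum: "(\<Sum>i<n + m. p i x * q i y) = (\<Sum>i<n. a i x * b i y) + (\<Sum>i<m. c i x * d i y)" for x y
    by (simp add: sum_lessThan_add p_def q_def)
  have "norm (F x y + H x y - (\<Sum>i<n + m. p i x * q i y)) \<le> e"
    if "x \<in> carrier G" "y \<in> carrier G" for x y
    using norm_triangle_le[OF add_mono[OF n(3)[OF that] m(3)[OF that]]]
    unfolding sum by (simp add: algebra_simps)
  moreover have "inA (p i) \<and> inA (q i)" if "i < n + m" for i
    using that n m by (simp add: p_def q_def)
  ultimately show "\<exists>(n::nat) a b. (\<forall>i<n. inA (a i) \<and> inA (b i)) \<and>
     (\<forall>x\<in>carrier G. \<forall>y\<in>carrier G. norm (F x y + H x y - (\<Sum>i<n. a i x * b i y)) \<le> e)"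
    by (intro exI[of _ "n + m"] exI[of _ p] exI[of _ q]) simp
qed

lemma tens_mult_left:
  assumes F: "tens F" and c: "inA c"
  shows "tens (\<lambda>x y. c x * F x y)"
  unfolding tens_def
proof (intro allI impI)
  fix e :: real assume e: "e > 0"
  obtain B where B: "B > 0" "\<And>x. x \<in> carrier G \<Longrightarrow> norm (c x) \<le> B"
    using compact_bounded_norm[OF compact_T inA_cont[OF c]] by (auto simp: topspace_T)
  have eB: "e / B > 0" using e B(1) by simp
  obtain n :: nat and a b where n: "\<And>i. i < n \<Longrightarrow> inA (a i)" "\<And>i. i < n \<Longrightarrow> inA (b i)"
    "\<And>x y. x \<in> carrier G \<Longrightarrow> y \<in> carrier G \<Longrightarrow> norm (F x y - (\<Sum>i<n. a i x * b i y)) \<le> e / B"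
    by (rule tensE[OF F eB]) (rule that)
  have "norm (c x * F x y - (\<Sum>i<n. (c x * a i x) * b i y)) \<le> e"
    if "x \<in> carrier G" "y \<in> carrier G" for x y
  proof -
    have "c x * F x y - (\<Sum>i<n. (c x * a i x) * b i y) = c x * (F x y - (\<Sum>i<n. a i x * b i y))"
      by (simp add: sum_distrib_left right_diff_distrib mult.assoc)
    also have "norm \<dots> \<le> B * (e / B)"
      unfolding norm_mult using B n(3) that by (intro mult_mono) auto
    finally show ?thesis using B(1) by simp
  qed
  moreover have "inA (\<lambda>x. c x * a i x) \<and> inA (b i)" if "i < n" for i
    using that n inA_mult[OF c] by simp
  ultimately show "\<exists>(n::nat) a b. (\<forall>i<n. inA (a i) \<and> inA (b i)) \<and>
     (\<forall>x\<in>carrier G. \<forall>y\<in>carrier G. norm (c x * F x y - (\<Sum>i<n. a i x * b i y)) \<le> e)"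
    by (intro exI[of _ n] exI[of _ "\<lambda>i x. c x * a i x"] exI[of _ b]) simp
qed

text \<open>An explicit candidate for the functional that \<open>tensor_functional\<close> describes
  by uniqueness.\<close>

definition tensor_ext ::
    "(('a \<Rightarrow> complex) \<Rightarrow> complex) \<Rightarrow> (('a \<Rightarrow> complex) \<Rightarrow> complex) \<Rightarrow> ('a \<times> 'a \<Rightarrow> complex) \<Rightarrow> complex" where
  "tensor_ext \<phi> \<psi> = (\<lambda>F\<in>closed_tensor T A. app \<phi> (\<lambda>x. app \<psi> (\<lambda>y. F (x, y))))"

lemma compact_prod: "compact_space (prod_topology T T)"
  using compact_T by (simp add: compact_space_prod_topology)

lemma topspace_prod_ne: "topspace (prod_topology T T) \<noteq> {}"
  using carrier_ne by simp

lemma in_C_prod_iff: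
  "F \<in> mspace (C_space (prod_topology T T)) \<longleftrightarrow>
    F \<in> extensional (carrier G \<times> carrier G) \<and> continuous_map (prod_topology T T) euclidean F"
  by (subst mspace_C_space[OF compact_prod]) (simp add: topspace_T)

lemma closed_tensor_D:
  assumes "F \<in> closed_tensor T A"
  shows "tens (\<lambda>x y. F (x, y))" "continuous_map (prod_topology T T) euclidean F"
    "F \<in> mspace (C_space (prod_topology T T))"
  using assms in_C_prod_iff by (auto simp: closed_tensor_iff simp del: mspace_cfunspace)

lemma tens_cong:
  assumes "\<And>x y. x \<in> carrier G \<Longrightarrow> y \<in> carrier G \<Longrightarrow> F x y = H x y"
  shows "tens F \<longleftrightarrow> tens H"
  using assms unfolding tens_def by (simp cong: ball_cong)

lemma restrict_in_closed_tensor: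
  assumes "continuous_map (prod_topology T T) euclidean F" "tens (\<lambda>x y. F (x, y))"
  shows "restrict F (carrier G \<times> carrier G) \<in> closed_tensor T A"
proof -
  have "continuous_map (prod_topology T T) euclidean (restrict F (carrier G \<times> carrier G))"
    using assms(1) by (rule continuous_map_eq) (simp add: topspace_T)
  moreover have "tens (\<lambda>x y. restrict F (carrier G \<times> carrier G) (x, y))"
    using assms(2) by (subst tens_cong[of _ "\<lambda>x y. F (x, y)"]) auto
  ultimately show ?thesis by (simp add: closed_tensor_iff in_C_prod_iff del: mspace_cfunspace)
qed

lemma tensor_fun_in_alg_tensor:
  assumes "a \<in> A" "b \<in> A"
  shows "tensor_fun T a b \<in> alg_tensor T A"
proof -
  have "tensor_fun T a b = (\<lambda>p\<in>topspace T \<times> topspace T. \<Sum>i<(1::nat). tensor_fun T a b p)"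
    by (auto simp: tensor_fun_def fun_eq_iff)
  then show ?thesis
    unfolding alg_tensor_def using assms
    by (intro CollectI exI[of _ "1::nat"] exI[of _ "\<lambda>_. a"] exI[of _ "\<lambda>_. b"]) simp
qed

lemma alg_tensor_subset_closed: "alg_tensor T A \<subseteq> closed_tensor T A"
  unfolding closed_tensor_def using alg_tensor_subset
  by (intro closure_of_subset) (simp del: mspace_cfunspace)

lemma app_tensor_ext:
  "F \<in> closed_tensor T A \<Longrightarrow> tensor_ext \<phi> \<psi> F = app \<phi> (\<lambda>x. app \<psi> (\<lambda>y. F (x, y)))"
  by (simp add: tensor_ext_def)

lemma tensor_ext_restrict:
  assumes "restrict F (carrier G \<times> carrier G) \<in> closed_tensor T A"
  shows "tensor_ext \<phi> \<psi> (restrict F (carrier G \<times> carrier G)) = app \<phi> (\<lambda>x. app \<psi> (\<lambda>y. F (x, y)))"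
  unfolding app_tensor_ext[OF assms] by (intro app_cong) simp

text \<open>Slices and their images under \<open>\<psi>\<close> stay in \<open>A\<close>, so
  linearity passes through both functionals; two contractions give the Lipschitz constant 1.\<close>

lemma tensor_ext_in_dual:
  assumes \<phi>: "\<phi> \<in> maxspace" and \<psi>: "\<psi> \<in> maxspace"
  shows "tensor_ext \<phi> \<psi> \<in> dual_space (prod_topology T T) (closed_tensor T A)"
proof -
  have top: "topspace (prod_topology T T) = carrier G \<times> carrier G" by (simp add: topspace_T)
  have sl: "inA (\<lambda>y. F (x, y))" if "F \<in> closed_tensor T A" "x \<in> carrier G" for F x
    using tens_slice_right[OF closed_tensor_D(1)[OF that(1)] that(2)] .
  have sl': "inA (\<lambda>x. app \<psi> (\<lambda>y. F (x, y)))" if "F \<in> closed_tensor T A" for F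
    using inA_app_slice[OF closed_tensor_D(1)[OF that] \<psi>] .
  have add: "tensor_ext \<phi> \<psi> (\<lambda>p\<in>topspace (prod_topology T T). F p + H p) =
      tensor_ext \<phi> \<psi> F + tensor_ext \<phi> \<psi> H"
    if F: "F \<in> closed_tensor T A" and H: "H \<in> closed_tensor T A" for F H
  proof -
    have "restrict (\<lambda>p. F p + H p) (carrier G \<times> carrier G) \<in> closed_tensor T A"
      using closed_tensor_D[OF F] closed_tensor_D[OF H]
      by (intro restrict_in_closed_tensor continuous_map_add tens_add)
    then have "tensor_ext \<phi> \<psi> (\<lambda>p\<in>topspace (prod_topology T T). F p + H p) =
        app \<phi> (\<lambda>x. app \<psi> (\<lambda>y. F (x, y) + H (x, y)))"
      unfolding top by (rule tensor_ext_restrict)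
    also have "\<dots> = app \<phi> (\<lambda>x. app \<psi> (\<lambda>y. F (x, y)) + app \<psi> (\<lambda>y. H (x, y)))"
      using sl[OF F] sl[OF H] by (intro app_cong app_add \<psi>)
    also have "\<dots> = tensor_ext \<phi> \<psi> F + tensor_ext \<phi> \<psi> H"
      unfolding app_tensor_ext[OF F] app_tensor_ext[OF H] by (intro app_add \<phi> sl' F H)
    finally show ?thesis .
  qed
  have cmult: "tensor_ext \<phi> \<psi> (\<lambda>p\<in>topspace (prod_topology T T). c * F p) = c * tensor_ext \<phi> \<psi> F"
    if F: "F \<in> closed_tensor T A" for c F
  proof -
    have "restrict (\<lambda>p. c * F p) (carrier G \<times> carrier G) \<in> closed_tensor T A"
    proof (rule restrict_in_closed_tensor)
      show "continuous_map (prod_topology T T) euclidean (\<lambda>p. c * F p)"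
        by (rule continuous_map_unop[OF closed_tensor_D(2)[OF F]]) (intro continuous_intros)
      show "tens (\<lambda>x y. c * F (x, y))"
        using tens_mult_left[OF closed_tensor_D(1)[OF F] inA_const[of c]] .
    qed
    then have "tensor_ext \<phi> \<psi> (\<lambda>p\<in>topspace (prod_topology T T). c * F p) =
        app \<phi> (\<lambda>x. app \<psi> (\<lambda>y. c * F (x, y)))"
      unfolding top by (rule tensor_ext_restrict)
    also have "\<dots> = app \<phi> (\<lambda>x. c * app \<psi> (\<lambda>y. F (x, y)))"
      using sl[OF F] by (intro app_cong app_cmult \<psi>)
    also have "\<dots> = c * tensor_ext \<phi> \<psi> F"
      unfolding app_tensor_ext[OF F] by (intro app_cmult \<phi> sl' F)
    finally show ?thesis .
  qed
  have "continuous_map (subtopology (mtopology_of (C_space (prod_topology T T))) (closed_tensor T A))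
      euclidean (tensor_ext \<phi> \<psi>)"
  proof -
    let ?S = "submetric (C_space (prod_topology T T)) (closed_tensor T A)"
    have "Lipschitz_continuous_map ?S euclidean_metric (tensor_ext \<phi> \<psi>)"
      unfolding Lipschitz_continuous_map_def
    proof (intro conjI exI[of _ 1] ballI)
      fix F H assume "F \<in> mspace ?S" "H \<in> mspace ?S"
      then have F: "F \<in> closed_tensor T A" and H: "H \<in> closed_tensor T A"
        by (auto simp del: mspace_cfunspace)
      let ?d = "mdist (C_space (prod_topology T T)) F H"
      have "\<forall>p\<in>topspace (prod_topology T T). norm (F p - H p) \<le> ?d"
        using mdist_C_space_le[OF closed_tensor_D(3)[OF F] closed_tensor_D(3)[OF H] topspace_prod_ne, of ?d]
        by blast
      then have "norm (F (x, y) - H (x, y)) \<le> ?d" if "x \<in> carrier G" "y \<in> carrier G" for x y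
        using that by (simp add: topspace_T)
      then have "norm (tensor_ext \<phi> \<psi> F - tensor_ext \<phi> \<psi> H) \<le> ?d"
        unfolding app_tensor_ext[OF F] app_tensor_ext[OF H]
        by (intro norm_app_diff_le \<phi> \<psi> sl' sl F H)
      then show "mdist euclidean_metric (tensor_ext \<phi> \<psi> F) (tensor_ext \<phi> \<psi> H) \<le> 1 * mdist ?S F H"
        by (simp add: dist_norm)
    qed simp
    then show ?thesis
      using Lipschitz_continuous_imp_continuous_map by (force simp: mtopology_of_submetric)
  qed
  with add cmult show ?thesis
    unfolding dual_space_def linear_functionals_def by (simp add: tensor_ext_def)
qed

lemma tensor_ext_tensor_fun:
  assumes \<phi>: "\<phi> \<in> maxspace" and \<psi>: "\<psi> \<in> maxspace" and a: "a \<in> A" and b: "b \<in> A"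
  shows "tensor_ext \<phi> \<psi> (tensor_fun T a b) = \<phi> a * \<psi> b"
proof -
  have "tensor_fun T a b \<in> closed_tensor T A"
    using tensor_fun_in_alg_tensor[OF a b] alg_tensor_subset_closed by blast
  then have "tensor_ext \<phi> \<psi> (tensor_fun T a b) = app \<phi> (\<lambda>x. app \<psi> (\<lambda>y. tensor_fun T a b (x, y)))"
    by (rule app_tensor_ext)
  also have "\<dots> = app \<phi> (\<lambda>x. app \<psi> (\<lambda>y. a x * b y))"
    by (intro app_cong) (simp add: tensor_fun_def topspace_T)
  also have "\<dots> = app \<phi> (\<lambda>x. app \<psi> b * a x)"
    using app_cmult[OF \<psi> A_D(4)[OF b]] by (simp add: mult.commute)
  also have "\<dots> = \<phi> a * \<psi> b"
    using app_cmult[OF \<phi> A_D(4)[OF a]] a b by (simp add: app_A)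
  finally show ?thesis .
qed

text \<open>Agreement on elementary tensors extends to finite sums by linearity and to the closure
  by continuity into a Hausdorff space.\<close>

lemma dual_space_closed_tensor_eqI:
  assumes \<Phi>: "\<Phi> \<in> dual_space (prod_topology T T) (closed_tensor T A)"
    and \<Psi>: "\<Psi> \<in> dual_space (prod_topology T T) (closed_tensor T A)"
    and eq: "\<And>a b. a \<in> A \<Longrightarrow> b \<in> A \<Longrightarrow> \<Phi> (tensor_fun T a b) = \<Psi> (tensor_fun T a b)"
  shows "\<Phi> = \<Psi>"
proof (rule extensionalityI[of _ "closed_tensor T A"])
  show "\<Phi> \<in> extensional (closed_tensor T A)" "\<Psi> \<in> extensional (closed_tensor T A)"
    using \<Phi> \<Psi> by (auto simp: dual_space_def linear_functionals_def)
  let ?X = "subtopology (mtopology_of (C_space (prod_topology T T))) (closed_tensor T A)"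
  have lin: "\<And>F H. F \<in> closed_tensor T A \<Longrightarrow> H \<in> closed_tensor T A \<Longrightarrow>
      \<Theta> (\<lambda>p\<in>topspace T \<times> topspace T. F p + H p) = \<Theta> F + \<Theta> H"
    "\<And>c F. F \<in> closed_tensor T A \<Longrightarrow> \<Theta> (\<lambda>p\<in>topspace T \<times> topspace T. c * F p) = c * \<Theta> F"
    if "\<Theta> \<in> {\<Phi>, \<Psi>}" for \<Theta>
    using that \<Phi> \<Psi> by (auto simp: dual_space_def linear_functionals_def)
  have alg: "\<Phi> (\<lambda>p\<in>topspace T \<times> topspace T. \<Sum>i<n. tensor_fun T (a i) (b i) p) =
      \<Psi> (\<lambda>p\<in>topspace T \<times> topspace T. \<Sum>i<n. tensor_fun T (a i) (b i) p)"
    if "\<forall>i<n. a i \<in> A \<and> b i \<in> A" for n :: nat and a b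
    using that
  proof (induction n)
    case 0
    have one: "restrict (\<lambda>x. 1) (carrier G) \<in> A" using inA_const[of 1] by (simp add: inA_def)
    then have m: "tensor_fun T (restrict (\<lambda>x. 1) (carrier G)) (restrict (\<lambda>x. 1) (carrier G)) \<in> closed_tensor T A"
      (is "?t \<in> _") using tensor_fun_in_alg_tensor alg_tensor_subset_closed by blast
    \<comment> \<open>The empty sum is reached through homogeneity, as 0 times a member of the
      closed tensor product.\<close>
    have zero: "\<Theta> (\<lambda>p\<in>topspace T \<times> topspace T. 0) = 0" if "\<Theta> \<in> {\<Phi>, \<Psi>}" for \<Theta>
      using lin(2)[OF that m, of 0] by simp
    have "\<Phi> (\<lambda>p\<in>topspace T \<times> topspace T. 0) = \<Psi> (\<lambda>p\<in>topspace T \<times> topspace T. 0)"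
      using zero[of \<Phi>] zero[of \<Psi>] by (metis insertI1 insertI2)
    then show ?case unfolding lessThan_0 sum.empty .
  next
    case (Suc n)
    let ?F = "\<lambda>p\<in>topspace T \<times> topspace T. \<Sum>i<n. tensor_fun T (a i) (b i) p"
    have "?F \<in> alg_tensor T A"
      unfolding alg_tensor_def
      by (rule CollectI, rule exI[of _ n], rule exI[of _ a], rule exI[of _ b]) (use Suc.prems in simp)
    then have F: "?F \<in> closed_tensor T A" using alg_tensor_subset_closed by blast
    have t: "tensor_fun T (a n) (b n) \<in> closed_tensor T A"
      using tensor_fun_in_alg_tensor alg_tensor_subset_closed Suc.prems by blast
    have split: "(\<lambda>p\<in>topspace T \<times> topspace T. \<Sum>i<Suc n. tensor_fun T (a i) (b i) p) =
        (\<lambda>p\<in>topspace T \<times> topspace T. ?F p + tensor_fun T (a n) (b n) p)"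
      by (rule restrict_ext) simp
    have "\<Phi> ?F = \<Psi> ?F" by (rule Suc.IH) (use Suc.prems in simp)
    moreover have "\<Phi> (tensor_fun T (a n) (b n)) = \<Psi> (tensor_fun T (a n) (b n))"
      using eq Suc.prems by simp
    moreover have "\<Phi> (\<lambda>p\<in>topspace T \<times> topspace T. ?F p + tensor_fun T (a n) (b n) p) =
        \<Phi> ?F + \<Phi> (tensor_fun T (a n) (b n))"
      by (rule lin(1)[OF _ F t]) simp
    moreover have "\<Psi> (\<lambda>p\<in>topspace T \<times> topspace T. ?F p + tensor_fun T (a n) (b n) p) =
        \<Psi> ?F + \<Psi> (tensor_fun T (a n) (b n))"
      by (rule lin(1)[OF _ F t]) simp
    ultimately show ?case unfolding split by (simp only:)
  qed
  fix F assume F: "F \<in> closed_tensor T A"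
  show "\<Phi> F = \<Psi> F"
  proof (rule forall_in_closure_of_eq[where f = \<Phi> and g = \<Psi> and x = F])
    have "closed_tensor T A \<inter> alg_tensor T A = alg_tensor T A" using alg_tensor_subset_closed by blast
    then show "F \<in> ?X closure_of alg_tensor T A"
      using F by (simp add: closure_of_subtopology closed_tensor_def)
    show "Hausdorff_space (euclidean :: complex topology)" by simp
    show "continuous_map ?X euclidean \<Phi>" "continuous_map ?X euclidean \<Psi>"
      using \<Phi> \<Psi> by (auto simp: dual_space_def)
    fix H assume "H \<in> alg_tensor T A"
    then obtain n :: nat and a b where "\<forall>i<n. a i \<in> A \<and> b i \<in> A"
      "H = (\<lambda>p\<in>topspace T \<times> topspace T. \<Sum>i<n. tensor_fun T (a i) (b i) p)"
      unfolding alg_tensor_def by blast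
    with alg show "\<Phi> H = \<Psi> H" by simp
  qed
qed

lemma tensor_functional_eq:
  assumes "\<phi> \<in> maxspace" "\<psi> \<in> maxspace"
  shows "tensor_functional T A \<phi> \<psi> = tensor_ext \<phi> \<psi>"
  unfolding tensor_functional_def
proof (rule the_equality)
  show "tensor_ext \<phi> \<psi> \<in> dual_space (prod_topology T T) (closed_tensor T A) \<and>
      (\<forall>a\<in>A. \<forall>b\<in>A. tensor_ext \<phi> \<psi> (tensor_fun T a b) = \<phi> a * \<psi> b)"
    using tensor_ext_in_dual[OF assms] tensor_ext_tensor_fun[OF assms] by simp
next
  fix \<Phi> assume "\<Phi> \<in> dual_space (prod_topology T T) (closed_tensor T A) \<and>
      (\<forall>a\<in>A. \<forall>b\<in>A. \<Phi> (tensor_fun T a b) = \<phi> a * \<psi> b)"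
  then show "\<Phi> = tensor_ext \<phi> \<psi>"
    using tensor_ext_in_dual[OF assms] tensor_ext_tensor_fun[OF assms]
    by (intro dual_space_closed_tensor_eqI) simp_all
qed

subsection \<open>Convolution\<close>

text \<open>The iterated-integral form of the product, with functionals in place of
  measures.\<close>

definition conv where
  "conv \<phi> \<psi> F = app \<phi> (\<lambda>x. app \<psi> (\<lambda>y. F (x \<otimes> y)))"

lemma convolution_eq:
  assumes \<phi>: "\<phi> \<in> maxspace" and \<psi>: "\<psi> \<in> maxspace"
  shows "convolution G T A \<phi> \<psi> = restrict (conv \<phi> \<psi>) A"
  unfolding convolution_def
proof (rule restrict_ext)
  fix f assume f: "f \<in> A"
  have "continuous_map (prod_topology T T) euclidean (\<lambda>p. f (fst p \<otimes> snd p))"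
    by (intro cont_of[OF A_D(2)[OF f]] continuous_mult_of continuous_map_fst continuous_map_snd)
  moreover have "tens (\<lambda>x y. f (fst (x, y) \<otimes> snd (x, y)))"
    using tens_comult[OF A_D(4)[OF f]] by simp
  ultimately have "restrict (\<lambda>p. f (fst p \<otimes> snd p)) (carrier G \<times> carrier G) \<in> closed_tensor T A"
    by (rule restrict_in_closed_tensor)
  from tensor_ext_restrict[OF this, of \<phi> \<psi>]
  have "tensor_ext \<phi> \<psi> (restrict (\<lambda>p. f (fst p \<otimes> snd p)) (carrier G \<times> carrier G)) = conv \<phi> \<psi> f"
    by (simp add: conv_def)
  moreover have "comult G f = restrict (\<lambda>p. f (fst p \<otimes> snd p)) (carrier G \<times> carrier G)"
    by (auto simp: comult_def fun_eq_iff)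
  ultimately show "tensor_functional T A \<phi> \<psi> (comult G f) = conv \<phi> \<psi> f"
    by (simp add: tensor_functional_eq[OF \<phi> \<psi>])
qed

lemma inA_conv_left:
  assumes "\<psi> \<in> maxspace" "inA F"
  shows "inA (\<lambda>x. app \<psi> (\<lambda>y. F (x \<otimes> y)))"
  by (rule inA_app_slice[OF tens_comult[OF assms(2)] assms(1)])

text \<open>Applying \<open>\<psi>\<close> in the variable \<open>y\<close> is an algebra
  homomorphism of \<open>A\<close> into itself, and \<open>\<phi>\<close> is multiplicative on the
  result.\<close>

lemma convolution_in_maxspace:
  assumes \<phi>: "\<phi> \<in> maxspace" and \<psi>: "\<psi> \<in> maxspace"
  shows "convolution G T A \<phi> \<psi> \<in> maxspace"
    "\<And>F. inA F \<Longrightarrow> app (convolution G T A \<phi> \<psi>) F = conv \<phi> \<psi> F"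
proof -
  have cong: "conv \<phi> \<psi> F = conv \<phi> \<psi> H" if "\<And>x. x \<in> carrier G \<Longrightarrow> F x = H x" for F H
    unfolding conv_def using that by (intro app_cong) simp
  have add: "conv \<phi> \<psi> (\<lambda>x. F x + H x) = conv \<phi> \<psi> F + conv \<phi> \<psi> H" if "inA F" "inA H" for F H
  proof -
    have "conv \<phi> \<psi> (\<lambda>x. F x + H x) =
        app \<phi> (\<lambda>x. app \<psi> (\<lambda>y. F (x \<otimes> y)) + app \<psi> (\<lambda>y. H (x \<otimes> y)))"
      unfolding conv_def using that by (intro app_cong app_add \<psi> inA_left_translate)
    then show ?thesis unfolding conv_def using app_add[OF \<phi>] inA_conv_left[OF \<psi>] that by simp
  qed
  have cmult: "conv \<phi> \<psi> (\<lambda>x. c * F x) = c * conv \<phi> \<psi> F" if "inA F" for c F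
  proof -
    have "conv \<phi> \<psi> (\<lambda>x. c * F x) = app \<phi> (\<lambda>x. c * app \<psi> (\<lambda>y. F (x \<otimes> y)))"
      unfolding conv_def using that by (intro app_cong app_cmult \<psi> inA_left_translate)
    then show ?thesis unfolding conv_def using app_cmult[OF \<phi>] inA_conv_left[OF \<psi>] that by simp
  qed
  have mult: "conv \<phi> \<psi> (\<lambda>x. F x * H x) = conv \<phi> \<psi> F * conv \<phi> \<psi> H" if "inA F" "inA H" for F H
  proof -
    have "conv \<phi> \<psi> (\<lambda>x. F x * H x) =
        app \<phi> (\<lambda>x. app \<psi> (\<lambda>y. F (x \<otimes> y)) * app \<psi> (\<lambda>y. H (x \<otimes> y)))"
      unfolding conv_def using that by (intro app_cong app_mult \<psi> inA_left_translate)
    then show ?thesis unfolding conv_def using app_mult[OF \<phi>] inA_conv_left[OF \<psi>] that by simp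
  qed
  have one: "conv \<phi> \<psi> (\<lambda>x. 1) = 1" by (simp add: conv_def app_const \<phi> \<psi>)
  show "convolution G T A \<phi> \<psi> \<in> maxspace"
    "\<And>F. inA F \<Longrightarrow> app (convolution G T A \<phi> \<psi>) F = conv \<phi> \<psi> F"
    unfolding convolution_eq[OF \<phi> \<psi>]
    using restrict_in_maxspace[of "conv \<phi> \<psi>", OF cong add cmult mult one] by blast+
qed

text \<open>Both sides apply \<open>\<theta>\<close>, \<open>\<psi>\<close> and
  \<open>\<phi>\<close> in turn to \<open>F (x \<otimes> y \<otimes> z)\<close>, from the last
  variable to the first.\<close>

lemma convolution_assoc:
  assumes \<phi>: "\<phi> \<in> maxspace" and \<psi>: "\<psi> \<in> maxspace" and \<theta>: "\<theta> \<in> maxspace"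
  shows "convolution G T A (convolution G T A \<phi> \<psi>) \<theta> = convolution G T A \<phi> (convolution G T A \<psi> \<theta>)"
proof (rule maxspace_eqI)
  note m = convolution_in_maxspace(1)
  show "convolution G T A (convolution G T A \<phi> \<psi>) \<theta> \<in> maxspace"
    "convolution G T A \<phi> (convolution G T A \<psi> \<theta>) \<in> maxspace"
    using assms by (auto intro: m)
  fix F assume F: "inA F"
  have "app (convolution G T A (convolution G T A \<phi> \<psi>) \<theta>) F =
      conv \<phi> \<psi> (\<lambda>x. app \<theta> (\<lambda>y. F (x \<otimes> y)))"
    using convolution_in_maxspace(2)[OF m[OF \<phi> \<psi>] \<theta> F]
      convolution_in_maxspace(2)[OF \<phi> \<psi> inA_conv_left[OF \<theta> F]] by (simp add: conv_def)
  also have "\<dots> = app \<phi> (\<lambda>x. conv \<psi> \<theta> (\<lambda>y. F (x \<otimes> y)))"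
    unfolding conv_def by (intro app_cong) (simp add: m_assoc)
  also have "\<dots> = app \<phi> (\<lambda>x. app (convolution G T A \<psi> \<theta>) (\<lambda>y. F (x \<otimes> y)))"
    using convolution_in_maxspace(2)[OF \<psi> \<theta>] F by (intro app_cong) (simp add: inA_left_translate)
  also have "\<dots> = app (convolution G T A \<phi> (convolution G T A \<psi> \<theta>)) F"
    using convolution_in_maxspace(2)[OF \<phi> m[OF \<psi> \<theta>] F] by (simp add: conv_def)
  finally show "app (convolution G T A (convolution G T A \<phi> \<psi>) \<theta>) F =
      app (convolution G T A \<phi> (convolution G T A \<psi> \<theta>)) F" .
qed

lemma convolution_ev_ev:
  assumes g: "g \<in> carrier G" and h: "h \<in> carrier G"
  shows "convolution G T A (ev A g) (ev A h) = ev A (g \<otimes> h)"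
proof (rule maxspace_eqI)
  fix F assume F: "inA F"
  have "conv (ev A g) (ev A h) F = app (ev A g) (\<lambda>x. F (x \<otimes> h))"
    unfolding conv_def using h F by (intro app_cong) (simp add: ev_in_maxspace inA_left_translate)
  also have "\<dots> = F (g \<otimes> h)" using g h F by (simp add: ev_in_maxspace inA_right_translate)
  finally show "app (convolution G T A (ev A g) (ev A h)) F = app (ev A (g \<otimes> h)) F"
    using g h F by (simp add: convolution_in_maxspace ev_in_maxspace)
qed (use g h in \<open>auto intro: convolution_in_maxspace ev_in_maxspace\<close>)

lemma convolution_ev_one:
  assumes \<phi>: "\<phi> \<in> maxspace"
  shows "convolution G T A (ev A \<one>) \<phi> = \<phi>" "convolution G T A \<phi> (ev A \<one>) = \<phi>"
proof -
  note e = ev_in_maxspace[OF one_closed]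
  show "convolution G T A (ev A \<one>) \<phi> = \<phi>"
  proof (rule maxspace_eqI[OF convolution_in_maxspace(1)[OF e(1) \<phi>] \<phi>])
    fix F assume F: "inA F"
    have "conv (ev A \<one>) \<phi> F = app \<phi> (\<lambda>y. F (\<one> \<otimes> y))"
      unfolding conv_def using e(2)[OF inA_conv_left[OF \<phi> F]] .
    also have "\<dots> = app \<phi> F" by (rule app_cong) simp
    finally show "app (convolution G T A (ev A \<one>) \<phi>) F = app \<phi> F"
      using convolution_in_maxspace(2)[OF e(1) \<phi> F] by simp
  qed
  show "convolution G T A \<phi> (ev A \<one>) = \<phi>"
  proof (rule maxspace_eqI[OF convolution_in_maxspace(1)[OF \<phi> e(1)] \<phi>])
    fix F assume F: "inA F"
    have "conv \<phi> (ev A \<one>) F = app \<phi> F"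
      unfolding conv_def by (rule app_cong) (simp add: e(2) inA_left_translate F)
    then show "app (convolution G T A \<phi> (ev A \<one>)) F = app \<phi> F"
      using convolution_in_maxspace(2)[OF \<phi> e(1) F] by simp
  qed
qed

subsection \<open>Divisors of evaluations\<close>

text \<open>An argument in the style of the Shilov boundary. If \<open>\<psi>\<close> is not a point evaluation, finitely
  many \<open>f \<in> A\<close> with \<open>\<psi>(f) = 0\<close> satisfy \<open>max |f| > 1\<close> everywhere on \<open>G\<close>, while
  \<open>W = {y. |(f * \<psi>)(y)| < 1 for all f}\<close> is a neighbourhood of the identity. Multiplying with high
  powers shows that the norm of \<open>F\<close> is still attained by \<open>F * \<psi>\<close> off any finite union of translates
  of \<open>W\<close>, although finitely many such translates cover \<open>G\<close>.\<close>

lemma norming_is_ev: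
  assumes \<psi>: "\<psi> \<in> maxspace"
    and norming: "\<And>F B x. inA F \<Longrightarrow> (\<And>y. y \<in> carrier G \<Longrightarrow> norm (app \<psi> (\<lambda>z. F (y \<otimes> z))) \<le> B) \<Longrightarrow>
      x \<in> carrier G \<Longrightarrow> norm (F x) \<le> B"
  shows "\<psi> \<in> ev A ` carrier G"
proof (rule ccontr)
  assume not_ev: "\<psi> \<notin> ev A ` carrier G"
  \<comment> \<open>\<open>\<alpha>\<close> is an algebra homomorphism of \<open>A\<close> into
    itself that commutes with left translations; by the norming hypothesis it does not decrease sup
    norms.\<close>
  define \<alpha> where "\<alpha> F y = app \<psi> (\<lambda>z. F (y \<otimes> z))" for F y
  have sep: "\<exists>f. inA f \<and> app \<psi> f = 0 \<and> norm (f g) > 1" if g: "g \<in> carrier G" for g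
  proof -
    have "\<psi> \<noteq> ev A g" using not_ev g by blast
    then obtain f where f: "inA f" "app \<psi> f \<noteq> f g"
      using maxspace_eqI[OF \<psi> ev_in_maxspace(1)[OF g]] ev_in_maxspace(2)[OF g] by metis
    define d where "d = f g - app \<psi> f"
    have d: "d \<noteq> 0" using f(2) by (simp add: d_def)
    \<comment> \<open>Subtracting \<open>app \<psi> f\<close> makes \<open>\<psi>\<close> vanish;
      the factor \<open>2 / d\<close> makes the modulus at \<open>g\<close> equal to 2.\<close>
    let ?h = "\<lambda>x. 2 / d * (f x - app \<psi> f)"
    have fd: "inA (\<lambda>x. f x - app \<psi> f)" by (intro inA_diff f(1) inA_const)
    have "app \<psi> ?h = 0"
      using app_cmult[OF \<psi> fd, of "2 / d"] app_diff[OF \<psi> f(1) inA_const, of "app \<psi> f"] app_const[OF \<psi>]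
      by simp
    moreover have "norm (?h g) > 1" using d by (simp add: d_def[symmetric] norm_mult norm_divide)
    moreover have "inA ?h" by (rule inA_cmult[OF fd])
    ultimately show ?thesis by blast
  qed
  then obtain f where f: "\<And>g. g \<in> carrier G \<Longrightarrow> inA (f g) \<and> app \<psi> (f g) = 0 \<and> norm (f g g) > 1"
    by metis
  define V where "V g = {x \<in> topspace T. f g x \<in> - cball 0 1}" for g
  have V: "openin T (V g)" if "g \<in> carrier G" for g
    unfolding V_def using f[OF that] inA_cont
    by (intro openin_continuous_map_preimage[of T euclidean]) auto
  have "g \<in> V g" if "g \<in> carrier G" for g using f[OF that] that by (simp add: V_def topspace_T)
  then have "topspace T \<subseteq> \<Union>(V ` carrier G)" unfolding topspace_T by blast
  then obtain D where D: "finite D" "D \<subseteq> V ` carrier G" "topspace T \<subseteq> \<Union>D"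
    using compact_T V unfolding compact_space_alt by (metis (no_types, lifting) imageE)
  then obtain S where S: "finite S" "S \<subseteq> carrier G" "D = V ` S"
    by (meson finite_subset_image)
  have big: "\<exists>g\<in>S. norm (f g x) > 1" if "x \<in> carrier G" for x
    using D(3) S(3) that by (force simp: V_def topspace_T)
  have inA_\<alpha>: "inA (\<alpha> F)" if "inA F" for F
    unfolding \<alpha>_def using inA_conv_left[OF \<psi> that] .
  define W where "W = {y \<in> topspace T. \<forall>g\<in>S. norm (\<alpha> (f g) y) < 1}"
  have "openin T W"
  proof -
    have "W = topspace T \<inter> (\<Inter>g\<in>S. {y \<in> topspace T. \<alpha> (f g) y \<in> ball 0 1})"
      by (auto simp: W_def)
    moreover have "openin T {y \<in> topspace T. \<alpha> (f g) y \<in> ball 0 1}" if "g \<in> S" for g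
      using inA_cont[OF inA_\<alpha>] f S(2) that
      by (intro openin_continuous_map_preimage[of T euclidean]) auto
    ultimately show ?thesis using S(1) by (auto intro: openin_Int_Inter)
  qed
  moreover have "\<one> \<in> W"
  proof -
    have "\<alpha> (f g) \<one> = 0" if "g \<in> S" for g
    proof -
      have "\<alpha> (f g) \<one> = app \<psi> (f g)" unfolding \<alpha>_def by (rule app_cong) simp
      then show ?thesis using f S(2) that by auto
    qed
    then show ?thesis by (simp add: W_def topspace_T)
  qed
  ultimately obtain xs where xs: "elts xs" "\<And>y. y \<in> carrier G \<Longrightarrow> \<exists>a\<in>set xs. a \<otimes> y \<in> W"
    using left_translates_cover by metis
  \<comment> \<open>\<open>Y\<close> indexes translates of \<open>W\<close> on which
    \<open>\<alpha> F\<close> is left uncontrolled. For the empty set this is the norming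
    hypothesis; each induction step gives up one more translate.\<close>
  have claim: "\<forall>F B. inA F \<longrightarrow> B \<ge> 0 \<longrightarrow>
      (\<forall>y\<in>carrier G. (\<forall>a\<in>Y. a \<otimes> y \<notin> W) \<longrightarrow> norm (\<alpha> F y) \<le> B) \<longrightarrow>
      (\<forall>x\<in>carrier G. norm (F x) \<le> B)" if "finite Y" "Y \<subseteq> carrier G" for Y
    using that
  proof (induction Y rule: finite_induct)
    case empty
    then show ?case using norming unfolding \<alpha>_def by auto
  next
    case (insert a Y)
    have a: "a \<in> carrier G" and Y: "Y \<subseteq> carrier G" using insert.prems by simp_all
    have IH: "norm (F x) \<le> B" if "inA F" "B \<ge> 0"
      "\<forall>y\<in>carrier G. (\<forall>a\<in>Y. a \<otimes> y \<notin> W) \<longrightarrow> norm (\<alpha> F y) \<le> B" "x \<in> carrier G" for F B x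
      using insert.IH[OF Y, THEN spec, THEN spec, THEN mp, THEN mp, THEN mp, THEN bspec, OF that] .
    show ?case
    proof (intro allI impI)
      fix F B assume F: "inA F" and B: "B \<ge> 0"
        and off: "\<forall>y\<in>carrier G. (\<forall>a'\<in>insert a Y. a' \<otimes> y \<notin> W) \<longrightarrow> norm (\<alpha> F y) \<le> B"
      have "compact ((\<lambda>x. norm (F x)) ` carrier G)"
        using image_compactin[of T "carrier G" euclidean "\<lambda>x. norm (F x)"] compact_T
          continuous_map_norm[OF inA_cont[OF F]] by (simp add: compact_space_def topspace_T)
      moreover have "(\<lambda>x. norm (F x)) ` carrier G \<noteq> {}" using one_closed by blast
      ultimately obtain x0 where x0: "x0 \<in> carrier G" "\<And>x. x \<in> carrier G \<Longrightarrow> norm (F x) \<le> norm (F x0)"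
        using compact_attains_sup[of "(\<lambda>x. norm (F x)) ` carrier G"] by auto
      define m where "m = norm (F x0)"
      have "m \<le> B"
      proof (rule ccontr)
        assume "\<not> m \<le> B"
        then have m: "m > B" "m > 0" using B by auto
        \<comment> \<open>Normalised at a maximum point, \<open>H\<close> has modulus 1 at
          \<open>x0\<close>, while \<open>\<alpha> H\<close> is at most 1 everywhere and at most
          \<open>q\<close> off all translates.\<close>
        define H where "H x = 1 / of_real m * F x" for x
        have H: "inA H" unfolding H_def by (rule inA_cmult[OF F])
        have H1: "norm (H x) \<le> 1" if "x \<in> carrier G" for x
          using x0(2)[OF that] m by (simp add: H_def norm_mult norm_divide m_def)
        have Hx0: "norm (H x0) = 1" using m by (simp add: H_def norm_mult norm_divide m_def)
        have \<alpha>H: "\<alpha> H y = 1 / of_real m * \<alpha> F y" if "y \<in> carrier G" for y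
          unfolding \<alpha>_def H_def by (rule app_cmult[OF \<psi> inA_left_translate[OF that F]])
        have \<alpha>H1: "norm (\<alpha> H y) \<le> 1" if "y \<in> carrier G" for y
          unfolding \<alpha>_def using H1 that by (intro norm_app_le[OF \<psi> inA_left_translate[OF that H]]) auto
        define q where "q = B / m"
        have q: "0 \<le> q" "q < 1" using m B by (simp_all add: q_def)
        have off': "norm (\<alpha> H y) \<le> q" if "y \<in> carrier G" "\<forall>a'\<in>insert a Y. a' \<otimes> y \<notin> W" for y
          using off that m by (simp add: \<alpha>H norm_mult norm_divide q_def divide_right_mono)
        \<comment> \<open>The translate \<open>k\<close> formed from this \<open>g\<close> exceeds 1
          at \<open>x0\<close>, yet \<open>\<alpha> k\<close> is below 1 wherever
          \<open>a \<otimes> y\<close> lies in \<open>W\<close>.\<close>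
        obtain g where g: "g \<in> S" "norm (f g (a \<otimes> x0)) > 1" using big[of "a \<otimes> x0"] a x0(1) by auto
        define k where "k x = f g (a \<otimes> x)" for x
        have fg: "inA (f g)" using f g(1) S(2) by blast
        have k: "inA k" unfolding k_def by (rule inA_left_translate[OF a fg])
        obtain C where C: "C > 0" "\<And>x. x \<in> carrier G \<Longrightarrow> norm (\<alpha> k x) \<le> C"
          using compact_bounded_norm[OF compact_T inA_cont[OF inA_\<alpha>[OF k]]] by (auto simp: topspace_T)
        have "(\<lambda>n. q ^ n * C) \<longlonglongrightarrow> 0 * C"
          using q by (intro tendsto_mult LIMSEQ_realpow_zero tendsto_const) auto
        then have "\<forall>\<^sub>F n in sequentially. q ^ n * C < 1"
          by (rule order_tendstoD(2)) simp
        then obtain n where n: "q ^ n * C < 1" by (auto simp: eventually_sequentially)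
        \<comment> \<open>Outside the remaining translates there are two cases: on the translate
          given by \<open>a\<close> the factor \<open>\<alpha> k\<close> is small, and off it the
          power of \<open>\<alpha> H\<close> outweighs the bound \<open>C\<close>. At
          \<open>x0\<close> the product keeps the modulus of \<open>k\<close>, which exceeds
          1.\<close>
        let ?P = "\<lambda>x. H x ^ n * k x"
        have P: "inA ?P" by (intro inA_mult inA_power H k)
        have \<alpha>P: "\<alpha> ?P y = \<alpha> H y ^ n * \<alpha> k y" if "y \<in> carrier G" for y
          unfolding \<alpha>_def using that
          by (simp add: app_mult[OF \<psi>] app_power[OF \<psi>] inA_power inA_left_translate[OF that] H k)
        have P1: "norm (\<alpha> ?P y) \<le> 1" if y: "y \<in> carrier G" and offY: "\<forall>a'\<in>Y. a' \<otimes> y \<notin> W" for y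
        proof (cases "a \<otimes> y \<in> W")
          case True
          have "\<alpha> k y = \<alpha> (f g) (a \<otimes> y)"
            unfolding \<alpha>_def k_def using a y by (intro app_cong) (simp add: m_assoc)
          then have "norm (\<alpha> k y) \<le> 1" using True g(1) by (auto simp: W_def intro: less_imp_le)
          moreover have "norm (\<alpha> H y) ^ n \<le> 1" using \<alpha>H1[OF y] by (simp add: power_le_one)
          ultimately have "norm (\<alpha> H y) ^ n * norm (\<alpha> k y) \<le> 1 * 1" by (intro mult_mono) auto
          then show ?thesis using \<alpha>P[OF y] by (simp add: norm_mult norm_power)
        next
          case False
          then have "norm (\<alpha> H y) \<le> q" using off' y offY by simp
          then have "norm (\<alpha> H y) ^ n * norm (\<alpha> k y) \<le> q ^ n * C"
            using C(2)[OF y] q(1) by (intro mult_mono power_mono) auto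
          then show ?thesis using \<alpha>P[OF y] n by (simp add: norm_mult norm_power)
        qed
        have "norm (?P x0) \<le> 1"
        proof (rule IH[OF P])
          show "\<forall>y\<in>carrier G. (\<forall>a\<in>Y. a \<otimes> y \<notin> W) \<longrightarrow> norm (\<alpha> ?P y) \<le> 1"
            using P1 by blast
        qed (use x0(1) in simp_all)
        then show False using Hx0 g(2) by (simp add: norm_mult norm_power k_def)
      qed
      then show "\<forall>x\<in>carrier G. norm (F x) \<le> B" using x0(2) by (force simp: m_def)
    qed
  qed
  have "set xs \<subseteq> carrier G" using xs(1) by (simp add: elts_def)
  note claim_xs = claim[OF finite_set this, THEN spec, THEN spec, THEN mp, THEN mp, THEN mp, THEN bspec]
  \<comment> \<open>The translates given by \<open>xs\<close> cover the group, so the condition off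
    them is void and the bound 0 becomes admissible.\<close>
  have "norm (1 :: complex) \<le> 0"
  proof (rule claim_xs[OF inA_const[of 1] order_refl _ one_closed])
    show "\<forall>y\<in>carrier G. (\<forall>a\<in>set xs. a \<otimes> y \<notin> W) \<longrightarrow> norm (\<alpha> (\<lambda>x. 1) y) \<le> 0"
      using xs(2) by blast
  qed
  then show False by simp
qed

text \<open>Since \<open>\<phi>\<close> is contractive, every value of \<open>F\<close> is bounded
  by the sup norm of \<open>x \<mapsto> app \<psi> (\<lambda>z. F (x \<otimes> z))\<close>, so
  \<open>\<psi>\<close> is norming. Once \<open>\<psi>\<close> is an evaluation, a right translation
  cancels it and \<open>\<phi>\<close> can be solved for.\<close>

lemma convolution_eq_ev_imp:
  assumes \<phi>: "\<phi> \<in> maxspace" and \<psi>: "\<psi> \<in> maxspace" and g: "g \<in> carrier G"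
    and eq: "convolution G T A \<phi> \<psi> = ev A g"
  shows "\<phi> \<in> ev A ` carrier G \<and> \<psi> \<in> ev A ` carrier G"
proof -
  have conv: "conv \<phi> \<psi> F = F g" if "inA F" for F
    using convolution_in_maxspace(2)[OF \<phi> \<psi> that] ev_in_maxspace(2)[OF g that] eq by simp
  have "\<psi> \<in> ev A ` carrier G"
  proof (rule norming_is_ev[OF \<psi>])
    fix F B x assume F: "inA F" and x: "x \<in> carrier G"
      and B: "\<And>y. y \<in> carrier G \<Longrightarrow> norm (app \<psi> (\<lambda>z. F (y \<otimes> z))) \<le> B"
    \<comment> \<open>Chosen so that \<open>h \<otimes> g = x\<close>: the product evaluates at
      \<open>g\<close>, and a left translation moves \<open>g\<close> to \<open>x\<close>.\<close>
    define h where "h = x \<otimes> inv g"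
    have h: "h \<in> carrier G" using x g by (simp add: h_def)
    have "F x = conv \<phi> \<psi> (\<lambda>z. F (h \<otimes> z))"
      using conv[OF inA_left_translate[OF h F]] x g by (simp add: h_def m_assoc)
    also have "norm \<dots> \<le> B"
      unfolding conv_def
    proof (rule norm_app_le[OF \<phi>])
      show "inA (\<lambda>x. app \<psi> (\<lambda>y. F (h \<otimes> (x \<otimes> y))))"
        by (rule inA_conv_left[OF \<psi> inA_left_translate[OF h F]])
      fix y assume y: "y \<in> carrier G"
      have "app \<psi> (\<lambda>z. F (h \<otimes> (y \<otimes> z))) = app \<psi> (\<lambda>z. F (h \<otimes> y \<otimes> z))"
        using h y by (intro app_cong) (simp add: m_assoc)
      then show "norm (app \<psi> (\<lambda>z. F (h \<otimes> (y \<otimes> z)))) \<le> B" using B[of "h \<otimes> y"] h y by simp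
    qed
    finally show "norm (F x) \<le> B" .
  qed
  then obtain h where h: "h \<in> carrier G" "\<psi> = ev A h" by blast
  have "\<phi> = ev A (g \<otimes> inv h)"
  proof (rule maxspace_eqI[OF \<phi> ev_in_maxspace(1)])
    fix F assume F: "inA F"
    have Fh: "inA (\<lambda>x. F (x \<otimes> inv h))" using h(1) F by (simp add: inA_right_translate)
    have "app \<phi> F = conv \<phi> \<psi> (\<lambda>x. F (x \<otimes> inv h))"
      unfolding conv_def h(2) using h(1)
      by (intro app_cong) (simp add: ev_in_maxspace(2)[OF h(1)] inA_left_translate[OF _ Fh] m_assoc)
    also have "\<dots> = F (g \<otimes> inv h)" by (rule conv[OF Fh])
    finally show "app \<phi> F = app (ev A (g \<otimes> inv h)) F"
      using g h(1) F by (simp add: ev_in_maxspace)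
  qed (use g h in simp)
  with \<open>\<psi> \<in> ev A ` carrier G\<close> g h(1) show ?thesis by blast
qed

subsection \<open>The weak-* topology\<close>

abbreviation maxtop :: "(('a \<Rightarrow> complex) \<Rightarrow> complex) topology" where
  "maxtop \<equiv> max_ideal_topology T A"

lemma topspace_maxtop: "topspace maxtop = maxspace"
  using maxspace_extensional by (auto simp: max_ideal_topology_def PiE_def)

lemma continuous_app:
  assumes "inA F"
  shows "continuous_map maxtop euclidean (\<lambda>\<phi>. app \<phi> F)"
  unfolding max_ideal_topology_def app_def using assms
  by (intro continuous_map_from_subtopology continuous_map_product_projection) (simp add: inA_def)

lemma continuous_map_maxtopI:
  assumes "\<And>x. x \<in> topspace X \<Longrightarrow> h x \<in> maxspace"
    and "\<And>f. f \<in> A \<Longrightarrow> continuous_map X euclidean (\<lambda>x. h x f)"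
  shows "continuous_map X maxtop h"
  using assms maxspace_extensional
  by (auto simp: max_ideal_topology_def continuous_map_in_subtopology continuous_map_componentwise)

lemma Hausdorff_maxtop: "Hausdorff_space maxtop"
  unfolding max_ideal_topology_def
  by (intro Hausdorff_space_subtopology) (simp add: Hausdorff_space_product_topology)

text \<open>The Banach-Alaoglu argument: contractivity places the space inside a product of discs,
  and its defining equations are closed for pointwise convergence.\<close>

lemma compact_maxtop: "compact_space maxtop"
proof -
  let ?P = "product_topology (\<lambda>f. euclidean :: complex topology) A"
  have proj: "continuous_map ?P euclidean (\<lambda>\<phi>. \<phi> f)" if "f \<in> A" for f
    using that by (rule continuous_map_product_projection)
  have topP: "topspace ?P = extensional A" by (simp add: PiE_def)
  have "\<exists>B. \<forall>x\<in>carrier G. norm (f x) \<le> B" if "f \<in> A" for f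
    using compact_bounded_norm[OF compact_T A_D(2)[OF that]] unfolding topspace_T by metis
  then obtain B where B: "\<And>f. f \<in> A \<Longrightarrow> (\<forall>x\<in>carrier G. norm (f x) \<le> B f)"
    by metis
  let ?K = "PiE A (\<lambda>f. cball 0 (B f))"
  have K: "compactin ?P ?K" by (simp add: compactin_PiE)
  have sub: "maxspace \<subseteq> ?K"
  proof
    fix \<phi> assume \<phi>: "\<phi> \<in> maxspace"
    have "norm (\<phi> f) \<le> B f" if "f \<in> A" for f
      using norm_app_le[OF \<phi> A_D(4)[OF that], of "B f"] B[OF that] that by (simp add: app_A)
    then show "\<phi> \<in> ?K" using maxspace_extensional[OF \<phi>] by (auto simp: PiE_def)
  qed
  let ?one = "\<lambda>x\<in>topspace T. 1 :: complex"
  have one: "?one \<in> A" using inA_const[of 1] by (simp add: inA_def topspace_T)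
  have clA: "(\<lambda>x\<in>topspace T. f x + g x) \<in> A" "(\<lambda>x\<in>topspace T. f x * g x) \<in> A"
    "(\<lambda>x\<in>topspace T. c * f x) \<in> A" if "f \<in> A" "g \<in> A" for f g c
    using closed_A that unfolding closed_subalgebra_def by blast+
  define S1 where "S1 = {\<phi> \<in> topspace ?P. \<forall>p\<in>A \<times> A.
      \<phi> (\<lambda>x\<in>topspace T. fst p x + snd p x) = \<phi> (fst p) + \<phi> (snd p)}"
  define S2 where "S2 = {\<phi> \<in> topspace ?P. \<forall>p\<in>A \<times> A.
      \<phi> (\<lambda>x\<in>topspace T. fst p x * snd p x) = \<phi> (fst p) * \<phi> (snd p)}"
  define S3 where "S3 = {\<phi> \<in> topspace ?P. \<forall>p\<in>UNIV \<times> A.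
      \<phi> (\<lambda>x\<in>topspace T. fst p * snd p x) = fst p * \<phi> (snd p)}"
  \<comment> \<open>Being nonzero is not a closed condition; for members of the space it can be
    replaced by the value 1 at the constant 1. The one-element index set gives the shape that
    \<open>closedin_continuous_eqs\<close> expects.\<close>
  define S4 where "S4 = {\<phi> \<in> topspace ?P. \<forall>p\<in>{()}. \<phi> ?one = 1}"
  have "closedin ?P S1" unfolding S1_def
    by (intro closedin_continuous_eqs[where Y = euclidean])
      (auto intro!: proj clA continuous_map_add)
  moreover have "closedin ?P S2" unfolding S2_def
  proof (intro closedin_continuous_eqs[where Y = euclidean] conjI)
    fix p assume p: "p \<in> A \<times> A"
    show "continuous_map ?P euclidean (\<lambda>\<phi>. \<phi> (\<lambda>x\<in>topspace T. fst p x * snd p x))"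
      using p by (auto intro!: proj clA)
    show "continuous_map ?P euclidean (\<lambda>\<phi>. \<phi> (fst p) * \<phi> (snd p))"
      using p by (intro continuous_map_binop[where h = "\<lambda>u v. u * v"] proj)
        (auto simp: case_prod_unfold intro!: continuous_intros)
  qed simp
  moreover have "closedin ?P S3" unfolding S3_def
  proof (intro closedin_continuous_eqs[where Y = euclidean] conjI)
    fix p :: "complex \<times> ('a \<Rightarrow> complex)" assume p: "p \<in> UNIV \<times> A"
    show "continuous_map ?P euclidean (\<lambda>\<phi>. \<phi> (\<lambda>x\<in>topspace T. fst p * snd p x))"
      using p by (auto intro!: proj clA)
    show "continuous_map ?P euclidean (\<lambda>\<phi>. fst p * \<phi> (snd p))"
      using p by (intro continuous_map_unop[where h = "\<lambda>z. fst p * z"] proj)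
        (auto intro!: continuous_intros)
  qed simp
  moreover have "closedin ?P S4" unfolding S4_def
    using proj[OF one] by (intro closedin_continuous_eqs[where Y = euclidean]) auto
  ultimately have "closedin ?P (S1 \<inter> S2 \<inter> S3 \<inter> S4)" by blast
  moreover have "maxspace = S1 \<inter> S2 \<inter> S3 \<inter> S4"
  proof
    show "maxspace \<subseteq> S1 \<inter> S2 \<inter> S3 \<inter> S4"
    proof
      fix \<phi> assume \<phi>: "\<phi> \<in> maxspace"
      have "\<phi> ?one = 1" using app_const[OF \<phi>, of 1] by (simp add: app_def topspace_T)
      then show "\<phi> \<in> S1 \<inter> S2 \<inter> S3 \<inter> S4"
        using maxspaceD[OF \<phi>] maxspace_extensional[OF \<phi>]
        unfolding S1_def S2_def S3_def S4_def topP by auto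
    qed
    show "S1 \<inter> S2 \<inter> S3 \<inter> S4 \<subseteq> maxspace"
    proof
      fix \<phi> assume "\<phi> \<in> S1 \<inter> S2 \<inter> S3 \<inter> S4"
      then have \<phi>: "\<phi> \<in> extensional A"
        "\<forall>p\<in>A \<times> A. \<phi> (\<lambda>x\<in>topspace T. fst p x + snd p x) = \<phi> (fst p) + \<phi> (snd p)"
        "\<forall>p\<in>A \<times> A. \<phi> (\<lambda>x\<in>topspace T. fst p x * snd p x) = \<phi> (fst p) * \<phi> (snd p)"
        "\<forall>p\<in>UNIV \<times> A. \<phi> (\<lambda>x\<in>topspace T. fst p * snd p x) = fst p * \<phi> (snd p)"
        "\<phi> ?one = 1"
        unfolding S1_def S2_def S3_def S4_def topP by auto
      have "\<exists>f\<in>A. \<phi> f \<noteq> 0" using one \<phi>(5) by (intro bexI[of _ ?one]) simp_all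
      moreover have "\<phi> (\<lambda>x\<in>topspace T. f x + g x) = \<phi> f + \<phi> g"
        "\<phi> (\<lambda>x\<in>topspace T. f x * g x) = \<phi> f * \<phi> g" if "f \<in> A" "g \<in> A" for f g
        using \<phi>(2)[rule_format, of "(f, g)"] \<phi>(3)[rule_format, of "(f, g)"] that by simp_all
      moreover have "\<phi> (\<lambda>x\<in>topspace T. c * f x) = c * \<phi> f" if "f \<in> A" for c f
        using \<phi>(4)[rule_format, of "(c, f)"] that by simp
      ultimately show "\<phi> \<in> maxspace"
        using \<phi>(1) unfolding max_ideal_space_def linear_functionals_def by blast
    qed
  qed
  ultimately have "closedin ?P maxspace" by simp
  from closed_compactin[OF K sub this] have "compactin ?P maxspace" .
  then show ?thesis unfolding max_ideal_topology_def by (simp add: compactin_subspace)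
qed

text \<open>For each \<open>f\<close> the value of the product is a uniform limit of sums of
  \<open>app \<phi> (a i) * app \<psi> (b i)\<close>, with the same \<open>a i\<close> and
  \<open>b i\<close> for all pairs. Joint continuity follows, not only separate continuity.\<close>

lemma continuous_convolution:
  "continuous_map (prod_topology maxtop maxtop) maxtop (\<lambda>(\<phi>, \<psi>). convolution G T A \<phi> \<psi>)"
proof (rule continuous_map_maxtopI)
  let ?X = "prod_topology maxtop maxtop"
  fix p assume "p \<in> topspace ?X"
  then show "(case p of (\<phi>, \<psi>) \<Rightarrow> convolution G T A \<phi> \<psi>) \<in> maxspace"
    by (auto simp: topspace_maxtop intro: convolution_in_maxspace)
next
  let ?X = "prod_topology maxtop maxtop"
  fix f assume f: "f \<in> A"
  show "continuous_map ?X euclidean (\<lambda>p. (case p of (\<phi>, \<psi>) \<Rightarrow> convolution G T A \<phi> \<psi>) f)"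
  proof (rule continuous_map_approximable)
    fix e :: real assume "e > 0"
    then obtain n :: nat and a b where n: "\<And>i. i < n \<Longrightarrow> inA (a i)" "\<And>i. i < n \<Longrightarrow> inA (b i)"
      "\<And>x y. x \<in> carrier G \<Longrightarrow> y \<in> carrier G \<Longrightarrow> norm (f (x \<otimes> y) - (\<Sum>i<n. a i x * b i y)) \<le> e"
      by (rule tensE[OF tens_comult[OF A_D(4)[OF f]]]) (rule that)
    let ?H = "\<lambda>p. \<Sum>i<n. app (fst p) (a i) * app (snd p) (b i)"
    have "continuous_map ?X euclidean ?H"
    proof (intro continuous_map_sum finite_lessThan)
      fix i assume "i \<in> {..<n}"
      then have i: "inA (a i)" "inA (b i)" using n by auto
      have "continuous_map ?X euclidean ((\<lambda>\<phi>. app \<phi> (a i)) \<circ> fst)"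
        "continuous_map ?X euclidean ((\<lambda>\<phi>. app \<phi> (b i)) \<circ> snd)"
        using continuous_map_compose[OF continuous_map_fst continuous_app[OF i(1)]]
          continuous_map_compose[OF continuous_map_snd continuous_app[OF i(2)]] by blast+
      then show "continuous_map ?X euclidean (\<lambda>p. app (fst p) (a i) * app (snd p) (b i))"
        unfolding o_def by (rule continuous_map_binop) (auto simp: case_prod_unfold intro!: continuous_intros)
    qed
    moreover have "norm ((case p of (\<phi>, \<psi>) \<Rightarrow> convolution G T A \<phi> \<psi>) f - ?H p) \<le> e"
      if pX: "p \<in> topspace ?X" for p
    proof -
      obtain \<phi> \<psi> where p: "p = (\<phi>, \<psi>)" "\<phi> \<in> maxspace" "\<psi> \<in> maxspace"
        using pX by (auto simp: topspace_maxtop)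
      show ?thesis
        using norm_app_app_le[OF tens_comult[OF A_D(4)[OF f]] p(2,3) n] f
        by (simp add: p(1) convolution_eq[OF p(2,3)] conv_def)
    qed
    ultimately show "\<exists>H. continuous_map ?X euclidean H \<and> (\<forall>p\<in>topspace ?X.
        norm ((case p of (\<phi>, \<psi>) \<Rightarrow> convolution G T A \<phi> \<psi>) f - H p) \<le> e)" by blast
  qed
qed

subsection \<open>The involution\<close>

text \<open>The two conjugations cancel, so the functional is complex linear;
  \<open>inA_star\<close> keeps its argument in \<open>A\<close>.\<close>

lemma involution_in_maxspace:
  assumes \<phi>: "\<phi> \<in> maxspace"
  shows "involution G A \<phi> \<in> maxspace"
    "\<And>F. inA F \<Longrightarrow> app (involution G A \<phi>) F = cnj (app \<phi> (\<lambda>x. cnj (F (inv x))))"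
proof -
  let ?\<Phi> = "\<lambda>F. cnj (app \<phi> (\<lambda>x. cnj (F (inv x))))"
  have eq: "involution G A \<phi> = restrict ?\<Phi> A"
    by (simp add: involution_def star_fun_def app_def)
  have cong: "?\<Phi> F = ?\<Phi> H" if "\<And>x. x \<in> carrier G \<Longrightarrow> F x = H x" for F H
    using app_cong[of "\<lambda>x. cnj (F (inv x))" "\<lambda>x. cnj (H (inv x))" \<phi>] that by simp
  have add: "?\<Phi> (\<lambda>x. F x + H x) = ?\<Phi> F + ?\<Phi> H" if "inA F" "inA H" for F H
    using that by (simp add: app_add[OF \<phi>] inA_star)
  have cmult: "?\<Phi> (\<lambda>x. c * F x) = c * ?\<Phi> F" if "inA F" for c F
    using that by (simp add: app_cmult[OF \<phi>] inA_star)
  have mult: "?\<Phi> (\<lambda>x. F x * H x) = ?\<Phi> F * ?\<Phi> H" if "inA F" "inA H" for F H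
    using that by (simp add: app_mult[OF \<phi>] inA_star)
  have one: "?\<Phi> (\<lambda>x. 1) = 1" by (simp add: app_const[OF \<phi>])
  show "involution G A \<phi> \<in> maxspace"
    "\<And>F. inA F \<Longrightarrow> app (involution G A \<phi>) F = ?\<Phi> F"
    unfolding eq using restrict_in_maxspace[of ?\<Phi>, OF cong add cmult mult one] by blast+
qed

lemma involution_involution:
  assumes \<phi>: "\<phi> \<in> maxspace"
  shows "involution G A (involution G A \<phi>) = \<phi>"
proof (rule maxspace_eqI)
  note i = involution_in_maxspace
  show "involution G A (involution G A \<phi>) \<in> maxspace" by (intro i(1) \<phi>)
  fix F assume F: "inA F"
  have "app (involution G A (involution G A \<phi>)) F = app \<phi> (\<lambda>x. F (inv (inv x)))"
    by (simp add: i(2)[OF i(1)[OF \<phi>] F] i(2)[OF \<phi> inA_star[OF F]])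
  also have "\<dots> = app \<phi> F" by (rule app_cong) simp
  finally show "app (involution G A (involution G A \<phi>)) F = app \<phi> F" .
qed (rule \<phi>)

text \<open>Inversion reverses products and so puts the variables in the order opposite to that of
  \<open>conv\<close>; \<open>app_app_commute\<close> restores it.\<close>

lemma involution_convolution:
  assumes \<phi>: "\<phi> \<in> maxspace" and \<psi>: "\<psi> \<in> maxspace"
  shows "involution G A (convolution G T A \<phi> \<psi>) =
    convolution G T A (involution G A \<psi>) (involution G A \<phi>)"
proof (rule maxspace_eqI)
  note i = involution_in_maxspace and c = convolution_in_maxspace
  show "involution G A (convolution G T A \<phi> \<psi>) \<in> maxspace"
    "convolution G T A (involution G A \<psi>) (involution G A \<phi>) \<in> maxspace"
    by (intro i(1) c(1) \<phi> \<psi>)+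
  fix F assume F: "inA F"
  define K where "K x = cnj (F (inv x))" for x
  have K: "inA K" unfolding K_def by (rule inA_star[OF F])
  have "app (convolution G T A (involution G A \<psi>) (involution G A \<phi>)) F =
      app (involution G A \<psi>) (\<lambda>x. app (involution G A \<phi>) (\<lambda>y. F (x \<otimes> y)))"
    by (simp add: c(2)[OF i(1)[OF \<psi>] i(1)[OF \<phi>] F] conv_def)
  also have "\<dots> = cnj (app \<psi> (\<lambda>x. cnj (app (involution G A \<phi>) (\<lambda>y. F (inv x \<otimes> y)))))"
    by (rule i(2)[OF \<psi> inA_conv_left[OF i(1)[OF \<phi>] F]])
  also have "app \<psi> (\<lambda>x. cnj (app (involution G A \<phi>) (\<lambda>y. F (inv x \<otimes> y)))) =
      app \<psi> (\<lambda>x. app \<phi> (\<lambda>y. K (y \<otimes> x)))"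
  proof (rule app_cong)
    fix x assume x: "x \<in> carrier G"
    have "cnj (app (involution G A \<phi>) (\<lambda>y. F (inv x \<otimes> y))) =
        app \<phi> (\<lambda>y. cnj (F (inv x \<otimes> inv y)))"
      using i(2)[OF \<phi> inA_left_translate[of "inv x", OF _ F]] x by simp
    also have "\<dots> = app \<phi> (\<lambda>y. K (y \<otimes> x))"
      unfolding K_def using x by (intro app_cong) (simp add: inv_mult_group)
    finally show "cnj (app (involution G A \<phi>) (\<lambda>y. F (inv x \<otimes> y))) = app \<phi> (\<lambda>y. K (y \<otimes> x))" .
  qed
  also have "\<dots> = conv \<phi> \<psi> K"
    unfolding conv_def by (rule app_app_commute[OF tens_comult[OF K] \<phi> \<psi>, symmetric])
  also have "cnj \<dots> = app (involution G A (convolution G T A \<phi> \<psi>)) F"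
    using i(2)[OF c(1)[OF \<phi> \<psi>] F] c(2)[OF \<phi> \<psi> K] by (simp add: K_def[abs_def])
  finally show "app (involution G A (convolution G T A \<phi> \<psi>)) F =
      app (convolution G T A (involution G A \<psi>) (involution G A \<phi>)) F" ..
qed

lemma involution_ev:
  assumes g: "g \<in> carrier G"
  shows "involution G A (ev A g) = ev A (inv g)"
proof (rule maxspace_eqI)
  show "involution G A (ev A g) \<in> maxspace" "ev A (inv g) \<in> maxspace"
    using g by (auto intro: involution_in_maxspace ev_in_maxspace)
  fix F assume F: "inA F"
  show "app (involution G A (ev A g)) F = app (ev A (inv g)) F"
    using g F by (simp add: involution_in_maxspace ev_in_maxspace inA_star)
qed

lemma continuous_involution: "continuous_map maxtop maxtop (involution G A)"
proof (rule continuous_map_maxtopI)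
  show "involution G A \<phi> \<in> maxspace" if "\<phi> \<in> topspace maxtop" for \<phi>
    using that by (simp add: topspace_maxtop involution_in_maxspace)
  fix f assume f: "f \<in> A"
  have "continuous_map maxtop euclidean (\<lambda>\<phi>. cnj (app \<phi> (\<lambda>x. cnj (f (inv x)))))"
    by (rule continuous_map_unop[OF continuous_app[OF inA_star[OF A_D(4)[OF f]]]])
      (intro continuous_intros)
  then show "continuous_map maxtop euclidean (\<lambda>\<phi>. involution G A \<phi> f)"
    using f by (simp add: involution_def star_fun_def app_def)
qed

end

theorem theorem1:
  fixes G :: "('a, 'b) monoid_scheme" and T :: "'a topology" and A :: "('a \<Rightarrow> complex) set"
  assumes "compact_Hausdorff_group G T"
    and "invariant_algebra G T A"
    and "separating G A"
  shows "let M = max_ideal_monoid G T A; X = max_ideal_topology T A; G' = ev A ` carrier G in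
     compact_topological_semigroup M X \<and>
     ev A \<in> hom G M \<and> embedding_map T X (ev A) \<and>
     monoid M \<and> \<one>\<^bsub>M\<^esub> = ev A \<one>\<^bsub>G\<^esub> \<and>
     Units M = G' \<and> ev A \<in> iso G (units_of M) \<and>
     (\<forall>\<phi>\<in>carrier M. \<forall>\<psi>\<in>carrier M. \<phi> \<otimes>\<^bsub>M\<^esub> \<psi> \<in> G' \<longrightarrow> \<phi> \<in> G' \<and> \<psi> \<in> G') \<and>
     involutive_antiautomorphism M X (involution G A) \<and>
     (\<forall>g\<in>carrier G. involution G A (ev A g) = ev A (inv\<^bsub>G\<^esub> g))"
proof -
  interpret group G using assms(1) by (simp add: compact_Hausdorff_group_def)
  interpret invariant_alg G T A
    using assms(1,2) by unfold_locales (auto simp: compact_Hausdorff_group_def)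
  define M where "M = max_ideal_monoid G T A"
  have M: "carrier M = maxspace" "mult M = convolution G T A" "one M = ev A \<one>\<^bsub>G\<^esub>"
    by (simp_all add: M_def max_ideal_monoid_def)
  \<comment> \<open>Separation enters here: an element of \<open>A\<close> that distinguishes two
    points distinguishes their evaluations.\<close>
  have inj: "inj_on (ev A) (carrier G)"
  proof (rule inj_onI, rule ccontr)
    fix x y assume xy: "x \<in> carrier G" "y \<in> carrier G" "ev A x = ev A y" "x \<noteq> y"
    then obtain f where f: "f \<in> A" "f x \<noteq> f y" using assms(3) unfolding separating_def by blast
    then show False using fun_cong[OF xy(3), of f] by (simp add: ev_def)
  qed
  have monoid: "monoid M"
    by (rule monoidI) (simp_all add: M convolution_in_maxspace ev_in_maxspace convolution_assoc convolution_ev_one)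
  have semigroup: "compact_topological_semigroup M maxtop"
    unfolding compact_topological_semigroup_def M
    using compact_maxtop Hausdorff_maxtop continuous_convolution
    by (simp add: topspace_maxtop convolution_in_maxspace convolution_assoc)
  have hom: "ev A \<in> hom G M"
    by (rule homI) (simp_all add: M ev_in_maxspace convolution_ev_ev)
  \<comment> \<open>A continuous injection of a compact space into a Hausdorff space is an
    embedding.\<close>
  have emb: "embedding_map T maxtop (ev A)"
  proof (rule continuous_imp_embedding_map)
    show "continuous_map T maxtop (ev A)"
    proof (rule continuous_map_maxtopI)
      show "ev A x \<in> maxspace" if "x \<in> topspace T" for x
        using that by (simp add: topspace_T ev_in_maxspace)
      show "continuous_map T euclidean (\<lambda>x. ev A x f)" if "f \<in> A" for f
        using A_D(2)[OF that] that by (simp add: ev_def)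
    qed
  qed (use compact_T Hausdorff_maxtop inj in \<open>simp_all add: topspace_T\<close>)
  have absorb: "\<phi> \<in> ev A ` carrier G \<and> \<psi> \<in> ev A ` carrier G"
    if "\<phi> \<in> maxspace" "\<psi> \<in> maxspace" "convolution G T A \<phi> \<psi> \<in> ev A ` carrier G" for \<phi> \<psi>
    using that convolution_eq_ev_imp by blast
  have Units: "Units M = ev A ` carrier G"
  proof
    \<comment> \<open>The product of a unit with its inverse is the evaluation at the identity, so
      the divisor property applies.\<close>
    show "Units M \<subseteq> ev A ` carrier G"
      using absorb one_closed unfolding Units_def M by fastforce
    show "ev A ` carrier G \<subseteq> Units M"
    proof
      fix \<phi> assume "\<phi> \<in> ev A ` carrier G"
      then obtain g where g: "g \<in> carrier G" "\<phi> = ev A g" by blast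
      then show "\<phi> \<in> Units M"
        unfolding Units_def M
        by (auto simp: ev_in_maxspace convolution_ev_ev intro!: bexI[of _ "ev A (inv\<^bsub>G\<^esub> g)"])
    qed
  qed
  have iso: "ev A \<in> iso G (units_of M)"
    using inj by (auto simp: iso_def hom_def bij_betw_def units_of_def Units M convolution_ev_ev)
  \<comment> \<open>The map is its own inverse, so its continuity covers both directions.\<close>
  have "homeomorphic_map maxtop maxtop (involution G A)"
    unfolding homeomorphic_map_maps homeomorphic_maps_def
    using continuous_involution involution_involution topspace_maxtop by blast
  moreover have "bij_betw (involution G A) maxspace maxspace"
    by (rule bij_betw_byWitness[where f' = "involution G A"])
      (auto simp: involution_involution involution_in_maxspace)
  ultimately have anti: "involutive_antiautomorphism M maxtop (involution G A)"
    unfolding involutive_antiautomorphism_def M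
    by (simp add: involution_convolution involution_involution)
  show ?thesis
    unfolding Let_def M_def[symmetric]
    using semigroup hom emb monoid Units iso absorb anti involution_ev by (simp add: M)
qed

end
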